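(* Let $\mu$ be a finite even Borel measure on $S^{n-1}$ that is not concentrated in any closed hemisphere. Then for each $0<\alpha<\frac1n$ there exists an $o$-symmetric convex body $K$ in $\mathbb{R}^n$ such that $$\mu = c\,S_{\gamma_n,K},\qquad\text{where } c=\frac{1}{\gamma_n(K)^{1-\alpha}} .$$
   Context: A convex body in $\mathbb{R}^n$ is a compact convex set with nonempty interior; it is $o$-symmetric if $K=-K$. A Borel measure $\mu$ on the unit sphere $S^{n-1}$ is even if $\mu(\eta)=\mu(-\eta)$ for all Borel $\eta$; it is not concentrated in any closed hemisphere if for every closed hemisphere $H=\{u\in S^{n-1}:u\cdot v\ge 0\}$, $v \in S^{n-1}$, one has $\mu(S^{n-1}\setminus H)>0$. $\gamma_n$ is the Gaussian probability measure, $\gamma_n(E)=\frac{1}{(\sqrt{2\pi})^n}\int_E e^{-|x|^2/2}\,dx$, and $\mathcal{H}^{n-1}$ is $(n-1)$-dimensional Hausdorff measure. For a convex body $K$ and $\eta\subset S^{n-1}$, let $\nu_K^{-1}(\eta)$ be the set of $x\in\partial K$ for which there exists $v\in\eta$ that is an outer unit normal of $K$ at $x$ (i.e. $x\cdot v=\max_{y\in K} y\cdot v$). The Gaussian surface area measure $S_{\gamma_n,K}$ of a convex body $K$ containing the origin in its interior is the Borel measure on $S^{n-1}$ given by $$S_{\gamma_n,K}(\eta)=\frac{1}{(\sqrt{2\pi})^n}\int_{\nu_K^{-1}(\eta)}e^{-\frac{|x|^2}{2}}\,d\mathcal{H}^{n-1}(x)$$ for Borel $\eta\subset S^{n-1}$.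 *)

theory Defs
  imports "HOL-Analysis.Analysis"
begin

definition convex_body :: "(real ^ 'n) set \<Rightarrow> bool" where
  "convex_body K \<longleftrightarrow> compact K \<and> convex K \<and> interior K \<noteq> {}"

definition o_symmetric :: "(real ^ 'n) set \<Rightarrow> bool" where
  "o_symmetric K \<longleftrightarrow> K = uminus ` K"

definition sphere_borel :: "(real ^ 'n) measure" where
  "sphere_borel = restrict_space borel (sphere 0 1)"

definition even_measure :: "(real ^ 'n) measure \<Rightarrow> bool" where
  "even_measure \<mu> \<longleftrightarrow> (\<forall>\<eta>\<in>sets \<mu>. emeasure \<mu> \<eta> = emeasure \<mu> (uminus ` \<eta>))"

definition closed_hemisphere :: "real ^ 'n \<Rightarrow> (real ^ 'n) set" where
  "closed_hemisphere v = {u \<in> sphere 0 1. u \<bullet> v \<ge> 0}"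

definition not_concentrated_in_hemisphere :: "(real ^ 'n) measure \<Rightarrow> bool" where
  "not_concentrated_in_hemisphere \<mu> \<longleftrightarrow>
     (\<forall>v\<in>sphere 0 1. emeasure \<mu> (sphere 0 1 - closed_hemisphere v) > 0)"

definition gaussian_measure :: "(real ^ 'n) measure" where
  "gaussian_measure =
     density lborel (\<lambda>x. ennreal (1 / sqrt (2 * pi) ^ CARD('n) * exp (- ((norm x)\<^sup>2) / 2)))"

text \<open>
  Hausdorff measure of integer dimension \<open>s\<close>, with the normalisation for which the
  \<open>s\<close>-dimensional measure on \<open>s\<close>-dimensional Euclidean space is Lebesgue measure.  Nonempty sets of
  diameter zero get weight \<open>0 ^ 0 = 1\<close> for \<open>s = 0\<close>, so that case is counting measure.  The
  boundedness condition on the covering sets is needed because \<^const>\<open>diameter\<close> carries no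
  information on unbounded sets.
\<close>

definition hausdorff_weight :: "nat \<Rightarrow> 'a::metric_space set \<Rightarrow> ennreal" where
  "hausdorff_weight s U =
     (if U = {} then 0 else ennreal (unit_ball_vol (real s) * (diameter U / 2) ^ s))"

definition hausdorff_premeasure :: "nat \<Rightarrow> real \<Rightarrow> 'a::metric_space set \<Rightarrow> ennreal" where
  "hausdorff_premeasure s \<delta> E =
     (INF U \<in> {U :: nat \<Rightarrow> 'a set. E \<subseteq> (\<Union>i. U i) \<and> (\<forall>i. bounded (U i) \<and> diameter (U i) \<le> \<delta>)}.
        \<Sum>i. hausdorff_weight s (U i))"

definition hausdorff_outer :: "nat \<Rightarrow> 'a::metric_space set \<Rightarrow> ennreal" where
  "hausdorff_outer s E = (SUP \<delta> \<in> {0<..}. hausdorff_premeasure s \<delta> E)"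

text \<open>
  The sigma-algebra consists of all Caratheodory measurable sets rather than only the Borel sets:
  the sets \<open>reverse_gauss_image K \<eta>\<close> below need not be Borel, but they are Caratheodory measurable.
\<close>

definition hausdorff_measure :: "nat \<Rightarrow> 'a::metric_space measure" where
  "hausdorff_measure s =
     measure_of UNIV (lambda_system UNIV (Pow UNIV) (hausdorff_outer s)) (hausdorff_outer s)"

definition reverse_gauss_image :: "(real ^ 'n) set \<Rightarrow> (real ^ 'n) set \<Rightarrow> (real ^ 'n) set" where
  "reverse_gauss_image K \<eta> = {x \<in> frontier K. \<exists>v\<in>\<eta>. \<forall>y\<in>K. y \<bullet> v \<le> x \<bullet> v}"

text \<open>
  Intended for convex bodies with the origin in the interior.  The set function below is countably
  additive for every convex body \<open>K\<close>, because almost every boundary point has a unique outer unit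
  normal; this is what makes it the value of the \<^const>\<open>measure_of\<close> construction.
\<close>

definition gaussian_surface_area :: "(real ^ 'n) set \<Rightarrow> (real ^ 'n) measure" where
  "gaussian_surface_area K =
     measure_of (sphere 0 1) (sets sphere_borel)
       (\<lambda>\<eta>. ennreal (1 / sqrt (2 * pi) ^ CARD('n)) *
          (\<integral>\<^sup>+x\<in>reverse_gauss_image K \<eta>. ennreal (exp (- ((norm x)\<^sup>2) / 2))
             \<partial>hausdorff_measure (CARD('n) - 1)))"

end

(*
  Among o-symmetric compact convex sets L consider the functional gamma(L)^alpha / alpha - t int h_L d mu,
  where h_L is the support function. Since mu is even and not concentrated in a hemisphere, sets on which the
  functional is nonnegative are uniformly bounded, and because alpha < 1/n small balls give positive values;
  so a maximizer K exists and has interior points. Its Euler-Lagrange equation is the assertion.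

  The factor t is free, so the normalisation of Hausdorff measure is irrelevant: on hyperplanes it is a
  constant multiple of Lebesgue measure by uniqueness of Haar measure, and t absorbs the constant.

  The Euler-Lagrange equation is proved as two inequalities on pieces of the boundary whose normals are close to
  a fixed vector v. Such a piece is almost isometric to its projection along v. Pushing it outwards (and
  taking the convex hull) bounds the surface measure by mu, cutting off a cap bounds mu by the surface measure,
  with factors that tend to 1 as the pieces shrink. Points with several normals form a null set.
*)

theory Submission
  imports Defs "HOL-Probability.Distributions" "HOL-Complex_Analysis.Great_Picard"
begin

section \<open>Hausdorff measure\<close>

text \<open>No derivative of Gaussian volume is computed. A perturbed body \<open>L\<close> comes
  with one-sided estimates of its volume and of its support function, and the errors have the sign
  that maximality tolerates: the convex hull may gain more volume than the pushed piece, and a cut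
  may lower the support function in further directions. So the support function of \<open>L\<close>
  is never identified. The constant c is the derivative of s^\<alpha>/\<alpha> at s = gamma(K);
  concavity bounds increments by tangents at gamma(L), and dilates of K control gamma(L).
  Competitors must be symmetric, so each perturbation is made at a piece and at its mirror image,
  and evenness of mu removes the factor 2.

  The boundary is treated as a graph twice: over radial directions with a crude Lipschitz constant,
  enough for finite area and null sets, and over directions near a normal with constant 1 - e, for
  the sharp comparison. Perturbed pieces are compact, which gives uniform margins and Borel
  projections; inner regularity then reaches all Borel sets of normals.\<close>

lemma hausdorff_weight_mono:
  assumes "A \<subseteq> B" "bounded B"
  shows "hausdorff_weight s A \<le> hausdorff_weight s B"
proof (cases "A = {}")
  case False
  then have "0 \<le> diameter A" "diameter A \<le> diameter B" "B \<noteq> {}"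
    using assms diameter_ge_0[OF bounded_subset[OF assms(2,1)]] diameter_subset[OF assms] by auto
  then show ?thesis using False
    by (auto simp: hausdorff_weight_def intro!: ennreal_leI mult_left_mono power_mono divide_right_mono)
qed (simp add: hausdorff_weight_def)

lemma hausdorff_premeasure_le:
  assumes "E \<subseteq> (\<Union>i. U i)" "\<And>i. bounded (U i)" "\<And>i. diameter (U i) \<le> \<delta>"
  shows "hausdorff_premeasure s \<delta> E \<le> (\<Sum>i. hausdorff_weight s (U i))"
  unfolding hausdorff_premeasure_def by (rule INF_lower) (use assms in auto)

lemma hausdorff_premeasure_greatest:
  assumes "\<And>U. E \<subseteq> (\<Union>i. U i) \<Longrightarrow> (\<And>i. bounded (U i)) \<Longrightarrow> (\<And>i. diameter (U i) \<le> \<delta>)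
    \<Longrightarrow> c \<le> (\<Sum>i. hausdorff_weight s (U i))"
  shows "c \<le> hausdorff_premeasure s \<delta> E"
  unfolding hausdorff_premeasure_def by (rule INF_greatest) (use assms in auto)

lemma hausdorff_premeasure_antimono:
  "\<delta> \<le> \<delta>' \<Longrightarrow> hausdorff_premeasure s \<delta>' E \<le> hausdorff_premeasure s \<delta> E"
  by (rule hausdorff_premeasure_greatest, rule hausdorff_premeasure_le) (auto intro: order_trans)

lemma hausdorff_premeasure_mono:
  "E \<subseteq> F \<Longrightarrow> hausdorff_premeasure s \<delta> E \<le> hausdorff_premeasure s \<delta> F"
  by (rule hausdorff_premeasure_greatest, rule hausdorff_premeasure_le) auto

lemma hausdorff_premeasure_le_outer:
  "0 < \<delta> \<Longrightarrow> hausdorff_premeasure s \<delta> E \<le> hausdorff_outer s E"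
  unfolding hausdorff_outer_def by (rule SUP_upper) auto

lemma hausdorff_outer_least:
  "(\<And>\<delta>. 0 < \<delta> \<Longrightarrow> hausdorff_premeasure s \<delta> E \<le> c) \<Longrightarrow> hausdorff_outer s E \<le> c"
  unfolding hausdorff_outer_def by (rule SUP_least) auto

lemma hausdorff_outer_mono: "E \<subseteq> F \<Longrightarrow> hausdorff_outer s E \<le> hausdorff_outer s F"
  by (meson hausdorff_outer_least hausdorff_premeasure_le_outer hausdorff_premeasure_mono order_trans)

lemma hausdorff_outer_empty [simp]: "hausdorff_outer s {} = 0"
proof -
  have "hausdorff_outer s {} \<le> 0"
  proof (rule hausdorff_outer_least)
    fix \<delta> :: real assume "0 < \<delta>"
    then show "hausdorff_premeasure s \<delta> {} \<le> (0::ennreal)"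
      using hausdorff_premeasure_le[of "{}" "\<lambda>_. {}" \<delta> s] by (simp add: hausdorff_weight_def)
  qed
  then show ?thesis by simp
qed

text \<open>Covers of the \<open>A n\<close> that exceed the infimum by at most e/2^(n+1) are merged
  into one sequence through the pairing function; the excesses add up to e.\<close>

lemma hausdorff_premeasure_subadditive:
  "hausdorff_premeasure s \<delta> (\<Union>i. A i) \<le> (\<Sum>i. hausdorff_premeasure s \<delta> (A i))"
proof (rule ennreal_le_epsilon)
  let ?O = "hausdorff_premeasure s \<delta>"
  fix e :: real assume e: "0 < e" "(\<Sum>n. ?O (A n)) < top"
  then have lt: "\<And>n. ?O (A n) < ?O (A n) + e * (1/2)^Suc n"
    by (auto simp add: less_top dest!: ennreal_suminf_lessD)
  have "\<exists>U. A n \<subseteq> (\<Union>i. U i) \<and> (\<forall>i. bounded (U i) \<and> diameter (U i) \<le> \<delta>) \<and>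
      (\<Sum>i. hausdorff_weight s (U i)) \<le> ?O (A n) + e * (1/2)^Suc n" for n
    using lt[of n] unfolding hausdorff_premeasure_def INF_less_iff
    by (metis (mono_tags, lifting) less_imp_le mem_Collect_eq)
  then obtain B where B: "\<And>n. A n \<subseteq> (\<Union>i. B n i)"
    "\<And>n i. bounded (B n i)" "\<And>n i. diameter (B n i) \<le> \<delta>"
    "\<And>n. (\<Sum>i. hausdorff_weight s (B n i)) \<le> ?O (A n) + e * (1/2)^Suc n"
    by metis
  define C where "C = case_prod B o prod_decode"
  have "(\<Union>i. A i) \<subseteq> (\<Union>i. C i)"
    using B(1) by (auto simp add: C_def subset_eq) (metis prod.case prod_encode_inverse)
  moreover have "bounded (C i)" "diameter (C i) \<le> \<delta>" for i
    using B by (auto simp: C_def split: prod.split)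
  ultimately have "?O (\<Union>i. A i) \<le> (\<Sum>i. hausdorff_weight s (C i))"
    by (rule hausdorff_premeasure_le)
  also have "\<dots> = (\<Sum>i. case_prod (\<lambda>n i. hausdorff_weight s (B n i)) (prod_decode i))"
    by (simp add: C_def split_def)
  also have "\<dots> = (\<Sum>n. \<Sum>i. hausdorff_weight s (B n i))"
    using suminf_ennreal_2dimen[of "\<lambda>n. \<Sum>i. hausdorff_weight s (B n i)" "case_prod (\<lambda>n i. hausdorff_weight s (B n i))"]
    by (simp add: comp_def)
  also have "\<dots> \<le> (\<Sum>n. ?O (A n) + e * (1/2) ^ Suc n)"
    using B by (intro suminf_le suminf_nonneg allI B(4)) auto
  also have "... = (\<Sum>n. ?O (A n)) + (\<Sum>n. ennreal e * ennreal ((1/2) ^ Suc n))"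
    using \<open>0 < e\<close> by (subst suminf_add[symmetric])
      (auto simp del: ennreal_suminf_cmult simp add: ennreal_mult[symmetric])
  also have "\<dots> = (\<Sum>n. ?O (A n)) + e"
    unfolding ennreal_suminf_cmult
    by (subst suminf_ennreal_eq[OF zero_le_power power_half_series]) auto
  finally show "?O (\<Union>i. A i) \<le> (\<Sum>n. ?O (A n)) + e" .
qed

lemma hausdorff_outer_subadditive:
  "hausdorff_outer s (\<Union>i. A i) \<le> (\<Sum>i. hausdorff_outer s (A i))"
proof (rule hausdorff_outer_least)
  fix \<delta> :: real assume "0 < \<delta>"
  then have "(\<Sum>i. hausdorff_premeasure s \<delta> (A i)) \<le> (\<Sum>i. hausdorff_outer s (A i))"
    by (intro suminf_le hausdorff_premeasure_le_outer) auto
  then show "hausdorff_premeasure s \<delta> (\<Union>i. A i) \<le> (\<Sum>i. hausdorff_outer s (A i))"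
    using hausdorff_premeasure_subadditive order_trans by blast
qed

lemma outer_measure_space_hausdorff: "outer_measure_space (Pow UNIV) (hausdorff_outer s)"
  by (auto simp: outer_measure_space_def positive_def increasing_def countably_subadditive_def
      intro: hausdorff_outer_mono hausdorff_outer_subadditive)

lemma hausdorff_outer_Un_le:
  "hausdorff_outer s (A \<union> B) \<le> hausdorff_outer s A + hausdorff_outer s B"
proof -
  have "subadditive (Pow UNIV) (hausdorff_outer s)"
    using outer_measure_space_hausdorff ring_of_sets.countably_subadditive_subadditive[OF ring_of_sets_Pow]
    unfolding outer_measure_space_def by blast
  have "hausdorff_outer s (A \<union> B) = hausdorff_outer s (A \<union> (B - A))" by simp
  also have "\<dots> \<le> hausdorff_outer s A + hausdorff_outer s (B - A)"
    using \<open>subadditive _ _\<close> by (intro subadditiveD) auto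
  also have "\<dots> \<le> hausdorff_outer s A + hausdorff_outer s B"
    by (intro add_mono hausdorff_outer_mono) auto
  finally show ?thesis .
qed

lemma measure_space_hausdorff:
  "measure_space UNIV (lambda_system UNIV (Pow UNIV) (hausdorff_outer s)) (hausdorff_outer s)"
proof -
  interpret sigma_algebra UNIV "Pow UNIV" by (rule sigma_algebra_Pow)
  show ?thesis using outer_measure_space_hausdorff by (rule caratheodory_lemma)
qed

lemma space_hausdorff [simp]: "space (hausdorff_measure s) = UNIV"
  by (simp add: hausdorff_measure_def space_measure_of_conv)

lemma sets_hausdorff:
  "sets (hausdorff_measure s) = lambda_system UNIV (Pow UNIV) (hausdorff_outer s)"
  using measure_space_hausdorff[of s]
  unfolding hausdorff_measure_def measure_space_def by (metis sigma_algebra.sets_measure_of_eq)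

text \<open>One inequality suffices in Caratheodory's condition, the other being
  subadditivity.\<close>

lemma in_sets_hausdorff_iff:
  "A \<in> sets (hausdorff_measure s) \<longleftrightarrow>
    (\<forall>T. hausdorff_outer s (T \<inter> A) + hausdorff_outer s (T - A) \<le> hausdorff_outer s T)"
proof -
  have "hausdorff_outer s T \<le> hausdorff_outer s (T \<inter> A) + hausdorff_outer s (T - A)" for T :: "'a set"
    using hausdorff_outer_Un_le[of s "T \<inter> A" "T - A"] by (simp add: Int_Diff_Un)
  moreover have "A \<in> lambda_system UNIV (Pow UNIV) (hausdorff_outer s) \<longleftrightarrow>
      (\<forall>T. hausdorff_outer s (T \<inter> A) + hausdorff_outer s (T - A) = hausdorff_outer s T)"
    using algebra.lambda_system_eq[OF algebra_Pow, of "UNIV::'a set" "hausdorff_outer s"] by auto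
  ultimately show ?thesis
    unfolding sets_hausdorff by (auto intro: antisym)
qed

lemma emeasure_hausdorff:
  assumes "A \<in> sets (hausdorff_measure s)"
  shows "emeasure (hausdorff_measure s) A = hausdorff_outer s A"
  using assms measure_space_hausdorff[of s] unfolding sets_hausdorff
  unfolding hausdorff_measure_def
  by (intro emeasure_measure_of_sigma) (auto simp: measure_space_def)

text \<open>A covering set of diameter below d cannot meet both \<open>A\<close> and
  \<open>B\<close>, so every fine cover of the union splits into a cover of each.\<close>

lemma hausdorff_outer_separated:
  fixes A B :: "'a::metric_space set"
  assumes d: "0 < d" "\<And>a b. a \<in> A \<Longrightarrow> b \<in> B \<Longrightarrow> d \<le> dist a b"
  shows "hausdorff_outer s A + hausdorff_outer s B \<le> hausdorff_outer s (A \<union> B)"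
proof -
  have *: "hausdorff_premeasure s \<delta> A + hausdorff_premeasure s \<delta> B \<le> hausdorff_premeasure s \<delta> (A \<union> B)"
    if \<delta>: "\<delta> < d" for \<delta>
  proof (rule hausdorff_premeasure_greatest)
    fix U :: "nat \<Rightarrow> 'a set" assume U: "A \<union> B \<subseteq> (\<Union>i. U i)" "\<And>i. bounded (U i)" "\<And>i. diameter (U i) \<le> \<delta>"
    have AB: "U i \<inter> A = {} \<or> U i \<inter> B = {}" for i
      using U(2)[of i] U(3)[of i] d(2) \<delta> diameter_bounded_bound[of "U i"] by fastforce
    have dm: "diameter (U i \<inter> X) \<le> \<delta>" for i X
      using diameter_subset[of "U i \<inter> X" "U i"] U(2)[of i] U(3)[of i] by auto
    have "hausdorff_premeasure s \<delta> A + hausdorff_premeasure s \<delta> B \<le>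
        (\<Sum>i. hausdorff_weight s (U i \<inter> A)) + (\<Sum>i. hausdorff_weight s (U i \<inter> B))"
      using U dm by (intro add_mono hausdorff_premeasure_le) auto
    also have "\<dots> = (\<Sum>i. hausdorff_weight s (U i \<inter> A) + hausdorff_weight s (U i \<inter> B))"
      by (rule suminf_add) auto
    also have "\<dots> \<le> (\<Sum>i. hausdorff_weight s (U i))"
    proof (rule suminf_le)
      fix i
      have "hausdorff_weight s ({}::'a set) = 0" by (simp add: hausdorff_weight_def)
      then show "hausdorff_weight s (U i \<inter> A) + hausdorff_weight s (U i \<inter> B) \<le> hausdorff_weight s (U i)"
        using AB[of i] U(2)[of i] hausdorff_weight_mono[of "U i \<inter> A" "U i" s]
          hausdorff_weight_mono[of "U i \<inter> B" "U i" s] by auto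
    qed auto
    finally show "hausdorff_premeasure s \<delta> A + hausdorff_premeasure s \<delta> B \<le> (\<Sum>i. hausdorff_weight s (U i))" .
  qed
  \<comment> \<open>The premeasure grows as \<delta> shrinks, so only scales below d matter for the
    supremum.\<close>
  have SUP: "hausdorff_outer s E = (SUP \<delta>\<in>{0<..<d}. hausdorff_premeasure s \<delta> E)" for E :: "'a set"
  proof (rule antisym)
    show "hausdorff_outer s E \<le> (SUP \<delta>\<in>{0<..<d}. hausdorff_premeasure s \<delta> E)"
    proof (rule hausdorff_outer_least)
      fix \<delta> :: real assume "0 < \<delta>"
      have "hausdorff_premeasure s \<delta> E \<le> hausdorff_premeasure s (min \<delta> (d/2)) E"
        by (rule hausdorff_premeasure_antimono) simp
      also have "\<dots> \<le> (SUP \<delta>\<in>{0<..<d}. hausdorff_premeasure s \<delta> E)"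
        using d \<open>0 < \<delta>\<close> by (intro SUP_upper) auto
      finally show "hausdorff_premeasure s \<delta> E \<le> (SUP \<delta>\<in>{0<..<d}. hausdorff_premeasure s \<delta> E)" .
    qed
  next
    show "(SUP \<delta>\<in>{0<..<d}. hausdorff_premeasure s \<delta> E) \<le> hausdorff_outer s E"
      by (rule SUP_least) (simp add: hausdorff_premeasure_le_outer)
  qed
  have "hausdorff_outer s A + hausdorff_outer s B = (SUP \<delta>\<in>{0<..<d}. hausdorff_premeasure s \<delta> A + hausdorff_premeasure s \<delta> B)"
    unfolding SUP
  proof (rule SUP_add_directed_ennreal[symmetric])
    fix i j assume "i \<in> {0<..<d}" "j \<in> {0<..<d}"
    then show "\<exists>k\<in>{0<..<d}. hausdorff_premeasure s i A + hausdorff_premeasure s j B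
           \<le> hausdorff_premeasure s k A + hausdorff_premeasure s k B"
      by (intro bexI[of _ "min i j"] add_mono hausdorff_premeasure_antimono) auto
  qed
  also have "\<dots> \<le> hausdorff_outer s (A \<union> B)"
  proof (rule SUP_least)
    fix \<delta> assume "\<delta> \<in> {0<..<d}"
    then show "hausdorff_premeasure s \<delta> A + hausdorff_premeasure s \<delta> B \<le> hausdorff_outer s (A \<union> B)"
      by (meson "*" greaterThanLessThan_iff hausdorff_premeasure_le_outer order_trans)
  qed
  finally show ?thesis .
qed

text \<open>Caratheodory's criterion. The shells \<open>S k\<close> of even index are pairwise at positive distance,
  and so are those of odd index; hence the measures of the shells are summable.\<close>

lemma closed_in_sets_hausdorff:
  fixes F :: "'a::metric_space set"
  assumes "closed F"
  shows "F \<in> sets (hausdorff_measure s)"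
  unfolding in_sets_hausdorff_iff
proof
  fix T :: "'a set"
  let ?H = "hausdorff_outer s :: 'a set \<Rightarrow> ennreal"
  show "?H (T \<inter> F) + ?H (T - F) \<le> ?H T"
  proof (cases "F = {} \<or> ?H T = \<infinity>")
    case False
    then have F: "F \<noteq> {}" and fin: "?H T \<noteq> \<infinity>" by auto
    define B where "B n = {x \<in> T. 1 / real (Suc n) \<le> infdist x F}" for n
    define S where "S n = B (Suc n) - B n" for n
    have Bmono: "B m \<subseteq> B n" if "m \<le> n" for m n
    proof -
      have "1 / real (Suc n) \<le> 1 / real (Suc m)" using that by (intro divide_left_mono) auto
      then show ?thesis by (auto simp: B_def)
    qed
    have TF: "T - F = (\<Union>n. B n)"
    proof (intro set_eqI iffI)
      fix x assume "x \<in> T - F"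
      then have "0 < infdist x F"
        using F assms by (metis DiffE antisym_conv2 in_closed_iff_infdist_zero infdist_nonneg)
      then obtain n where "1 / real (Suc n) < infdist x F"
        using reals_Archimedean by (metis inverse_eq_divide)
      then show "x \<in> (\<Union>n. B n)" using \<open>x \<in> T - F\<close> by (auto simp: B_def intro!: exI[of _ n])
    next
      fix x assume "x \<in> (\<Union>n. B n)"
      then obtain n where n: "x \<in> T" "1 / real (Suc n) \<le> infdist x F" by (auto simp: B_def)
      have "0 < 1 / real (Suc n)" by simp
      with n have "infdist x F \<noteq> 0" by linarith
      then show "x \<in> T - F" using n(1) by auto
    qed
    have sep: "1 / real (Suc m) - 1 / real (Suc (Suc m)) \<le> dist a b"
      if "a \<in> B m" "b \<notin> B (Suc m)" "b \<in> T" for m a b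
    proof -
      have "1 / real (Suc m) \<le> infdist a F" "infdist b F < 1 / real (Suc (Suc m))"
        using that by (auto simp: B_def not_le)
      then show ?thesis using infdist_triangle[of a F b] by linarith
    qed
    have pos: "0 < 1 / real (Suc m) - 1 / real (Suc (Suc m))" for m
      unfolding diff_gt_0_iff_gt by (rule divide_strict_left_mono) simp_all
    have S_sub: "S n \<subseteq> T" for n by (auto simp: S_def B_def)
    have sum_shells: "(\<Sum>i<N. ?H (S (2 * i + k))) \<le> ?H (\<Union>i<N. S (2 * i + k))" for N k
    proof (induction N)
      case (Suc N)
      note IH = Suc
      show ?case
      proof (cases N)
        case (Suc M)
        \<comment> \<open>With N = M + 1, the shell of index 2M + k + 1 lies between the earlier
          shells and the new one; its thickness is the positive distance needed.\<close>
        have "?H (\<Union>i<N. S (2 * i + k)) + ?H (S (2 * N + k)) \<le> ?H ((\<Union>i<N. S (2 * i + k)) \<union> S (2 * N + k))"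
        proof (rule hausdorff_outer_separated[OF pos sep])
          fix a b assume a: "a \<in> (\<Union>i<N. S (2 * i + k))" and b: "b \<in> S (2 * N + k)"
          then obtain i where i: "i < N" "a \<in> B (Suc (2 * i + k))" by (auto simp: S_def)
          then show "a \<in> B (Suc (2 * M + k))" using Bmono[of "Suc (2 * i + k)" "Suc (2 * M + k)"] Suc by auto
          show "b \<notin> B (Suc (Suc (2 * M + k)))" using b Suc by (auto simp: S_def)
          show "b \<in> T" using b S_sub by auto
        qed
        then have "(\<Sum>i<N. ?H (S (2 * i + k))) + ?H (S (2 * N + k)) \<le> ?H ((\<Union>i<N. S (2 * i + k)) \<union> S (2 * N + k))"
          using IH by (meson add_right_mono order_trans)
        then show ?thesis by (simp add: lessThan_Suc Un_commute add.commute)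
      next
        case 0 then show ?thesis by (simp add: lessThan_Suc)
      qed
    qed simp
    have sum_le: "(\<Sum>i<N. ?H (S (2 * i + k))) \<le> ?H T" for N k
      by (rule order_trans[OF sum_shells hausdorff_outer_mono]) (use S_sub in blast)
    have "(\<Sum>i. ?H (S i)) \<noteq> \<infinity>"
    proof -
      have "(\<Sum>i<n. ?H (S i)) \<le> ?H T + ?H T" for n
      proof -
        have "(\<Sum>i<n. ?H (S i)) \<le> (\<Sum>i<2 * n. ?H (S i))" by (rule sum_mono2) auto
        also have "\<dots> = (\<Sum>i<n. ?H (S (2 * i + 0))) + (\<Sum>i<n. ?H (S (2 * i + 1)))"
          by (induction n) (auto simp: add_ac)
        also have "\<dots> \<le> ?H T + ?H T"
          by (intro add_mono sum_le)
        finally show ?thesis .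
      qed
      then have "(\<Sum>i. ?H (S i)) \<le> ?H T + ?H T" by (rule suminf_le_const[OF summableI])
      then show ?thesis using fin by (auto simp: top_unique)
    qed
    note fin_sum = this
    have "?H (T \<inter> F) + ?H (T - F) \<le> ?H T + (\<Sum>i. ?H (S (i + n)))" for n
    proof -
      have "T - F \<subseteq> B n \<union> (\<Union>i. S (i + n))"
      proof
        fix x assume x: "x \<in> T - F"
        define m where "m = (LEAST m. x \<in> B m)"
        have m: "x \<in> B m" "\<And>j. j < m \<Longrightarrow> x \<notin> B j"
          using x TF not_less_Least unfolding m_def by (auto intro: LeastI)
        show "x \<in> B n \<union> (\<Union>i. S (i + n))"
        proof (cases "m \<le> n")
          case False
          then obtain j where j: "m = Suc j" "n \<le> j" by (cases m) auto
          then have "x \<in> S ((j - n) + n)" using m by (simp add: S_def)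
          then show ?thesis by blast
        qed (use m Bmono in blast)
      qed
      then have "?H (T - F) \<le> ?H (B n \<union> (\<Union>i. S (i + n)))" by (rule hausdorff_outer_mono)
      also have "\<dots> \<le> ?H (B n) + ?H (\<Union>i. S (i + n))" by (rule hausdorff_outer_Un_le)
      also have "\<dots> \<le> ?H (B n) + (\<Sum>i. ?H (S (i + n)))"
        by (intro add_left_mono hausdorff_outer_subadditive)
      finally have "?H (T \<inter> F) + ?H (T - F) \<le> ?H (T \<inter> F) + (?H (B n) + (\<Sum>i. ?H (S (i + n))))"
        by (rule add_left_mono)
      also have "\<dots> = ?H (T \<inter> F) + ?H (B n) + (\<Sum>i. ?H (S (i + n)))" by (simp only: add.assoc)
      also have "\<dots> \<le> ?H ((T \<inter> F) \<union> B n) + (\<Sum>i. ?H (S (i + n)))"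
        by (intro add_right_mono hausdorff_outer_separated[of "1 / real (Suc n)"])
          (auto simp: B_def dist_commute intro: order_trans[OF _ infdist_le2])
      also have "\<dots> \<le> ?H T + (\<Sum>i. ?H (S (i + n)))"
        by (intro add_right_mono hausdorff_outer_mono) (auto simp: B_def)
      finally show ?thesis .
    qed
    note * = this
    \<comment> \<open>Adding the first n shells completes the tail to the full series, which does
      not depend on n; being finite, it cancels after the supremum over n.\<close>
    have "(?H (T \<inter> F) + ?H (T - F)) + (\<Sum>i<n. ?H (S i)) \<le> ?H T + (\<Sum>i. ?H (S i))" for n
      using add_right_mono[OF *[of n], of "\<Sum>i<n. ?H (S i)"] suminf_offset[of "\<lambda>i. ?H (S i)" n]
      by (simp add: add_ac summableI)
    then have "(SUP n. (?H (T \<inter> F) + ?H (T - F)) + (\<Sum>i<n. ?H (S i))) \<le> ?H T + (\<Sum>i. ?H (S i))"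
      by (rule SUP_least)
    then have "(?H (T \<inter> F) + ?H (T - F)) + (\<Sum>i. ?H (S i)) \<le> ?H T + (\<Sum>i. ?H (S i))"
      by (simp add: ennreal_SUP_add_right[symmetric] suminf_eq_SUP[symmetric])
    then show ?thesis using fin_sum by (simp add: ennreal_add_left_cancel_le add.commute)
  qed (auto simp: top_unique)
qed

lemma borel_in_sets_hausdorff: "A \<in> sets borel \<Longrightarrow> A \<in> sets (hausdorff_measure s)"
  for A :: "'a::metric_space set"
proof -
  have "sets (borel :: 'a measure) = sigma_sets UNIV (Collect closed)"
    by (simp add: borel_eq_closed)
  also have "\<dots> \<subseteq> sets (hausdorff_measure s)"
    using sets.sigma_sets_subset[of "Collect closed" "hausdorff_measure s :: 'a measure"]
    by (auto intro: closed_in_sets_hausdorff)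
  finally show "A \<in> sets borel \<Longrightarrow> A \<in> sets (hausdorff_measure s)" by auto
qed

lemma id_measurable_hausdorff:
  "(\<lambda>x. x) \<in> measurable (hausdorff_measure s) (borel :: 'a::metric_space measure)"
  by (rule measurableI) (auto intro: borel_in_sets_hausdorff)

text \<open>Images of the sets of a cover at scale \<delta>/L form a cover at scale \<delta>, with
  weights multiplied by at most L^s. The covering sets are first cut down to \<open>A\<close>, where
  the Lipschitz bound holds.\<close>

lemma hausdorff_outer_Lipschitz:
  fixes f :: "'a::metric_space \<Rightarrow> 'b::metric_space"
  assumes L: "0 < L" and f: "\<And>x y. x \<in> A \<Longrightarrow> y \<in> A \<Longrightarrow> dist (f x) (f y) \<le> L * dist x y"
  shows "hausdorff_outer s (f ` A) \<le> ennreal (L ^ s) * hausdorff_outer s A"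
proof (rule hausdorff_outer_least)
  fix \<delta> :: real assume \<delta>: "0 < \<delta>"
  define c where "c = ennreal (inverse (L ^ s))"
  have c: "c * (ennreal (L ^ s) * x) = x" for x
    using L by (simp add: c_def mult.assoc[symmetric] ennreal_mult[symmetric])
  have "c * hausdorff_premeasure s \<delta> (f ` A) \<le> hausdorff_premeasure s (\<delta> / L) A"
  proof (rule hausdorff_premeasure_greatest)
    fix U :: "nat \<Rightarrow> 'a set" assume U: "A \<subseteq> (\<Union>i. U i)" "\<And>i. bounded (U i)" "\<And>i. diameter (U i) \<le> \<delta> / L"
    define V where "V i = f ` (A \<inter> U i)" for i
    have dV: "dist x y \<le> L * diameter (U i)" if xy: "x \<in> V i" "y \<in> V i" for x y i
    proof -
      obtain a b where ab: "a \<in> A \<inter> U i" "b \<in> A \<inter> U i" "x = f a" "y = f b"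
        using xy unfolding V_def by blast
      then have "dist x y \<le> L * dist a b" using f by auto
      also have "\<dots> \<le> L * diameter (U i)"
        using L ab U(2) by (intro mult_left_mono diameter_bounded_bound) auto
      finally show ?thesis .
    qed
    have diamV: "diameter (V i) \<le> L * diameter (U i)" for i
    proof (cases "V i = {}")
      case True then show ?thesis using L diameter_ge_0[OF U(2), of i] by simp
    next
      case False then show ?thesis using dV unfolding diameter_def[of "V i"] by (auto intro!: cSUP_least)
    qed
    have bV: "bounded (V i)" for i using dV bounded_two_points by blast
    have "hausdorff_premeasure s \<delta> (f ` A) \<le> (\<Sum>i. hausdorff_weight s (V i))"
    proof (rule hausdorff_premeasure_le)
      show "f ` A \<subseteq> (\<Union>i. V i)" using U(1) by (force simp: V_def)
      show "diameter (V i) \<le> \<delta>" for i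
        using diamV[of i] U(3)[of i] L by (simp add: field_simps)
    qed (rule bV)
    also have "\<dots> \<le> (\<Sum>i. ennreal (L ^ s) * hausdorff_weight s (U i))"
    proof (rule suminf_le)
      fix i
      show "hausdorff_weight s (V i) \<le> ennreal (L ^ s) * hausdorff_weight s (U i)"
      \<comment> \<open>The empty set has weight 0 also for s = 0, where the formula for nonempty
        sets would give 1.\<close>
      proof (cases "V i = {}")
        case False
        then have "U i \<noteq> {}" by (auto simp: V_def)
        have "unit_ball_vol (real s) * (diameter (V i) / 2) ^ s \<le>
            unit_ball_vol (real s) * (L * diameter (U i) / 2) ^ s"
          using diamV[of i] diameter_ge_0[OF bV[of i]]
          by (intro mult_left_mono power_mono) auto
        also have "\<dots> = L ^ s * (unit_ball_vol (real s) * (diameter (U i) / 2) ^ s)"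
          by (simp add: power_mult_distrib power_divide)
        finally show ?thesis using False \<open>U i \<noteq> {}\<close> L diameter_ge_0[OF U(2)[of i]]
          by (simp add: hausdorff_weight_def ennreal_mult'' [symmetric] ennreal_leI)
      qed (simp add: hausdorff_weight_def)
    qed auto
    also have "\<dots> = ennreal (L ^ s) * (\<Sum>i. hausdorff_weight s (U i))" by (rule ennreal_suminf_cmult)
    finally show "c * hausdorff_premeasure s \<delta> (f ` A) \<le> (\<Sum>i. hausdorff_weight s (U i))"
      using c by (metis mult_left_mono zero_le)
  qed
  also have "\<dots> \<le> hausdorff_outer s A" using L \<delta> by (intro hausdorff_premeasure_le_outer) auto
  finally show "hausdorff_premeasure s \<delta> (f ` A) \<le> ennreal (L ^ s) * hausdorff_outer s A"
    using c by (metis mult.left_commute mult_left_mono zero_le)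
qed

lemma hausdorff_outer_isometry:
  assumes "\<And>x y. x \<in> A \<Longrightarrow> y \<in> A \<Longrightarrow> dist (f x) (f y) = dist x y"
  shows "hausdorff_outer s (f ` A) = hausdorff_outer s A"
proof (rule antisym)
  have inj: "inj_on f A" using assms by (intro inj_onI) (metis dist_eq_0_iff)
  have "hausdorff_outer s (the_inv_into A f ` (f ` A)) \<le> ennreal (1 ^ s) * hausdorff_outer s (f ` A)"
    by (rule hausdorff_outer_Lipschitz) (use inj assms in \<open>auto simp: the_inv_into_f_f\<close>)
  moreover have "the_inv_into A f ` (f ` A) = A" using inj by simp
  ultimately show "hausdorff_outer s A \<le> hausdorff_outer s (f ` A)" by simp
  show "hausdorff_outer s (f ` A) \<le> hausdorff_outer s A"
    using hausdorff_outer_Lipschitz[of 1 A f s] assms by simp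
qed

section \<open>Lebesgue measure on hyperplanes\<close>

definition proj_perp :: "'a::real_inner \<Rightarrow> 'a \<Rightarrow> 'a" where
  "proj_perp v z = z - (z \<bullet> v) *\<^sub>R v"

text \<open>The Lebesgue measure of the hyperplane orthogonal to a unit vector \<open>v\<close>, as a measure on the
  whole space: a set of base points is measured by the volume of the cylinder of height 1 over it.
  This avoids a type for the hyperplane.\<close>

definition perp_lebesgue :: "'a::euclidean_space \<Rightarrow> 'a measure" where
  "perp_lebesgue v = distr (density lborel (indicator {z. 0 \<le> z \<bullet> v \<and> z \<bullet> v \<le> 1})) borel (proj_perp v)"

lemma proj_perp_diff: "proj_perp v (x - y) = proj_perp v x - proj_perp v y"
  by (simp add: proj_perp_def algebra_simps)

lemma proj_perp_add: "proj_perp v (x + y) = proj_perp v x + proj_perp v y"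
  by (simp add: proj_perp_def algebra_simps)

lemma continuous_proj_perp [continuous_intros]: "continuous_on S (proj_perp v)"
  unfolding proj_perp_def by (intro continuous_intros)

lemma proj_perp_measurable [measurable]: "proj_perp (v :: 'a::euclidean_space) \<in> borel_measurable borel"
  by (intro borel_measurable_continuous_onI continuous_intros)

lemma borel_proj_perp_image: "compact A \<Longrightarrow> proj_perp (v :: 'a::euclidean_space) ` A \<in> sets borel"
  by (intro borel_compact compact_continuous_image continuous_proj_perp)

lemma proj_perp_inner: "norm v = 1 \<Longrightarrow> proj_perp v z \<bullet> v = 0"
  by (simp add: proj_perp_def algebra_simps norm_eq_1)

lemma proj_perp_id: "z \<bullet> v = 0 \<Longrightarrow> proj_perp v z = z"
  by (simp add: proj_perp_def)

lemma proj_perp_scaleR_self: "norm v = 1 \<Longrightarrow> proj_perp v (c *\<^sub>R v) = 0"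
  by (simp add: proj_perp_def norm_eq_1)

lemma norm_proj_perp_sq: "norm v = 1 \<Longrightarrow> (norm (proj_perp v z))\<^sup>2 = (norm z)\<^sup>2 - (z \<bullet> v)\<^sup>2"
  unfolding power2_norm_eq_inner proj_perp_def
  by (simp add: algebra_simps norm_eq_1 inner_commute power2_eq_square)

lemma norm_proj_perp_le: "norm v = 1 \<Longrightarrow> norm (proj_perp v z) \<le> norm z"
  by (rule power2_le_imp_le) (simp_all add: norm_proj_perp_sq)

lemma proj_perp_decomp: "z = proj_perp v z + (z \<bullet> v) *\<^sub>R v"
  by (simp add: proj_perp_def)

lemma sets_perp_lebesgue [measurable_cong, simp]: "sets (perp_lebesgue v) = sets borel"
  by (simp add: perp_lebesgue_def)

lemma space_perp_lebesgue [simp]: "space (perp_lebesgue v) = UNIV"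
  by (simp add: perp_lebesgue_def)

lemma nn_integral_perp_lebesgue:
  assumes [measurable]: "F \<in> borel_measurable borel"
  shows "(\<integral>\<^sup>+y. F y \<partial>perp_lebesgue v) =
    (\<integral>\<^sup>+z. F (proj_perp v z) * indicator {z. 0 \<le> z \<bullet> v \<and> z \<bullet> v \<le> 1} z \<partial>lborel)"
proof -
  have [measurable]: "{z. 0 \<le> z \<bullet> v \<and> z \<bullet> v \<le> 1} \<in> sets borel" by measurable
  show ?thesis
    unfolding perp_lebesgue_def
    by (subst nn_integral_distr) (auto simp: nn_integral_density mult.commute)
qed

lemma emeasure_perp_lebesgue:
  assumes [measurable]: "B \<in> sets borel"
  shows "emeasure (perp_lebesgue v) B = emeasure lborel {z. proj_perp v z \<in> B \<and> 0 \<le> z \<bullet> v \<and> z \<bullet> v \<le> 1}"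
proof -
  have [measurable]: "{z. proj_perp v z \<in> B \<and> 0 \<le> z \<bullet> v \<and> z \<bullet> v \<le> 1} \<in> sets borel" by measurable
  have "emeasure (perp_lebesgue v) B = (\<integral>\<^sup>+y. indicator B y \<partial>perp_lebesgue v)"
    by simp
  also have "\<dots> = (\<integral>\<^sup>+z. indicator B (proj_perp v z) * indicator {z. 0 \<le> z \<bullet> v \<and> z \<bullet> v \<le> 1} z \<partial>lborel)"
    by (rule nn_integral_perp_lebesgue) measurable
  also have "\<dots> = (\<integral>\<^sup>+z. indicator {z. proj_perp v z \<in> B \<and> 0 \<le> z \<bullet> v \<and> z \<bullet> v \<le> 1} z \<partial>lborel)"
    by (intro nn_integral_cong) (auto split: split_indicator)
  finally show ?thesis by (simp del: mem_Collect_eq)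
qed

lemma AE_perp_lebesgue: "norm v = 1 \<Longrightarrow> AE y in perp_lebesgue v. y \<bullet> v = 0"
  unfolding perp_lebesgue_def by (subst AE_distr_iff) (auto simp: proj_perp_inner)

lemma nn_integral_lborel_shift:
  fixes c :: "'a::euclidean_space"
  assumes [measurable]: "F \<in> borel_measurable borel"
  shows "(\<integral>\<^sup>+z. F (c + z) \<partial>lborel) = (\<integral>\<^sup>+z. F z \<partial>lborel)"
proof -
  have "(\<integral>\<^sup>+z. F z \<partial>lborel) = (\<integral>\<^sup>+z. F z \<partial>distr lborel borel ((+) c))"
    by (simp add: lborel_distr_plus)
  also have "\<dots> = (\<integral>\<^sup>+z. F (c + z) \<partial>lborel)" by (subst nn_integral_distr) auto
  finally show ?thesis by simp
qed

text \<open>Integrating over all translates of the slab recovers the whole space, because each point lies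
  in the translates belonging to an interval of length 1.\<close>

lemma nn_integral_lborel_perp:
  assumes v: "norm v = 1" and [measurable]: "F \<in> borel_measurable borel"
  shows "(\<integral>\<^sup>+z. F z \<partial>lborel) = (\<integral>\<^sup>+y. (\<integral>\<^sup>+t. F (y + t *\<^sub>R v) \<partial>lborel) \<partial>perp_lebesgue v)"
proof -
  define J where "J z = (indicator {0..1} (z \<bullet> v) :: ennreal)" for z
  have [measurable]: "J \<in> borel_measurable borel" unfolding J_def by measurable
  have "(\<integral>\<^sup>+y. (\<integral>\<^sup>+t. F (y + t *\<^sub>R v) \<partial>lborel) \<partial>perp_lebesgue v)
      = (\<integral>\<^sup>+z. (\<integral>\<^sup>+t. F (proj_perp v z + t *\<^sub>R v) \<partial>lborel) * J z \<partial>lborel)"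
    by (subst nn_integral_perp_lebesgue) (auto simp: J_def indicator_def intro!: nn_integral_cong)
  also have "\<dots> = (\<integral>\<^sup>+z. (\<integral>\<^sup>+t. F (z + t *\<^sub>R v) * J z \<partial>lborel) \<partial>lborel)"
  \<comment> \<open>Shifting the line parameter by the height of z lets the line start at z instead
    of at its projection.\<close>
  proof (rule nn_integral_cong)
    fix z
    have "(\<integral>\<^sup>+t. F (proj_perp v z + t *\<^sub>R v) \<partial>lborel) = (\<integral>\<^sup>+t. F (proj_perp v z + ((z \<bullet> v) + t) *\<^sub>R v) \<partial>lborel)"
      by (subst nn_integral_lborel_shift[where F="\<lambda>t. F (proj_perp v z + t *\<^sub>R v)"]) auto
    also have "\<dots> = (\<integral>\<^sup>+t. F (z + t *\<^sub>R v) \<partial>lborel)"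
      by (simp add: proj_perp_def algebra_simps)
    finally show "(\<integral>\<^sup>+t. F (proj_perp v z + t *\<^sub>R v) \<partial>lborel) * J z = (\<integral>\<^sup>+t. F (z + t *\<^sub>R v) * J z \<partial>lborel)"
      by (simp add: nn_integral_multc)
  qed
  also have "\<dots> = (\<integral>\<^sup>+t. (\<integral>\<^sup>+z. F (z + t *\<^sub>R v) * J z \<partial>lborel) \<partial>lborel)"
    by (rule pair_sigma_finite.Fubini'[symmetric]) (auto simp: pair_sigma_finite_def sigma_finite_lborel split_beta)
  also have "\<dots> = (\<integral>\<^sup>+t. (\<integral>\<^sup>+z. F z * J (z - t *\<^sub>R v) \<partial>lborel) \<partial>lborel)"
  proof (rule nn_integral_cong)
    fix t
    show "(\<integral>\<^sup>+z. F (z + t *\<^sub>R v) * J z \<partial>lborel) = (\<integral>\<^sup>+z. F z * J (z - t *\<^sub>R v) \<partial>lborel)"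
      using nn_integral_lborel_shift[where F="\<lambda>z. F z * J (z - t *\<^sub>R v)" and c="t *\<^sub>R v"]
      by (simp add: add.commute)
  qed
  also have "\<dots> = (\<integral>\<^sup>+z. (\<integral>\<^sup>+t. F z * J (z - t *\<^sub>R v) \<partial>lborel) \<partial>lborel)"
    by (rule pair_sigma_finite.Fubini') (auto simp: pair_sigma_finite_def sigma_finite_lborel split_beta)
  also have "\<dots> = (\<integral>\<^sup>+z. F z \<partial>lborel)"
  proof (rule nn_integral_cong)
    fix z
    have "(\<integral>\<^sup>+t. J (z - t *\<^sub>R v) \<partial>lborel) = (\<integral>\<^sup>+t. indicator {z \<bullet> v - 1..z \<bullet> v} t \<partial>lborel)"
      using v by (intro nn_integral_cong) (auto simp: J_def inner_diff_left norm_eq_1 split: split_indicator)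
    also have "\<dots> = 1" by simp
    finally show "(\<integral>\<^sup>+t. F z * J (z - t *\<^sub>R v) \<partial>lborel) = F z"
      by (subst nn_integral_cmult) auto
  qed
  finally show ?thesis by simp
qed

text \<open>Arbitrary heights are needed because a dilation of space changes the height of a
  cylinder along with its base.\<close>

lemma emeasure_cylinder:
  assumes v: "norm v = 1" and [measurable]: "B \<in> sets borel" and "a \<le> b"
  shows "emeasure lborel {z. proj_perp v z \<in> B \<and> a \<le> z \<bullet> v \<and> z \<bullet> v \<le> b}
    = ennreal (b - a) * emeasure (perp_lebesgue v) B"
proof -
  let ?C = "{z. proj_perp v z \<in> B \<and> a \<le> z \<bullet> v \<and> z \<bullet> v \<le> b}"
  have [measurable]: "?C \<in> sets borel" by measurable
  have "emeasure lborel ?C = (\<integral>\<^sup>+z. indicator ?C z \<partial>lborel)" by simp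
  also have "\<dots> = (\<integral>\<^sup>+y. (\<integral>\<^sup>+t. indicator ?C (y + t *\<^sub>R v) \<partial>lborel) \<partial>perp_lebesgue v)"
    by (rule nn_integral_lborel_perp[OF v]) measurable
  also have "\<dots> = (\<integral>\<^sup>+y. ennreal (b - a) * indicator B y \<partial>perp_lebesgue v)"
  proof (rule nn_integral_cong_AE, use AE_perp_lebesgue[OF v] in eventually_elim)
    case (elim y)
    have "(\<integral>\<^sup>+t. indicator ?C (y + t *\<^sub>R v) \<partial>lborel) = (\<integral>\<^sup>+t. indicator B y * indicator {a..b} t \<partial>lborel)"
      using v elim by (intro nn_integral_cong)
        (auto simp: proj_perp_add proj_perp_id proj_perp_scaleR_self inner_add_left norm_eq_1 split: split_indicator)
    also have "\<dots> = ennreal (b - a) * indicator B y"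
      using \<open>a \<le> b\<close> by (subst nn_integral_cmult) (auto simp: mult.commute)
    finally show ?case .
  qed
  also have "\<dots> = ennreal (b - a) * emeasure (perp_lebesgue v) B"
    by (rule nn_integral_cmult_indicator) simp
  finally show ?thesis .
qed

lemma nn_integral_perp_shift:
  assumes v: "norm v = 1" and a: "a \<bullet> v = 0" and [measurable]: "F \<in> borel_measurable borel"
  shows "(\<integral>\<^sup>+y. F (a + y) \<partial>perp_lebesgue v) = (\<integral>\<^sup>+y. F y \<partial>perp_lebesgue v)"
proof -
  have [measurable]: "{z. 0 \<le> z \<bullet> v \<and> z \<bullet> v \<le> 1} \<in> sets borel" by measurable
  show ?thesis
    using nn_integral_lborel_shift[where c=a and F="\<lambda>z. F (proj_perp v z) * indicator {z. 0 \<le> z \<bullet> v \<and> z \<bullet> v \<le> 1} z"]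
    using a by (simp add: nn_integral_perp_lebesgue proj_perp_add proj_perp_id inner_add_left indicator_def)
qed

lemma emeasure_perp_shift:
  assumes v: "norm v = 1" and a: "a \<bullet> v = 0"
  shows "emeasure (perp_lebesgue v) (cball a r) = emeasure (perp_lebesgue v) (cball 0 r)"
proof -
  have [measurable]: "cball a r \<in> sets borel" by simp
  have "emeasure (perp_lebesgue v) (cball 0 r) = (\<integral>\<^sup>+y. indicator (cball a r) (a + y) \<partial>perp_lebesgue v)"
    by (subst nn_integral_indicator[symmetric])
      (auto intro!: nn_integral_cong simp: indicator_def dist_norm simp del: nn_integral_indicator)
  also have "\<dots> = emeasure (perp_lebesgue v) (cball a r)"
    by (subst nn_integral_perp_shift[OF v a]) simp_all
  finally show ?thesis by simp
qed

text \<open>The unit cylinder over the ball is bounded, and it contains the ball of radius 1/2 about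
  v/2.\<close>

lemma emeasure_perp_unit_ball:
  fixes v :: "'a::euclidean_space"
  assumes v: "norm v = 1"
  shows "emeasure (perp_lebesgue v) (cball 0 1) \<noteq> 0" "emeasure (perp_lebesgue v) (cball 0 1) < \<infinity>"
proof -
  let ?C = "{z. proj_perp v z \<in> cball 0 1 \<and> 0 \<le> z \<bullet> v \<and> z \<bullet> v \<le> 1}"
  have [measurable]: "cball (0::'a) 1 \<in> sets borel" by simp
  have [measurable]: "?C \<in> sets borel" by measurable
  have "norm z \<le> 2" if "z \<in> ?C" for z
  proof -
    have "norm z \<le> norm (proj_perp v z) + norm ((z \<bullet> v) *\<^sub>R v)"
      by (metis norm_triangle_ineq proj_perp_decomp)
    then show ?thesis using that v by auto
  qed
  then have "bounded ?C" by (auto simp: bounded_iff)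
  from emeasure_bounded_finite[OF this] show "emeasure (perp_lebesgue v) (cball 0 1) < \<infinity>"
    by (subst emeasure_perp_lebesgue) simp_all
  have "ball ((1/2) *\<^sub>R v) (1/2) \<subseteq> ?C"
  proof
    fix z assume z: "z \<in> ball ((1/2) *\<^sub>R v) (1/2)"
    define w where "w = z - (1/2) *\<^sub>R v"
    have w: "norm w < 1/2" using z by (simp add: w_def dist_norm norm_minus_commute)
    have zw: "z = w + (1/2) *\<^sub>R v" by (simp add: w_def)
    have "\<bar>w \<bullet> v\<bar> \<le> norm w" using Cauchy_Schwarz_ineq2[of w v] v by simp
    moreover have "norm (proj_perp v z) \<le> norm w"
      using norm_proj_perp_le[OF v, of w] by (simp add: zw proj_perp_add proj_perp_scaleR_self v)
    moreover have "z \<bullet> v = w \<bullet> v + 1/2" using v by (simp add: zw inner_add_left norm_eq_1)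
    ultimately show "z \<in> ?C" using w by auto
  qed
  then have "emeasure lborel (ball ((1/2) *\<^sub>R v) (1/2)) \<le> emeasure lborel ?C"
    by (rule emeasure_mono) simp
  moreover have "emeasure lborel (ball ((1/2) *\<^sub>R v) (1/2)) \<noteq> 0"
    by (subst emeasure_ball) (auto simp: unit_ball_vol_pos less_imp_neq[symmetric])
  ultimately show "emeasure (perp_lebesgue v) (cball 0 1) \<noteq> 0"
    by (auto simp: emeasure_perp_lebesgue)
qed

text \<open>Dilation by r carries the cylinder of height 1/r over the unit ball onto the cylinder of
  height 1 over the ball of radius r; the volume factor r^n times 1/r leaves the exponent n -
  1.\<close>

lemma emeasure_perp_cball:
  fixes v :: "'a::euclidean_space"
  assumes v: "norm v = 1" and r: "0 < r"
  shows "emeasure (perp_lebesgue v) (cball 0 r) =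
    ennreal (r ^ (DIM('a) - 1)) * emeasure (perp_lebesgue v) (cball 0 1)"
proof -
  have [measurable]: "cball (0::'a) r \<in> sets borel" "cball (0::'a) 1 \<in> sets borel" by simp_all
  let ?C = "{z. proj_perp v z \<in> cball 0 r \<and> 0 \<le> z \<bullet> v \<and> z \<bullet> v \<le> 1}"
  let ?D = "{z. proj_perp v z \<in> cball 0 1 \<and> 0 \<le> z \<bullet> v \<and> z \<bullet> v \<le> 1 / r}"
  have [measurable]: "?C \<in> sets borel" "?D \<in> sets borel" by measurable
  have CD: "r *\<^sub>R x \<in> ?C \<longleftrightarrow> x \<in> ?D" for x
  proof -
    have "proj_perp v (r *\<^sub>R x) = r *\<^sub>R proj_perp v x" by (simp add: proj_perp_def algebra_simps)
    then show ?thesis using r by (auto simp: field_simps zero_le_mult_iff)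
  qed
  have "emeasure lborel ?C = emeasure (density (distr lborel borel (\<lambda>x. 0 + r *\<^sub>R x)) (\<lambda>_. \<bar>r\<bar>^DIM('a))) ?C"
    using lborel_affine[of r "0::'a"] r by simp
  also have "\<dots> = ennreal (r ^ DIM('a)) * emeasure (distr lborel borel (\<lambda>x. 0 + r *\<^sub>R x)) ?C"
    using r by (subst emeasure_density) (auto simp: nn_integral_cmult)
  also have "emeasure (distr lborel borel (\<lambda>x. 0 + r *\<^sub>R x)) ?C = emeasure lborel ?D"
    using CD by (subst emeasure_distr) (auto intro!: arg_cong[where f="emeasure lborel"])
  also have "\<dots> = ennreal (1 / r) * emeasure (perp_lebesgue v) (cball 0 1)"
    using r by (subst emeasure_cylinder[OF v]) auto
  finally have "emeasure lborel ?C = ennreal (r ^ DIM('a)) * (ennreal (1 / r) * emeasure (perp_lebesgue v) (cball 0 1))" .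
  moreover have "ennreal (r ^ DIM('a)) * ennreal (1 / r) = ennreal (r ^ (DIM('a) - 1))"
    using r by (subst ennreal_mult[symmetric]) (auto simp: power_diff)
  ultimately show ?thesis by (simp add: emeasure_perp_lebesgue mult.assoc[symmetric])
qed

lemma emeasure_perp_bounded:
  fixes v :: "'a::euclidean_space"
  assumes v: "norm v = 1" and B: "bounded B"
  shows "emeasure (perp_lebesgue v) B < \<infinity>"
proof -
  obtain b where b: "0 < b" "\<forall>x\<in>B. norm x \<le> b" using B unfolding bounded_pos by blast
  have "emeasure (perp_lebesgue v) B \<le> emeasure (perp_lebesgue v) (cball 0 b)"
    using b by (intro emeasure_mono) auto
  also have "\<dots> < \<infinity>"
    using emeasure_perp_unit_ball(2)[OF v] emeasure_perp_cball[OF v b(1)] by (simp add: ennreal_mult_less_top)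
  finally show ?thesis .
qed

text \<open>Radius 0 is included because a covering set may be a single point. It is reached as the
  limit of radii r + e, which also yields the correct bound with 0^0 = 1 in dimension one.\<close>

lemma emeasure_perp_cball_le:
  fixes v :: "'a::euclidean_space"
  assumes v: "norm v = 1" and a: "a \<bullet> v = 0" and r: "0 \<le> r"
  shows "emeasure (perp_lebesgue v) (cball a r) \<le>
    ennreal (r ^ (DIM('a) - 1)) * emeasure (perp_lebesgue v) (cball 0 1)"
proof -
  let ?b = "emeasure (perp_lebesgue v) (cball 0 1)"
  obtain b where b: "?b = ennreal b" "0 \<le> b"
    using emeasure_perp_unit_ball(2)[OF v] by (cases ?b) auto
  have "emeasure (perp_lebesgue v) (cball 0 r) \<le> ennreal ((r + e) ^ (DIM('a) - 1) * b)" if "0 < e" for e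
  proof -
    have "emeasure (perp_lebesgue v) (cball 0 r) \<le> emeasure (perp_lebesgue v) (cball 0 (r + e))"
      using that by (intro emeasure_mono) auto
    also have "\<dots> = ennreal ((r + e) ^ (DIM('a) - 1) * b)"
      using r that b by (subst emeasure_perp_cball[OF v]) (auto simp: ennreal_mult)
    finally show ?thesis .
  qed
  then have ev: "\<forall>\<^sub>F e in at_right 0. emeasure (perp_lebesgue v) (cball 0 r) \<le> ennreal ((r + e) ^ (DIM('a) - 1) * b)"
    by (rule eventually_mono[OF eventually_at_right_less])
  have "((\<lambda>e. ennreal ((r + e) ^ (DIM('a) - 1) * b)) \<longlongrightarrow> ennreal ((r + 0) ^ (DIM('a) - 1) * b)) (at_right 0)"
    by (intro tendsto_intros)
  then have "emeasure (perp_lebesgue v) (cball 0 r) \<le> ennreal ((r + 0) ^ (DIM('a) - 1) * b)"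
    by (rule tendsto_lowerbound[OF _ ev]) simp
  then show ?thesis using r b by (simp add: emeasure_perp_shift[OF v a] ennreal_mult)
qed

section \<open>Uniqueness of Haar measure and rotation invariance\<close>

text \<open>Uniqueness of Haar measure: Fubini for the integrand \<open>indicator A x * indicator B (y - x)\<close>.\<close>

lemma haar_proportional:
  fixes p q :: "'a::euclidean_space measure"
  assumes "sigma_finite_measure p" "sigma_finite_measure q"
    and [measurable_cong]: "sets p = sets borel" "sets q = sets borel"
    and V: "AE x in p. x \<in> V" "AE x in q. x \<in> V"
    and q: "\<And>F a. F \<in> borel_measurable borel \<Longrightarrow> a \<in> V \<Longrightarrow> (\<integral>\<^sup>+y. F (y - a) \<partial>q) = (\<integral>\<^sup>+y. F y \<partial>q)"
    and p: "\<And>F a. F \<in> borel_measurable borel \<Longrightarrow> a \<in> V \<Longrightarrow> (\<integral>\<^sup>+y. F (a - y) \<partial>p) = (\<integral>\<^sup>+y. F y \<partial>p)"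
    and [measurable]: "A \<in> sets borel" "B \<in> sets borel"
  shows "emeasure p A * emeasure q B = emeasure p B * emeasure q A"
proof -
  interpret p: sigma_finite_measure p by fact
  interpret q: sigma_finite_measure q by fact
  interpret pq: pair_sigma_finite p q ..
  have *: "(\<integral>\<^sup>+x. (\<integral>\<^sup>+y. indicator A x * indicator B (y - x) \<partial>q) \<partial>p) = emeasure p A * emeasure q B"
    if [measurable]: "A \<in> sets borel" "B \<in> sets borel" for A B
  proof -
    have "(\<integral>\<^sup>+x. (\<integral>\<^sup>+y. indicator A x * indicator B (y - x) \<partial>q) \<partial>p) = (\<integral>\<^sup>+x. indicator A x * emeasure q B \<partial>p)"
    proof (rule nn_integral_cong_AE, use V(1) in eventually_elim)
      case (elim x)
      have "(\<integral>\<^sup>+y. indicator B (y - x) \<partial>q) = emeasure q B"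
        using q[of "indicator B" x] elim by simp
      moreover have "(\<integral>\<^sup>+y. indicator A x * indicator B (y - x) \<partial>q) = indicator A x * (\<integral>\<^sup>+y. indicator B (y - x) \<partial>q)"
        by (rule nn_integral_cmult) measurable
      ultimately show ?case by simp
    qed
    also have "\<dots> = (\<integral>\<^sup>+x. indicator A x \<partial>p) * emeasure q B"
      by (rule nn_integral_multc) measurable
    also have "\<dots> = emeasure p A * emeasure q B" by simp
    finally show ?thesis .
  qed
  have "(\<integral>\<^sup>+x. (\<integral>\<^sup>+y. indicator A x * indicator B (y - x) \<partial>q) \<partial>p)
      = (\<integral>\<^sup>+y. (\<integral>\<^sup>+x. indicator A x * indicator B (y - x) \<partial>p) \<partial>q)"
    by (rule pq.Fubini'[symmetric]) (simp add: split_beta)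
  \<comment> \<open>The reflection of x to y - x, allowed by the invariance of \<open>p\<close>,
    exchanges the roles of \<open>A\<close> and \<open>B\<close>.\<close>
  also have "\<dots> = (\<integral>\<^sup>+y. (\<integral>\<^sup>+x. indicator B x * indicator A (y - x) \<partial>p) \<partial>q)"
  proof (rule nn_integral_cong_AE, use V(2) in eventually_elim)
    case (elim y)
    show ?case using p[of "\<lambda>x. indicator A x * indicator B (y - x)" y] elim by (simp add: mult.commute)
  qed
  also have "\<dots> = (\<integral>\<^sup>+x. (\<integral>\<^sup>+y. indicator B x * indicator A (y - x) \<partial>q) \<partial>p)"
    by (rule pq.Fubini') (simp add: split_beta)
  finally show ?thesis by (simp add: *)
qed

lemma nn_integral_lborel_reflect:
  fixes c :: "'a::euclidean_space"
  assumes [measurable]: "F \<in> borel_measurable borel"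
  shows "(\<integral>\<^sup>+z. F (c - z) \<partial>lborel) = (\<integral>\<^sup>+z. F z \<partial>lborel)"
proof -
  have "(\<integral>\<^sup>+z. F z \<partial>lborel) = (\<integral>\<^sup>+z. F z \<partial>density (distr lborel borel (\<lambda>x. c + (-1) *\<^sub>R x)) (\<lambda>_. ennreal (\<bar>- (1::real)\<bar>^DIM('a))))"
    using lborel_affine[of "-1" c] by simp
  also have "\<dots> = (\<integral>\<^sup>+z. F (c - z) \<partial>lborel)"
    by (subst nn_integral_density) (auto simp: nn_integral_distr)
  finally show ?thesis by simp
qed

lemma sigma_finite_cballs:
  fixes M :: "'a::euclidean_space measure"
  assumes M: "sets M = sets borel" "\<And>r. 0 < r \<Longrightarrow> emeasure M (cball 0 r) < \<infinity>"
  shows "sigma_finite_measure M"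
proof (rule sigma_finite_measure.intro, intro exI conjI)
  let ?S = "range (\<lambda>n::nat. cball 0 (Suc n) :: 'a set)"
  show "countable ?S" by auto
  show "?S \<subseteq> sets M" unfolding M(1) by auto
  have "\<exists>n. norm x \<le> real (Suc n)" for x :: 'a
    using real_arch_simple[of "norm x"] by (meson le_SucI of_nat_le_iff order_refl order_trans)
  then show "\<Union> ?S = space M"
    using sets_eq_imp_space_eq[OF M(1)] by (auto simp del: of_nat_Suc)
  show "\<forall>a\<in>?S. emeasure M a \<noteq> \<infinity>"
    using M(2) by (intro ballI, elim imageE) (simp add: less_top)
qed

text \<open>The image measure is translation invariant because \<open>f\<close> is linear and onto,
  hence proportional to Lebesgue measure; the unit ball is mapped to itself, so the ratio is
  1.\<close>

lemma lborel_distr_orthogonal: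
  fixes f :: "'a::euclidean_space \<Rightarrow> 'a"
  assumes f: "orthogonal_transformation f"
  shows "distr lborel borel f = lborel"
proof (rule measure_eqI)
  have lin: "linear f" using f by (simp add: orthogonal_transformation_def)
  have cont [measurable]: "f \<in> borel_measurable borel"
    using lin by (intro borel_measurable_continuous_onI linear_continuous_on) (simp add: linear_conv_bounded_linear)
  fix A assume "A \<in> sets (distr lborel borel f)"
  then have A [measurable]: "A \<in> sets borel" by simp
  let ?q = "distr lborel borel f" and ?B = "ball 0 1 :: 'a set"
  have vB: "f -` ?B = ?B" using f by (auto simp: orthogonal_transformation_norm)
  have qB: "emeasure ?q ?B = emeasure lborel ?B" using vB by (subst emeasure_distr) auto
  have "emeasure lborel A * emeasure ?q ?B = emeasure lborel ?B * emeasure ?q A"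
  proof (rule haar_proportional[where V=UNIV])
    show "sigma_finite_measure (lborel :: 'a measure)" by (rule sigma_finite_lborel)
    show "sigma_finite_measure ?q"
    proof (rule sigma_finite_cballs)
      fix r :: real
      have "f -` cball 0 r = cball 0 r" using f by (auto simp: orthogonal_transformation_norm)
      then show "emeasure ?q (cball 0 r) < \<infinity>"
        using emeasure_bounded_finite[OF bounded_cball, of "0 :: 'a" r] by (simp add: emeasure_distr)
    qed simp
    show "(\<integral>\<^sup>+y. F (y - a) \<partial>?q) = (\<integral>\<^sup>+y. F y \<partial>?q)" if [measurable]: "F \<in> borel_measurable borel" for F a
    proof -
      obtain b where b: "f b = - a" using orthogonal_transformation_surj[OF f] by (metis surjD)
      have "(\<integral>\<^sup>+y. F (y - a) \<partial>?q) = (\<integral>\<^sup>+y. F (f (b + y)) \<partial>lborel)"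
        by (subst nn_integral_distr) (auto simp: linear_add[OF lin] b)
      also have "\<dots> = (\<integral>\<^sup>+y. F y \<partial>?q)"
        by (subst nn_integral_lborel_shift[where F="\<lambda>y. F (f y)"]) (auto simp: nn_integral_distr)
      finally show ?thesis .
    qed
  qed (auto simp: nn_integral_lborel_reflect)
  then have "emeasure lborel A * emeasure lborel ?B = emeasure ?q A * emeasure lborel ?B"
    using qB by (simp add: mult.commute)
  moreover have "emeasure lborel ?B \<noteq> 0" "emeasure lborel ?B < \<infinity>"
    using emeasure_bounded_finite[OF bounded_ball]
    by (auto simp: emeasure_ball unit_ball_vol_pos less_imp_neq[symmetric])
  ultimately show "emeasure ?q A = emeasure lborel A"
    by (metis infinity_ennreal_def less_irrefl mult_divide_eq_ennreal)
qed simp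

section \<open>Hausdorff measure on hyperplanes\<close>

text \<open>Packing by volume: balls of radius \<delta>/3 about the points are disjoint and lie in
  the ball of radius 2, so their number is at most the ratio 2/(\<delta>/3) = 6/\<delta> to the
  power n - 1.\<close>

lemma separated_card_le:
  fixes v :: "'a::euclidean_space"
  assumes v: "norm v = 1" and \<delta>: "0 < \<delta>" "\<delta> \<le> 1" and X: "finite X" "X \<subseteq> cball 0 1 \<inter> {y. y \<bullet> v = 0}"
    and sep: "\<And>x y. x \<in> X \<Longrightarrow> y \<in> X \<Longrightarrow> x \<noteq> y \<Longrightarrow> \<delta> < dist x y"
  shows "real (card X) \<le> (6 / \<delta>) ^ (DIM('a) - 1)"
proof -
  let ?s = "DIM('a) - 1" and ?M = "perp_lebesgue v"
  obtain b where b: "emeasure ?M (cball 0 1) = ennreal b" "0 < b"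
    using emeasure_perp_unit_ball[OF v] by (cases "emeasure ?M (cball 0 1)") auto
  have disj: "disjoint_family_on (\<lambda>x. cball x (\<delta> / 3)) X"
  proof (unfold disjoint_family_on_def, intro ballI impI)
    fix x y assume xy: "x \<in> X" "y \<in> X" "x \<noteq> y"
    show "cball x (\<delta> / 3) \<inter> cball y (\<delta> / 3) = {}"
    proof (rule ccontr)
      assume "cball x (\<delta> / 3) \<inter> cball y (\<delta> / 3) \<noteq> {}"
      then obtain z where "z \<in> cball x (\<delta> / 3)" "z \<in> cball y (\<delta> / 3)" by blast
      then have "dist x z \<le> \<delta> / 3" "dist y z \<le> \<delta> / 3" by (simp_all only: mem_cball)
      then show False using sep[OF xy] dist_triangle2[of x y z] \<delta> by linarith
    qed
  qed
  have "(\<Sum>x\<in>X. ennreal ((\<delta> / 3) ^ ?s * b)) = (\<Sum>x\<in>X. emeasure ?M (cball x (\<delta> / 3)))"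
  proof (rule sum.cong)
    fix x assume "x \<in> X"
    then have "x \<bullet> v = 0" using X by auto
    then have "emeasure ?M (cball x (\<delta> / 3)) = ennreal ((\<delta> / 3) ^ ?s) * ennreal b"
      unfolding emeasure_perp_shift[OF v \<open>x \<bullet> v = 0\<close>] using emeasure_perp_cball[OF v, of "\<delta> / 3"] \<delta> b(1) by simp
    also have "\<dots> = ennreal ((\<delta> / 3) ^ ?s * b)" using \<delta> b by (intro ennreal_mult[symmetric]) auto
    finally show "ennreal ((\<delta> / 3) ^ ?s * b) = emeasure ?M (cball x (\<delta> / 3))" ..
  qed simp
  also have "\<dots> = emeasure ?M (\<Union>x\<in>X. cball x (\<delta> / 3))"
    using X disj by (intro sum_emeasure) auto
  also have "\<dots> \<le> emeasure ?M (cball 0 2)"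
  proof (rule emeasure_mono)
    show "(\<Union>x\<in>X. cball x (\<delta> / 3)) \<subseteq> cball 0 2"
    proof (rule UN_least, rule subsetI)
      fix x z assume "x \<in> X" "z \<in> cball x (\<delta> / 3)"
      then have "norm x \<le> 1" "dist x z \<le> \<delta> / 3" using X by auto
      then show "z \<in> cball 0 2" using \<delta> norm_triangle_sub[of z x] by (simp add: dist_norm norm_minus_commute)
    qed
  qed simp
  also have "\<dots> = ennreal (2 ^ ?s * b)"
    using b emeasure_perp_cball[OF v, of 2] by (simp only: ennreal_mult zero_le_power zero_le_numeral less_imp_le zero_less_numeral)
  also have "(\<Sum>x\<in>X. ennreal ((\<delta> / 3) ^ ?s * b)) = ennreal (real (card X) * ((\<delta> / 3) ^ ?s * b))"
    using \<delta> b by (subst sum_ennreal) auto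
  finally have "real (card X) * ((\<delta> / 3) ^ ?s * b) \<le> 2 ^ ?s * b"
    using b by (subst (asm) ennreal_le_iff) auto
  then have "real (card X) * (\<delta> / 3) ^ ?s \<le> 2 ^ ?s" using b by (simp add: mult.assoc[symmetric])
  then have "real (card X) \<le> 2 ^ ?s / (\<delta> / 3) ^ ?s" using \<delta> by (simp add: pos_le_divide_eq)
  also have "\<dots> = (6 / \<delta>) ^ ?s" by (simp add: power_divide[symmetric])
  finally show ?thesis .
qed

text \<open>Balls of radius \<delta> about a maximal \<delta>-separated set cover, and by the
  packing bound their number times \<delta>^(n-1) stays bounded as \<delta> tends to 0.\<close>

lemma hausdorff_perp_ball_finite:
  fixes v :: "'a::euclidean_space"
  assumes v: "norm v = 1"
  shows "hausdorff_outer (DIM('a) - 1) (cball 0 1 \<inter> {y. y \<bullet> v = 0}) < \<infinity>"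
proof -
  define s where "s = DIM('a) - 1"
  let ?B = "cball 0 1 \<inter> {y. y \<bullet> v = 0}"
  have "hausdorff_outer s ?B \<le> ennreal (6 ^ s * unit_ball_vol s)"
  proof (rule hausdorff_outer_least)
    fix \<delta>' :: real assume "0 < \<delta>'"
    \<comment> \<open>Half of \<delta>', because the covering balls have diameter 2\<delta>; at most
      1, as the packing bound demands.\<close>
    define \<delta> where "\<delta> = min 1 (\<delta>' / 2)"
    have \<delta>: "0 < \<delta>" "\<delta> \<le> 1" "2 * \<delta> \<le> \<delta>'" using \<open>0 < \<delta>'\<close> by (auto simp: \<delta>_def)
    define P where "P X \<longleftrightarrow> finite X \<and> X \<subseteq> ?B \<and> (\<forall>x\<in>X. \<forall>y\<in>X. x \<noteq> y \<longrightarrow> \<delta> < dist x y)" for X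
    have cardP: "real (card X) \<le> (6 / \<delta>) ^ s" if "P X" for X
      using that \<delta> unfolding s_def by (intro separated_card_le[OF v]) (auto simp: P_def)
    \<comment> \<open>The packing bound limits the cardinality of separated sets, so a largest one
      exists.\<close>
    obtain X where X: "P X" "\<And>Y. P Y \<Longrightarrow> card Y \<le> card X"
    proof -
      have "\<exists>X. P X \<and> (\<forall>Y. P Y \<longrightarrow> card Y \<le> card X)"
      proof (rule ex_has_greatest_nat)
        show "P {}" by (simp add: P_def)
        show "\<forall>Y. P Y \<longrightarrow> card Y < Suc (nat \<lceil>(6 / \<delta>) ^ s\<rceil>)"
          using cardP by (meson le_imp_less_Suc order_trans of_nat_le_iff real_nat_ceiling_ge)
      qed
      then show ?thesis using that by blast
    qed
    have cover: "?B \<subseteq> (\<Union>x\<in>X. cball x \<delta>)"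
    proof
      fix y assume y: "y \<in> ?B"
      show "y \<in> (\<Union>x\<in>X. cball x \<delta>)"
      proof (rule ccontr)
        assume no: "y \<notin> (\<Union>x\<in>X. cball x \<delta>)"
        then have far: "\<And>x. x \<in> X \<Longrightarrow> \<delta> < dist x y" by (auto simp: not_le)
        then have "P (insert y X)" using X(1) y by (auto simp: P_def dist_commute)
        moreover have "y \<notin> X" using far \<delta>(1) by force
        ultimately show False using X(2)[of "insert y X"] X(1) by (simp add: P_def)
      qed
    qed
    obtain e where e: "bij_betw e {0..<card X} X"
      using X(1) ex_bij_betw_nat_finite[of X] unfolding P_def by blast
    define U where "U i = (if i < card X then cball (e i) \<delta> else {})" for i
    have diamU: "diameter (U i) = (if i < card X then 2 * \<delta> else 0)" for i
      using \<delta> by (simp add: U_def)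
    have "hausdorff_premeasure s \<delta>' ?B \<le> (\<Sum>i. hausdorff_weight s (U i))"
    proof (rule hausdorff_premeasure_le)
      have "(\<Union>x\<in>X. cball x \<delta>) \<subseteq> (\<Union>i. U i)"
        using e by (force simp: U_def bij_betw_def)
      with cover show "?B \<subseteq> (\<Union>i. U i)" by (rule order_trans)
      show "bounded (U i)" for i by (simp add: U_def)
      show "diameter (U i) \<le> \<delta>'" for i using diamU \<delta> by auto
    qed
    also have "\<dots> = (\<Sum>i<card X. hausdorff_weight s (U i))"
      by (rule suminf_finite) (auto simp: U_def hausdorff_weight_def)
    also have "\<dots> = (\<Sum>i<card X. ennreal (unit_ball_vol s * \<delta> ^ s))"
      using \<delta> diamU by (intro sum.cong) (auto simp: hausdorff_weight_def U_def)
    also have "\<dots> = ennreal (real (card X) * (unit_ball_vol s * \<delta> ^ s))"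
      using \<delta> by (subst sum_ennreal) auto
    also have "\<dots> \<le> ennreal ((6 / \<delta>) ^ s * (unit_ball_vol s * \<delta> ^ s))"
      using \<delta> cardP[OF X(1)] by (intro ennreal_leI mult_right_mono) auto
    also have "(6 / \<delta>) ^ s * (unit_ball_vol s * \<delta> ^ s) = 6 ^ s * unit_ball_vol s"
      using \<delta> by (simp add: power_divide)
    finally show "hausdorff_premeasure s \<delta>' ?B \<le> ennreal (6 ^ s * unit_ball_vol s)" .
  qed
  then show ?thesis unfolding s_def by (rule le_less_trans) simp
qed

text \<open>Mass distribution: each covering set meets the hyperplane within a ball whose radius is
  its own diameter, so its weight dominates a fixed multiple of the Lebesgue measure it covers. The
  factor 2^s lost in this way is harmless, since only positivity is wanted.\<close>

lemma hausdorff_perp_ball_pos: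
  fixes v :: "'a::euclidean_space"
  assumes v: "norm v = 1"
  shows "hausdorff_outer (DIM('a) - 1) (cball 0 1 \<inter> {y. y \<bullet> v = 0}) \<noteq> 0"
proof
  define s where "s = DIM('a) - 1"
  let ?B = "cball 0 1 \<inter> {y. y \<bullet> v = 0}" and ?M = "perp_lebesgue v"
  assume "hausdorff_outer (DIM('a) - 1) ?B = 0"
  then have 0: "hausdorff_outer s ?B = 0" by (simp only: s_def)
  obtain b where b: "emeasure ?M (cball 0 1) = ennreal b" "0 < b"
    using emeasure_perp_unit_ball[OF v] by (cases "emeasure ?M (cball 0 1)") auto
  \<comment> \<open>Chosen so that c times the weight of a set of diameter d equals d^s times b, the
    bound for a ball of radius d.\<close>
  define c where "c = ennreal (2 ^ s * b / unit_ball_vol s)"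
  have "0 < unit_ball_vol s" by simp
  then have pos: "0 < unit_ball_vol s" "unit_ball_vol s \<noteq> 0" by (simp, metis less_irrefl)
  have bound: "ennreal b \<le> c * (\<Sum>i. hausdorff_weight s (U i))"
    if U: "?B \<subseteq> (\<Union>i. U i)" "\<And>i. bounded (U i)" for U :: "nat \<Rightarrow> 'a set"
  proof -
    have AE: "AE y in ?M. y \<in> cball 0 1 \<longrightarrow> y \<in> ?B" using AE_perp_lebesgue[OF v] by eventually_elim auto
    define x where "x i = (SOME x. x \<in> U i \<and> x \<bullet> v = 0)" for i
    define W where "W i = (if \<exists>x\<in>U i. x \<bullet> v = 0 then cball (x i) (diameter (U i)) else {})" for i
    have x: "x i \<in> U i" "x i \<bullet> v = 0" if "\<exists>x\<in>U i. x \<bullet> v = 0" for i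
      using that someI_ex[of "\<lambda>x. x \<in> U i \<and> x \<bullet> v = 0"] by (auto simp: x_def)
    have BW: "?B \<subseteq> (\<Union>i. W i)"
    proof
      fix y assume y: "y \<in> ?B"
      then obtain i where i: "y \<in> U i" using U by blast
      then have ex: "\<exists>x\<in>U i. x \<bullet> v = 0" using y by auto
      then have "dist (x i) y \<le> diameter (U i)" using x[OF ex] U(2) i by (intro diameter_bounded_bound) auto
      then have "y \<in> W i" using ex by (simp add: W_def)
      then show "y \<in> (\<Union>i. W i)" by blast
    qed
    have "ennreal b \<le> emeasure ?M (\<Union>i. W i)"
      unfolding b(1)[symmetric]
    proof (rule emeasure_mono_AE)
      show "AE y in ?M. y \<in> cball 0 1 \<longrightarrow> y \<in> (\<Union>i. W i)"
        using AE by eventually_elim (use BW in \<open>meson subsetD\<close>)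
    qed (auto simp: W_def)
    also have "\<dots> \<le> (\<Sum>i. emeasure ?M (W i))"
      by (rule emeasure_subadditive_countably) (auto simp: W_def)
    also have "\<dots> \<le> (\<Sum>i. c * hausdorff_weight s (U i))"
    proof (rule suminf_le)
      fix i
      show "emeasure ?M (W i) \<le> c * hausdorff_weight s (U i)"
      proof (cases "\<exists>x\<in>U i. x \<bullet> v = 0")
        case True
        let ?d = "diameter (U i)"
        have d: "0 \<le> ?d" using U(2) diameter_ge_0 by auto
        have "emeasure ?M (W i) \<le> ennreal (?d ^ s) * ennreal b"
          using emeasure_perp_cball_le[OF v x(2)[OF True] d] True b by (simp add: W_def s_def)
        also have "\<dots> = c * ennreal (unit_ball_vol s * (?d / 2) ^ s)"
          unfolding c_def using d b pos
          by (simp add: ennreal_mult[symmetric] power_divide)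
        finally show ?thesis using True by (auto simp: hausdorff_weight_def)
      qed (simp add: W_def)
    qed auto
    finally show ?thesis by (simp add: ennreal_suminf_cmult)
  qed
  \<comment> \<open>This makes c times e equal to b/2, contradicting the lower bound b.\<close>
  define e where "e = b / 2 / (2 ^ s * b / unit_ball_vol s)"
  have e: "0 < e" using b pos by (simp add: e_def)
  obtain U :: "nat \<Rightarrow> 'a set" where U: "ennreal b \<le> c * (\<Sum>i. hausdorff_weight s (U i))" "(\<Sum>i. hausdorff_weight s (U i)) < ennreal e"
  proof -
    have "hausdorff_premeasure s 1 ?B \<le> hausdorff_outer s ?B"
      by (rule hausdorff_premeasure_le_outer) simp
    then have "hausdorff_premeasure s 1 ?B < ennreal e" using 0 e by simp
    then obtain U :: "nat \<Rightarrow> 'a set" where "?B \<subseteq> (\<Union>i. U i)" "\<And>i. bounded (U i)" "(\<Sum>i. hausdorff_weight s (U i)) < ennreal e"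
      unfolding hausdorff_premeasure_def INF_less_iff by auto
    then show ?thesis using bound[of U] that by blast
  qed
  have "ennreal b \<le> c * ennreal e"
    using U by (meson less_imp_le mult_left_mono order_trans zero_le)
  also have "\<dots> = ennreal (b / 2)"
    unfolding c_def e_def using b pos by (subst ennreal_mult[symmetric]) auto
  finally show False using b by simp
qed

text \<open>Confinement to the hyperplane makes the measure sigma-finite, as Fubini requires; the
  image under the identity has the Borel sets as its sigma-algebra instead of all Caratheodory
  measurable sets.\<close>

definition hausdorff_perp :: "'a::euclidean_space \<Rightarrow> 'a measure" where
  "hausdorff_perp v = density (distr (hausdorff_measure (DIM('a) - 1)) borel (\<lambda>x. x)) (indicator {y. y \<bullet> v = 0})"

lemma sets_hausdorff_perp [measurable_cong, simp]: "sets (hausdorff_perp v) = sets borel"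
  by (simp add: hausdorff_perp_def)

lemma space_hausdorff_perp [simp]: "space (hausdorff_perp v) = UNIV"
  by (simp add: hausdorff_perp_def)

lemma emeasure_distr_hausdorff:
  assumes "B \<in> sets borel"
  shows "emeasure (distr (hausdorff_measure s) borel (\<lambda>x. x)) B = hausdorff_outer s (B :: 'a::metric_space set)"
  using assms by (simp add: emeasure_distr id_measurable_hausdorff emeasure_hausdorff borel_in_sets_hausdorff)

lemma emeasure_hausdorff_perp:
  fixes v :: "'a::euclidean_space"
  assumes B: "B \<in> sets borel"
  shows "emeasure (hausdorff_perp v) B = hausdorff_outer (DIM('a) - 1) (B \<inter> {y. y \<bullet> v = 0})"
proof -
  let ?D = "distr (hausdorff_measure (DIM('a) - 1)) borel (\<lambda>x. x) :: 'a measure"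
  have "emeasure (hausdorff_perp v) B = (\<integral>\<^sup>+x. indicator {y. y \<bullet> v = 0} x * indicator B x \<partial>?D)"
    unfolding hausdorff_perp_def using B by (intro emeasure_density) auto
  also have "\<dots> = (\<integral>\<^sup>+x. indicator (B \<inter> {y. y \<bullet> v = 0}) x \<partial>?D)"
    by (intro nn_integral_cong) (auto split: split_indicator)
  also have "\<dots> = emeasure ?D (B \<inter> {y. y \<bullet> v = 0})"
    using B by (intro nn_integral_indicator) auto
  also have "\<dots> = hausdorff_outer (DIM('a) - 1) (B \<inter> {y. y \<bullet> v = 0})"
    using B by (intro emeasure_distr_hausdorff) auto
  finally show ?thesis .
qed

lemma hausdorff_perp_ball_scaled_finite:
  fixes v :: "'a::euclidean_space"
  assumes v: "norm v = 1" and r: "0 < r"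
  shows "hausdorff_outer (DIM('a) - 1) (cball 0 r \<inter> {y. y \<bullet> v = 0}) < \<infinity>"
proof -
  let ?B = "cball 0 1 \<inter> {y. y \<bullet> v = 0}"
  have "cball 0 r \<inter> {y. y \<bullet> v = 0} \<subseteq> (\<lambda>x. r *\<^sub>R x) ` ?B"
  proof
    fix y assume "y \<in> cball 0 r \<inter> {y. y \<bullet> v = 0}"
    then show "y \<in> (\<lambda>x. r *\<^sub>R x) ` ?B" using r
      by (intro image_eqI[of _ _ "inverse r *\<^sub>R y"]) (auto simp: field_simps)
  qed
  then have "hausdorff_outer (DIM('a) - 1) (cball 0 r \<inter> {y. y \<bullet> v = 0}) \<le> hausdorff_outer (DIM('a) - 1) ((\<lambda>x. r *\<^sub>R x) ` ?B)"
    by (rule hausdorff_outer_mono)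
  also have "\<dots> \<le> ennreal (r ^ (DIM('a) - 1)) * hausdorff_outer (DIM('a) - 1) ?B"
    using r by (intro hausdorff_outer_Lipschitz) (auto simp: dist_norm scaleR_diff_right[symmetric])
  also have "\<dots> < \<infinity>" using hausdorff_perp_ball_finite[OF v] by (simp add: ennreal_mult_less_top)
  finally show ?thesis .
qed

lemma sigma_finite_hausdorff_perp:
  fixes v :: "'a::euclidean_space"
  assumes v: "norm v = 1"
  shows "sigma_finite_measure (hausdorff_perp v)"
  by (rule sigma_finite_cballs) (use hausdorff_perp_ball_scaled_finite[OF v] in \<open>simp_all add: emeasure_hausdorff_perp\<close>)

lemma sigma_finite_perp_lebesgue:
  fixes v :: "'a::euclidean_space"
  assumes v: "norm v = 1"
  shows "sigma_finite_measure (perp_lebesgue v)"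
  by (rule sigma_finite_cballs) (use emeasure_perp_bounded[OF v bounded_cball] in simp_all)

text \<open>The map y to a - y is an isometry of the hyperplane onto itself, and Hausdorff measure
  is invariant under isometries.\<close>

lemma nn_integral_hausdorff_perp_reflect:
  fixes v :: "'a::euclidean_space"
  assumes v: "norm v = 1" and a: "a \<bullet> v = 0" and F [measurable]: "F \<in> borel_measurable borel"
  shows "(\<integral>\<^sup>+y. F (a - y) \<partial>hausdorff_perp v) = (\<integral>\<^sup>+y. F y \<partial>hausdorff_perp v)"
proof -
  have "distr (hausdorff_perp v) borel (\<lambda>y. a - y) = hausdorff_perp v"
  proof (rule measure_eqI)
    fix A assume "A \<in> sets (distr (hausdorff_perp v) borel ((-) a))"
    then have [measurable]: "A \<in> sets borel" by simp
    have [measurable]: "{y. a - y \<in> A} \<in> sets borel" by measurable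
    have "emeasure (distr (hausdorff_perp v) borel ((-) a)) A =
        hausdorff_outer (DIM('a) - 1) ({y. a - y \<in> A} \<inter> {y. y \<bullet> v = 0})"
      by (subst emeasure_distr) (auto simp: vimage_def emeasure_hausdorff_perp)
    also have "{y. a - y \<in> A} \<inter> {y. y \<bullet> v = 0} = (\<lambda>y. a - y) ` (A \<inter> {y. y \<bullet> v = 0})"
    proof (intro set_eqI iffI)
      fix y assume "y \<in> {y. a - y \<in> A} \<inter> {y. y \<bullet> v = 0}"
      then show "y \<in> (\<lambda>y. a - y) ` (A \<inter> {y. y \<bullet> v = 0})"
        using a by (intro image_eqI[of _ _ "a - y"]) (auto simp: inner_diff_left)
    qed (use a in \<open>auto simp: inner_diff_left\<close>)
    also have "hausdorff_outer (DIM('a) - 1) \<dots> = emeasure (hausdorff_perp v) A"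
      by (subst hausdorff_outer_isometry) (auto simp: emeasure_hausdorff_perp dist_norm norm_minus_commute)
    finally show "emeasure (distr (hausdorff_perp v) borel ((-) a)) A = emeasure (hausdorff_perp v) A" .
  qed simp
  moreover have "(\<integral>\<^sup>+y. F (a - y) \<partial>hausdorff_perp v) = (\<integral>\<^sup>+y. F y \<partial>distr (hausdorff_perp v) borel (\<lambda>y. a - y))"
    by (subst nn_integral_distr) auto
  ultimately show ?thesis by simp
qed

text \<open>An instance of \<open>haar_proportional\<close> with the unit ball as reference set; the
  product form avoids division in \<open>ennreal\<close>.\<close>

lemma hausdorff_perp_eq:
  fixes v :: "'a::euclidean_space"
  assumes v: "norm v = 1" and A [measurable]: "A \<in> sets borel" and AV: "A \<subseteq> {y. y \<bullet> v = 0}"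
  shows "hausdorff_outer (DIM('a) - 1) A * emeasure (perp_lebesgue v) (cball 0 1)
    = hausdorff_outer (DIM('a) - 1) (cball 0 1 \<inter> {y. y \<bullet> v = 0}) * emeasure (perp_lebesgue v) A"
proof -
  have "emeasure (hausdorff_perp v) A * emeasure (perp_lebesgue v) (cball 0 1)
    = emeasure (hausdorff_perp v) (cball 0 1) * emeasure (perp_lebesgue v) A"
  proof (rule haar_proportional[where V="{y. y \<bullet> v = 0}"])
    show "AE x in hausdorff_perp v. x \<in> {y. y \<bullet> v = 0}"
      unfolding hausdorff_perp_def by (subst AE_density) (auto intro!: AE_I2 simp: indicator_def split: if_splits)
    show "(\<integral>\<^sup>+y. F (y - a) \<partial>perp_lebesgue v) = (\<integral>\<^sup>+y. F y \<partial>perp_lebesgue v)"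
      if "F \<in> borel_measurable borel" "a \<in> {y. y \<bullet> v = 0}" for F a
      using nn_integral_perp_shift[OF v, of "-a" F] that by simp
  qed (use v in \<open>auto simp: sigma_finite_hausdorff_perp sigma_finite_perp_lebesgue AE_perp_lebesgue
      nn_integral_hausdorff_perp_reflect\<close>)
  then show ?thesis using AV by (simp add: emeasure_hausdorff_perp Int_absorb2)
qed

text \<open>The ratio is the same for all hyperplanes: a rotation taking a fixed unit vector to v
  preserves Hausdorff measure as an isometry, and preserves the volume of cylinders by rotation
  invariance of Lebesgue measure.\<close>

lemma hausdorff_hyperplane_constant:
  obtains \<kappa> :: real where "0 < \<kappa>"
    "\<And>(v :: real ^ 'n) A. norm v = 1 \<Longrightarrow> A \<in> sets borel \<Longrightarrow> A \<subseteq> {y. y \<bullet> v = 0} \<Longrightarrow>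
      hausdorff_outer (CARD('n) - 1) A = ennreal \<kappa> * emeasure (perp_lebesgue v) A"
proof -
  let ?s = "CARD('n) - 1"
  define h :: "real ^ 'n \<Rightarrow> ennreal" where "h v = hausdorff_outer ?s (cball 0 1 \<inter> {y. y \<bullet> v = 0})" for v
  define b :: "real ^ 'n \<Rightarrow> ennreal" where "b v = emeasure (perp_lebesgue v) (cball 0 1)" for v
  define e where "e = (SOME i. i \<in> (Basis :: (real ^ 'n) set))"
  have e: "norm e = 1" unfolding e_def by (intro norm_Basis SOME_Basis)
  have hb: "h v = h e \<and> b v = b e" if v: "norm v = 1" for v
  proof -
    obtain f where f: "orthogonal_transformation f" "f e = v"
      using orthogonal_transformation_exists[of e v] e v by metis
    have inn: "f x \<bullet> f y = x \<bullet> y" for x y using f by (simp add: orthogonal_transformation_def)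
    have lin: "linear f" using f by (simp add: orthogonal_transformation_def)
    have cont [measurable]: "f \<in> borel_measurable borel"
      using lin by (intro borel_measurable_continuous_onI linear_continuous_on) (simp add: linear_conv_bounded_linear)
    have nf: "norm (f x) = norm x" for x using f by (simp add: orthogonal_transformation_norm)
    have "f ` (cball 0 1 \<inter> {y. y \<bullet> e = 0}) = cball 0 1 \<inter> {y. y \<bullet> v = 0}"
    proof (intro set_eqI iffI)
      fix y assume y: "y \<in> cball 0 1 \<inter> {y. y \<bullet> v = 0}"
      obtain x where x: "y = f x" using orthogonal_transformation_surj[OF f(1)] by (metis surjD)
      then have "x \<in> cball 0 1 \<inter> {y. y \<bullet> e = 0}" using y inn[of x e] f nf by auto
      then show "y \<in> f ` (cball 0 1 \<inter> {y. y \<bullet> e = 0})" using x by blast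
    qed (use inn f nf in \<open>auto simp flip: f(2)\<close>)
    then have "h v = h e"
      unfolding h_def using nf lin
      by (metis (no_types, lifting) hausdorff_outer_isometry dist_norm linear_diff)
    have proj: "proj_perp v (f z) = f (proj_perp e z)" for z
      using inn[of z e] f by (simp add: proj_perp_def linear_diff[OF lin] linear_scale[OF lin])
    have [measurable]: "cball (0::real^'n) 1 \<in> sets borel" by simp
    have "b v = emeasure (distr lborel borel f) {z. proj_perp v z \<in> cball 0 1 \<and> 0 \<le> z \<bullet> v \<and> z \<bullet> v \<le> 1}"
      unfolding b_def by (subst emeasure_perp_lebesgue) (simp_all add: lborel_distr_orthogonal[OF f(1)])
    also have "\<dots> = emeasure lborel {z. proj_perp e z \<in> cball 0 1 \<and> 0 \<le> z \<bullet> e \<and> z \<bullet> e \<le> 1}"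
    proof (subst emeasure_distr)
      show "{z. proj_perp v z \<in> cball 0 1 \<and> 0 \<le> z \<bullet> v \<and> z \<bullet> v \<le> 1} \<in> sets borel" by measurable
      have "z \<bullet> e = f z \<bullet> v" for z using inn[of z e] f by simp
      then show "emeasure lborel (f -` {z. proj_perp v z \<in> cball 0 1 \<and> 0 \<le> z \<bullet> v \<and> z \<bullet> v \<le> 1} \<inter> space lborel)
        = emeasure lborel {z. proj_perp e z \<in> cball 0 1 \<and> 0 \<le> z \<bullet> e \<and> z \<bullet> e \<le> 1}"
        by (simp add: vimage_def proj nf)
    qed simp
    also have "\<dots> = b e" unfolding b_def by (subst emeasure_perp_lebesgue) simp_all
    finally show ?thesis using \<open>h v = h e\<close> by simp
  qed
  obtain h' where h': "h e = ennreal h'" "0 < h'"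
  proof -
    have "h e < \<infinity>" "h e \<noteq> 0"
      using hausdorff_perp_ball_finite[OF e] hausdorff_perp_ball_pos[OF e] by (simp_all add: h_def)
    then show ?thesis using that by (cases "h e") auto
  qed
  obtain b' where b': "b e = ennreal b'" "0 < b'"
    using emeasure_perp_unit_ball[OF e] unfolding b_def[symmetric] by (cases "b e") auto
  show ?thesis
  proof (rule that[of "h' / b'"])
    show "0 < h' / b'" using h' b' by simp
    fix v :: "real ^ 'n" and A assume v: "norm v = 1" and A: "A \<in> sets borel" "A \<subseteq> {y. y \<bullet> v = 0}"
    have "hausdorff_outer ?s A * ennreal b' = ennreal h' * emeasure (perp_lebesgue v) A"
    proof -
      have "hausdorff_outer ?s A * b v = h v * emeasure (perp_lebesgue v) A"
        using hausdorff_perp_eq[OF v A] by (simp add: h_def b_def)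
      then show ?thesis using hb[OF v] h' b' by simp
    qed
    then have "hausdorff_outer ?s A = ennreal h' * emeasure (perp_lebesgue v) A / ennreal b'"
      using b' by (metis ennreal_neq_top less_irrefl mult_divide_eq_ennreal ennreal_eq_0_iff not_le)
    also have "\<dots> = ennreal (h' / b') * emeasure (perp_lebesgue v) A"
      using b' h' by (simp add: divide_ennreal[symmetric] divide_ennreal_def ac_simps)
    finally show "hausdorff_outer ?s A = ennreal (h' / b') * emeasure (perp_lebesgue v) A" .
  qed
qed

section \<open>Boundaries of convex bodies\<close>

text \<open>Split the difference d of the points as p + a v with p orthogonal to v. A supporting
  inequality at one of them bounds the height by (a c)^2 \<le> |p|^2 (1 - c^2), and Pythagoras turns
  this into c |d| \<le> |p|.\<close>

lemma support_proj_Lipschitz: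
  fixes x y v :: "'a::real_inner"
  assumes v: "norm v = 1" and c: "0 < c"
    and u: "norm u = 1" "y \<bullet> u \<le> x \<bullet> u" "c \<le> u \<bullet> v"
    and w: "norm w = 1" "x \<bullet> w \<le> y \<bullet> w" "c \<le> w \<bullet> v"
  shows "c * norm (x - y) \<le> norm (proj_perp v x - proj_perp v y)"
proof -
  have main: "c * norm d \<le> norm (proj_perp v d)"
    if d: "d \<bullet> u \<le> 0" "0 \<le> d \<bullet> v" and u: "norm u = 1" "c \<le> u \<bullet> v" for d u
  proof -
    define a p where "a = d \<bullet> v" and "p = proj_perp v d"
    have pv: "p \<bullet> v = 0" by (simp add: p_def proj_perp_inner[OF v])
    have dp: "d = p + a *\<^sub>R v" by (simp add: a_def p_def proj_perp_def)
    have "a * c \<le> a * (u \<bullet> v)" using u d by (intro mult_left_mono) (auto simp: a_def)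
    also have "\<dots> \<le> - (p \<bullet> u)"
    proof -
      have "d \<bullet> u = p \<bullet> u + a * (u \<bullet> v)"
        by (subst dp) (simp only: inner_add_left inner_scaleR_left inner_commute[of v u])
      then show ?thesis using d(1) by simp
    qed
    also have "\<dots> = - (p \<bullet> proj_perp v u)" using pv by (simp add: proj_perp_def inner_diff_right)
    also have "\<dots> \<le> norm p * norm (proj_perp v u)"
      using Cauchy_Schwarz_ineq2[of p "proj_perp v u"] by linarith
    finally have "a * c \<le> norm p * norm (proj_perp v u)" .
    moreover have "0 \<le> a * c" using d c by (simp add: a_def)
    ultimately have "(a * c)\<^sup>2 \<le> (norm p * norm (proj_perp v u))\<^sup>2" by (intro power_mono)
    also have "\<dots> = (norm p)\<^sup>2 * (1 - (u \<bullet> v)\<^sup>2)"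
      using u by (simp add: power_mult_distrib norm_proj_perp_sq[OF v])
    also have "\<dots> \<le> (norm p)\<^sup>2 * (1 - c\<^sup>2)"
      using u c by (intro mult_left_mono diff_left_mono power_mono) auto
    finally have 1: "(a * c)\<^sup>2 \<le> (norm p)\<^sup>2 * (1 - c\<^sup>2)" .
    have "(norm d)\<^sup>2 = (norm p)\<^sup>2 + a\<^sup>2"
      using norm_proj_perp_sq[OF v, of d] by (simp add: a_def p_def)
    then have "(c * norm d)\<^sup>2 = c\<^sup>2 * (norm p)\<^sup>2 + (a * c)\<^sup>2"
      by (simp add: power_mult_distrib algebra_simps)
    also have "\<dots> \<le> (norm p)\<^sup>2" using 1 by (simp add: algebra_simps)
    finally have "(c * norm d)\<^sup>2 \<le> (norm p)\<^sup>2" .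
    then show ?thesis unfolding p_def by (rule power2_le_imp_le) simp
  qed
  \<comment> \<open>The normal at the lower of the two points, with respect to v, is the one that
    limits the rise.\<close>
  show ?thesis
  proof (cases "0 \<le> (y - x) \<bullet> v")
    case True
    then have "c * norm (y - x) \<le> norm (proj_perp v (y - x))"
      using u by (intro main[of _ u]) (auto simp: inner_diff_left)
    then show ?thesis by (simp add: proj_perp_diff norm_minus_commute)
  next
    case False
    then have "c * norm (x - y) \<le> norm (proj_perp v (x - y))"
      using w by (intro main[of _ w]) (auto simp: inner_diff_left)
    then show ?thesis by (simp add: proj_perp_diff)
  qed
qed

section \<open>Surface measure on graphs over hyperplanes\<close>

definition hausdorff_borel :: "nat \<Rightarrow> 'a::metric_space measure" where
  "hausdorff_borel s = distr (hausdorff_measure s) borel (\<lambda>x. x)"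

lemma sets_hausdorff_borel [measurable_cong, simp]: "sets (hausdorff_borel s) = sets borel"
  by (simp add: hausdorff_borel_def)

lemma space_hausdorff_borel [simp]: "space (hausdorff_borel s) = UNIV"
  by (simp add: hausdorff_borel_def)

lemma emeasure_hausdorff_borel: "B \<in> sets borel \<Longrightarrow> emeasure (hausdorff_borel s) B = hausdorff_outer s B"
  unfolding hausdorff_borel_def by (rule emeasure_distr_hausdorff)

definition lift_perp :: "'a::euclidean_space \<Rightarrow> 'a set \<Rightarrow> 'a \<Rightarrow> 'a" where
  "lift_perp v A y = (if y \<in> proj_perp v ` A then the_inv_into A (proj_perp v) y else 0)"

lemma graph_inj:
  assumes "0 < c" "\<And>x y. x \<in> A \<Longrightarrow> y \<in> A \<Longrightarrow> c * norm (x - y) \<le> norm (proj_perp v x - proj_perp v y)"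
  shows "inj_on (proj_perp v) A"
proof (rule inj_onI)
  fix x y assume "x \<in> A" "y \<in> A" "proj_perp v x = proj_perp v y"
  then have "c * norm (x - y) \<le> 0" using assms(2)[of x y] by simp
  then show "x = y" using assms(1) by (simp add: mult_le_0_iff)
qed

lemma lift_perp_proj:
  assumes "inj_on (proj_perp v) A" "x \<in> A"
  shows "lift_perp v A (proj_perp v x) = x"
  using assms by (simp add: lift_perp_def the_inv_into_f_f)

text \<open>The inverse of a continuous injection on a compact set is continuous; outside the
  compact image the function is constant.\<close>

lemma lift_perp_measurable:
  fixes v :: "'a::euclidean_space"
  assumes A: "compact A" and inj: "inj_on (proj_perp v) A"
  shows "lift_perp v A \<in> borel_measurable borel"
proof -
  have "compact (proj_perp v ` A)" by (intro compact_continuous_image continuous_proj_perp A)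
  moreover have "continuous_on (proj_perp v ` A) (the_inv_into A (proj_perp v))"
    using inj by (intro continuous_on_inv continuous_proj_perp A) (simp add: the_inv_into_f_f)
  ultimately show ?thesis
    unfolding lift_perp_def by (intro borel_measurable_continuous_on_if) (auto intro: borel_compact)
qed

text \<open>From here on the ratio \<kappa> enters only through these two properties. The parameter
  \<open>dummy\<close> carries the index type and with it the dimension.\<close>

locale hausdorff_constant =
  fixes \<kappa> :: real and dummy :: "'n::finite itself"
  assumes \<kappa>_pos: "0 < \<kappa>"
    and hausdorff_hyperplane: "\<And>(v :: real ^ 'n) A. norm v = 1 \<Longrightarrow> A \<in> sets borel \<Longrightarrow> A \<subseteq> {y. y \<bullet> v = 0} \<Longrightarrow>
      hausdorff_outer (CARD('n) - 1) A = ennreal \<kappa> * emeasure (perp_lebesgue v) A"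
begin

text \<open>The projection is 1-Lipschitz and its inverse on \<open>A\<close> is 1/c-Lipschitz. So
  Hausdorff measure on the graph and \<kappa> times the measure of the projection agree up to the
  factor c^(n-1), which is close to 1 when c is.\<close>

lemma graph_sets:
  fixes v :: "real ^ 'n"
  assumes v: "norm v = 1" and c: "0 < c" and A: "compact A"
    and Lip: "\<And>x y. x \<in> A \<Longrightarrow> y \<in> A \<Longrightarrow> c * norm (x - y) \<le> norm (proj_perp v x - proj_perp v y)"
    and B: "B \<in> sets borel"
  shows "proj_perp v ` (A \<inter> B) = proj_perp v ` A \<inter> (lift_perp v A -` B)" (is ?th1)
    and "proj_perp v ` (A \<inter> B) \<in> sets borel" (is ?th2)
    and "ennreal \<kappa> * emeasure (perp_lebesgue v) (proj_perp v ` (A \<inter> B)) \<le> hausdorff_outer (CARD('n) - 1) (A \<inter> B)" (is ?th3)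
    and "ennreal (c ^ (CARD('n) - 1)) * hausdorff_outer (CARD('n) - 1) (A \<inter> B) \<le>
      ennreal \<kappa> * emeasure (perp_lebesgue v) (proj_perp v ` (A \<inter> B))" (is ?th4)
proof -
  have inj: "inj_on (proj_perp v) A" using c Lip by (rule graph_inj)
  show 1: ?th1 using lift_perp_proj[OF inj] by auto
  have "proj_perp v ` A \<in> sets borel"
    by (intro borel_proj_perp_image A)
  moreover have "lift_perp v A -` B \<in> sets borel"
    using measurable_sets[OF lift_perp_measurable[OF A inj] B] by simp
  ultimately show 2: ?th2 unfolding 1 by blast
  have sub: "proj_perp v ` (A \<inter> B) \<subseteq> {y. y \<bullet> v = 0}" using proj_perp_inner[OF v] by auto
  note eq = hausdorff_hyperplane[OF v 2 sub]
  show ?th3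
    unfolding eq[symmetric]
    using hausdorff_outer_Lipschitz[of 1 "A \<inter> B" "proj_perp v" "CARD('n) - 1"] norm_proj_perp_le[OF v]
    by (simp add: dist_norm proj_perp_diff[symmetric])
  have "lift_perp v A ` (proj_perp v ` (A \<inter> B)) = A \<inter> B"
    using lift_perp_proj[OF inj] by (force simp: image_image)
  then have "hausdorff_outer (CARD('n) - 1) (A \<inter> B) = hausdorff_outer (CARD('n) - 1) (lift_perp v A ` (proj_perp v ` (A \<inter> B)))"
    by simp
  also have "\<dots> \<le> ennreal ((1 / c) ^ (CARD('n) - 1)) * hausdorff_outer (CARD('n) - 1) (proj_perp v ` (A \<inter> B))"
  proof (rule hausdorff_outer_Lipschitz)
    fix x y assume "x \<in> proj_perp v ` (A \<inter> B)" "y \<in> proj_perp v ` (A \<inter> B)"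
    then obtain x' y' where "x = proj_perp v x'" "x' \<in> A" "y = proj_perp v y'" "y' \<in> A" by auto
    then show "dist (lift_perp v A x) (lift_perp v A y) \<le> 1 / c * dist x y"
      using Lip[of x' y'] c by (simp add: lift_perp_proj[OF inj] dist_norm field_simps)
  qed (use c in simp)
  finally have "ennreal (c ^ (CARD('n) - 1)) * hausdorff_outer (CARD('n) - 1) (A \<inter> B) \<le>
      ennreal (c ^ (CARD('n) - 1)) * (ennreal ((1 / c) ^ (CARD('n) - 1)) * hausdorff_outer (CARD('n) - 1) (proj_perp v ` (A \<inter> B)))"
    by (rule mult_left_mono) simp
  also have "\<dots> = hausdorff_outer (CARD('n) - 1) (proj_perp v ` (A \<inter> B))"
    using c by (simp add: mult.assoc[symmetric] ennreal_mult[symmetric] power_divide)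
  finally show ?th4 unfolding eq .
qed

text \<open>The set inequalities of \<open>graph_sets\<close> say that two Borel measures are
  ordered, and ordered measures have ordered integrals.\<close>

lemma graph_integral:
  fixes v :: "real ^ 'n"
  assumes v: "norm v = 1" and c: "0 < c" and A: "compact A"
    and Lip: "\<And>x y. x \<in> A \<Longrightarrow> y \<in> A \<Longrightarrow> c * norm (x - y) \<le> norm (proj_perp v x - proj_perp v y)"
    and \<phi> [measurable]: "\<phi> \<in> borel_measurable borel"
  defines "I \<equiv> ennreal \<kappa> * (\<integral>\<^sup>+y. indicator (proj_perp v ` A) y * \<phi> (lift_perp v A y) \<partial>perp_lebesgue v)"
  shows "I \<le> (\<integral>\<^sup>+x. indicator A x * \<phi> x \<partial>hausdorff_borel (CARD('n) - 1))"
    and "ennreal (c ^ (CARD('n) - 1)) * (\<integral>\<^sup>+x. indicator A x * \<phi> x \<partial>hausdorff_borel (CARD('n) - 1)) \<le> I"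
proof -
  let ?s = "CARD('n) - 1"
  have inj: "inj_on (proj_perp v) A" using c Lip by (rule graph_inj)
  have Ab [measurable]: "A \<in> sets borel" using A by (rule borel_compact)
  have Db [measurable]: "proj_perp v ` A \<in> sets borel"
    by (intro borel_proj_perp_image A)
  have lm [measurable]: "lift_perp v A \<in> borel_measurable borel" by (rule lift_perp_measurable[OF A inj])
  \<comment> \<open>\<open>M\<close> is the hyperplane measure carried up to the graph,
    \<open>N\<close> the surface measure on it; both live on the Borel sets of the whole
    space.\<close>
  define M where "M = distr (density (perp_lebesgue v) (\<lambda>y. ennreal \<kappa> * indicator (proj_perp v ` A) y)) borel (lift_perp v A)"
  define N where "N = density (hausdorff_borel ?s :: (real ^ 'n) measure) (indicator A)"
  have sMN: "sets M = sets borel" "sets N = sets borel" by (simp_all add: M_def N_def)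
  have eM: "emeasure M B = ennreal \<kappa> * emeasure (perp_lebesgue v) (proj_perp v ` (A \<inter> B))" if [measurable]: "B \<in> sets borel" for B
  proof -
    have "emeasure M B = (\<integral>\<^sup>+y. ennreal \<kappa> * indicator (proj_perp v ` A) y * indicator (lift_perp v A -` B) y \<partial>perp_lebesgue v)"
      unfolding M_def using measurable_sets[OF lm that] by (subst emeasure_distr) (auto simp: emeasure_density)
    also have "\<dots> = (\<integral>\<^sup>+y. ennreal \<kappa> * indicator (proj_perp v ` (A \<inter> B)) y \<partial>perp_lebesgue v)"
      by (intro nn_integral_cong) (simp only: graph_sets(1)[OF v c A Lip that] indicator_inter_arith mult.assoc)
    also have "\<dots> = ennreal \<kappa> * emeasure (perp_lebesgue v) (proj_perp v ` (A \<inter> B))"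
      using graph_sets(2)[OF v c A Lip that] by (intro nn_integral_cmult_indicator) simp
    finally show ?thesis .
  qed
  have eN: "emeasure N B = hausdorff_outer ?s (A \<inter> B)" if [measurable]: "B \<in> sets borel" for B
  proof -
    have "emeasure N B = (\<integral>\<^sup>+x. indicator A x * indicator B x \<partial>hausdorff_borel ?s)"
      unfolding N_def by (intro emeasure_density) auto
    also have "\<dots> = (\<integral>\<^sup>+x. indicator (A \<inter> B) x \<partial>hausdorff_borel ?s)"
      by (intro nn_integral_cong) (simp only: indicator_inter_arith)
    also have "\<dots> = hausdorff_outer ?s (A \<inter> B)"
      by (subst nn_integral_indicator) (auto simp: emeasure_hausdorff_borel)
    finally show ?thesis .
  qed
  have I: "I = (\<integral>\<^sup>+x. \<phi> x \<partial>M)"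
  proof -
    have "(\<integral>\<^sup>+x. \<phi> x \<partial>M) = (\<integral>\<^sup>+y. ennreal \<kappa> * indicator (proj_perp v ` A) y * \<phi> (lift_perp v A y) \<partial>perp_lebesgue v)"
      unfolding M_def by (subst nn_integral_distr) (auto simp: nn_integral_density)
    also have "\<dots> = I" unfolding I_def by (subst nn_integral_cmult[symmetric]) (auto simp: mult.assoc)
    finally show ?thesis by simp
  qed
  have N: "(\<integral>\<^sup>+x. indicator A x * \<phi> x \<partial>hausdorff_borel ?s) = (\<integral>\<^sup>+x. \<phi> x \<partial>N)"
    unfolding N_def by (subst nn_integral_density) auto
  have "M \<le> N"
    using sMN eM eN graph_sets(3)[OF v c A Lip] by (subst le_measure) auto
  then show "I \<le> (\<integral>\<^sup>+x. indicator A x * \<phi> x \<partial>hausdorff_borel ?s)"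
    unfolding I N using sMN by (intro nn_integral_mono_measure) auto
  have "density N (\<lambda>_. ennreal (c ^ ?s)) \<le> M"
    using sMN eM eN graph_sets(4)[OF v c A Lip] by (subst le_measure) (auto simp: emeasure_density_const)
  then have "(\<integral>\<^sup>+x. \<phi> x \<partial>density N (\<lambda>_. ennreal (c ^ ?s))) \<le> (\<integral>\<^sup>+x. \<phi> x \<partial>M)"
    using sMN by (intro nn_integral_mono_measure) auto
  also have "(\<integral>\<^sup>+x. \<phi> x \<partial>density N (\<lambda>_. ennreal (c ^ ?s))) = ennreal (c ^ ?s) * (\<integral>\<^sup>+x. \<phi> x \<partial>N)"
  proof -
    have [measurable]: "\<phi> \<in> borel_measurable N" using \<phi> measurable_cong_sets[OF sMN(2) refl] by blast
    show ?thesis by (subst nn_integral_density) (auto intro!: nn_integral_cmult)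
  qed
  finally show "ennreal (c ^ ?s) * (\<integral>\<^sup>+x. indicator A x * \<phi> x \<partial>hausdorff_borel ?s) \<le> I"
    unfolding I N .
qed

end

section \<open>Outer unit normals, and finiteness of the boundary area\<close>

definition unit_normals :: "'a::real_inner set \<Rightarrow> 'a \<Rightarrow> 'a set" where
  "unit_normals K x = {u. norm u = 1 \<and> (\<forall>y\<in>K. y \<bullet> u \<le> x \<bullet> u)}"

definition singular_points :: "'a::real_inner set \<Rightarrow> 'a set" where
  "singular_points K = {x \<in> K. \<exists>u\<in>unit_normals K x. \<exists>w\<in>unit_normals K x. u \<noteq> w}"

locale body = hausdorff_constant \<kappa> "TYPE('n)" for \<kappa> and dummy :: "'n::finite itself" +
  fixes K :: "(real ^ 'n) set" and r R :: real
  assumes K_compact: "compact K" and K_convex: "convex K"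
    and r_pos: "0 < r" and K_inner: "cball 0 r \<subseteq> K" and K_outer: "K \<subseteq> cball 0 R"
begin

lemma normal_ge: "u \<in> unit_normals K x \<Longrightarrow> r \<le> x \<bullet> u"
proof -
  assume u: "u \<in> unit_normals K x"
  then have "r *\<^sub>R u \<in> K" using K_inner r_pos by (auto simp: unit_normals_def)
  then have "(r *\<^sub>R u) \<bullet> u \<le> x \<bullet> u" using u by (auto simp: unit_normals_def)
  then show ?thesis using u by (simp add: unit_normals_def norm_eq_1)
qed

lemma frontier_iff: "x \<in> frontier K \<longleftrightarrow> x \<in> K \<and> unit_normals K x \<noteq> {}"
proof
  assume x: "x \<in> frontier K"
  have cl: "closure K = K" using K_compact by (simp add: compact_imp_closed)
  have "interior K \<noteq> {}" using K_inner r_pos interior_maximal[of "ball 0 r" K] ball_subset_cball by force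
  then have "x \<notin> rel_interior K" "x \<in> K"
    using x by (auto simp: frontier_def cl rel_interior_nonempty_interior)
  then obtain a where a: "a \<noteq> 0" "\<And>y. y \<in> closure K \<Longrightarrow> a \<bullet> x \<le> a \<bullet> y"
    using supporting_hyperplane_relative_frontier[OF K_convex, of x] cl by metis
  have "(- a) /\<^sub>R norm a \<in> unit_normals K x"
    using a cl by (auto simp: unit_normals_def inner_commute divide_right_mono)
  then show "x \<in> K \<and> unit_normals K x \<noteq> {}" using \<open>x \<in> K\<close> by blast
next
  assume x: "x \<in> K \<and> unit_normals K x \<noteq> {}"
  then obtain u where u: "norm u = 1" "\<And>y. y \<in> K \<Longrightarrow> y \<bullet> u \<le> x \<bullet> u" by (auto simp: unit_normals_def)
  have "x \<notin> interior K"
  proof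
    assume "x \<in> interior K"
    then obtain e where e: "0 < e" "cball x e \<subseteq> K" by (meson mem_interior_cball)
    then have "x + e *\<^sub>R u \<in> K" using u by (auto simp: dist_norm)
    then have "(x + e *\<^sub>R u) \<bullet> u \<le> x \<bullet> u" using u by blast
    then show False using e u by (simp add: inner_add_left norm_eq_1)
  qed
  then show "x \<in> frontier K" using x closure_subset by (auto simp: frontier_def)
qed

lemma reverse_gauss_image_eq:
  assumes "\<eta> \<subseteq> sphere 0 1"
  shows "reverse_gauss_image K \<eta> = {x \<in> K. \<eta> \<inter> unit_normals K x \<noteq> {}}"
proof -
  have "v \<in> unit_normals K x \<longleftrightarrow> (\<forall>y\<in>K. y \<bullet> v \<le> x \<bullet> v)" if "v \<in> \<eta>" for v x
    using assms that by (auto simp: unit_normals_def)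
  then have "(\<exists>v\<in>\<eta>. \<forall>y\<in>K. y \<bullet> v \<le> x \<bullet> v) \<longleftrightarrow> \<eta> \<inter> unit_normals K x \<noteq> {}" for x by blast
  then show ?thesis unfolding reverse_gauss_image_def using frontier_iff by blast
qed

text \<open>The pairs of a point of \<open>K\<close> and one of its normals in \<open>C\<close> form
  a compact set, being cut out by closed conditions; the set in question is its first
  projection.\<close>

lemma compact_normals:
  assumes "closed C"
  shows "compact {x \<in> K. C \<inter> unit_normals K x \<noteq> {}}"
proof -
  define T where "T = (K \<times> (sphere 0 1 \<inter> C)) \<inter> (\<Inter>y\<in>K. {p. y \<bullet> snd p \<le> fst p \<bullet> snd p})"
  have "closed (\<Inter>y\<in>K. {p :: (real^'n) \<times> (real^'n). y \<bullet> snd p \<le> fst p \<bullet> snd p})"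
    by (intro closed_INT ballI closed_Collect_le continuous_intros)
  then have "compact T" unfolding T_def
    using K_compact assms by (intro compact_Int_closed compact_Times) auto
  then have "compact (fst ` T)" by (intro compact_continuous_image continuous_intros)
  also have "fst ` T = {x \<in> K. C \<inter> unit_normals K x \<noteq> {}}"
  proof (rule set_eqI)
    fix x
    have "x \<in> fst ` T \<longleftrightarrow> (\<exists>u. (x, u) \<in> T)" by force
    also have "\<dots> \<longleftrightarrow> x \<in> {x \<in> K. C \<inter> unit_normals K x \<noteq> {}}"
      unfolding T_def unit_normals_def by auto
    finally show "x \<in> fst ` T \<longleftrightarrow> x \<in> {x \<in> K. C \<inter> unit_normals K x \<noteq> {}}" .
  qed
  finally show ?thesis .
qed

lemma compact_frontier_K: "compact (frontier K)"
  using compact_frontier[OF K_compact] .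

lemma normals_Lipschitz:
  assumes v: "norm v = 1" and c: "0 < c" and xy: "x \<in> K" "y \<in> K"
    and u: "u \<in> unit_normals K x" "c \<le> u \<bullet> v" and w: "w \<in> unit_normals K y" "c \<le> w \<bullet> v"
  shows "c * norm (x - y) \<le> norm (proj_perp v x - proj_perp v y)"
  using support_proj_Lipschitz[OF v c, of u y x w] assms by (auto simp: unit_normals_def)

lemma R_pos: "0 < R"
proof -
  have "r *\<^sub>R (SOME i. i \<in> (Basis :: (real^'n) set)) \<in> K"
    using K_inner r_pos by (auto simp: norm_Basis[OF SOME_Basis])
  then have "r \<le> R" using K_outer r_pos by (auto simp: norm_Basis[OF SOME_Basis])
  then show ?thesis using r_pos by simp
qed

text \<open>Near a point \<open>q\<close> the boundary is a Lipschitz graph in the radial direction.\<close>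

lemma radial_normal_ge:
  assumes q: "norm q \<le> R" and x: "norm (x - q) \<le> r / 2" and u: "u \<in> unit_normals K x"
  shows "q \<noteq> 0" "r / (2 * R) \<le> u \<bullet> (q /\<^sub>R norm q)"
proof -
  have "x \<bullet> u - q \<bullet> u \<le> norm (x - q)"
    using Cauchy_Schwarz_ineq2[of "x - q" u] u by (simp add: inner_diff_left unit_normals_def)
  then have 1: "r / 2 \<le> q \<bullet> u" using normal_ge[OF u] x by linarith
  then show "q \<noteq> 0" using r_pos by auto
  then have "0 < norm q" by simp
  have "r / (2 * R) \<le> r / (2 * norm q)"
    using r_pos q \<open>0 < norm q\<close> R_pos by (intro divide_left_mono) auto
  also have "\<dots> \<le> u \<bullet> (q /\<^sub>R norm q)"
    using 1 \<open>0 < norm q\<close> by (simp add: inner_commute field_simps)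
  finally show "r / (2 * R) \<le> u \<bullet> (q /\<^sub>R norm q)" .
qed

lemma finite_cover:
  obtains F where "finite F" "\<And>q. q \<in> F \<Longrightarrow> norm q \<le> R" "K \<subseteq> (\<Union>q\<in>F. cball q (r / 2))"
proof -
  obtain F where F: "F \<subseteq> K" "finite F" "K \<subseteq> (\<Union>q\<in>F. ball q (r / 2))"
    using compactE_image[OF K_compact, of K "\<lambda>q. ball q (r / 2)"] r_pos by (metis (no_types, lifting) UN_I centre_in_ball half_gt_zero open_ball subsetI)
  show thesis
  proof (rule that[OF F(2)])
    show "norm q \<le> R" if "q \<in> F" for q using that F(1) K_outer by auto
    show "K \<subseteq> (\<Union>q\<in>F. cball q (r / 2))" using F(3) ball_subset_cball by blast
  qed
qed

lemma radial_Lipschitz: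
  assumes q: "norm q \<le> R" and x: "x \<in> frontier K \<inter> cball q (r / 2)" and y: "y \<in> frontier K \<inter> cball q (r / 2)"
  shows "r / (2 * R) * norm (x - y) \<le> norm (proj_perp (q /\<^sub>R norm q) x - proj_perp (q /\<^sub>R norm q) y)"
proof -
  obtain u where u: "u \<in> unit_normals K x" using x frontier_iff by blast
  obtain w where w: "w \<in> unit_normals K y" using y frontier_iff by blast
  have n: "norm (x - q) \<le> r / 2" "norm (y - q) \<le> r / 2"
    using x y by (auto simp: dist_norm norm_minus_commute)
  show ?thesis
    using radial_normal_ge[OF q n(1) u] radial_normal_ge[OF q n(2) w] r_pos R_pos x y u w
    by (intro normals_Lipschitz[where u=u and w=w]) (auto simp: frontier_iff)
qed

text \<open>Finitely many balls of radius r/2 cover \<open>K\<close>, and within each the boundary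
  is a radial Lipschitz graph over a bounded set.\<close>

lemma hausdorff_frontier_finite: "hausdorff_outer (CARD('n) - 1) (frontier K) < \<infinity>"
proof -
  let ?s = "CARD('n) - 1" and ?c = "r / (2 * R)"
  obtain F where F: "finite F" "\<And>q. q \<in> F \<Longrightarrow> norm q \<le> R" "K \<subseteq> (\<Union>q\<in>F. cball q (r / 2))"
    using finite_cover by blast
  define A where "A q = frontier K \<inter> cball q (r / 2)" for q
  have cA: "compact (A q)" for q unfolding A_def using compact_frontier_K by (intro compact_Int_closed) auto
  have fin: "hausdorff_outer ?s (A q) < \<infinity>" if q: "q \<in> F" for q
  proof (cases "A q = {}")
    case False
    obtain x u where x: "x \<in> A q" "u \<in> unit_normals K x" using False frontier_iff unfolding A_def by blast
    then have "q \<noteq> 0"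
      using radial_normal_ge(1)[OF F(2)[OF q], of x u] by (auto simp: A_def dist_norm norm_minus_commute)
    define v where "v = q /\<^sub>R norm q"
    have v: "norm v = 1" using \<open>q \<noteq> 0\<close> by (simp add: v_def)
    have c: "0 < ?c" using r_pos R_pos by simp
    have Lip: "\<And>x y. x \<in> A q \<Longrightarrow> y \<in> A q \<Longrightarrow> ?c * norm (x - y) \<le> norm (proj_perp v x - proj_perp v y)"
      unfolding A_def v_def by (rule radial_Lipschitz[OF F(2)[OF q]])
    have bd: "bounded (proj_perp v ` A q)"
      by (intro compact_imp_bounded compact_continuous_image continuous_proj_perp cA)
    have "ennreal (?c ^ ?s) * hausdorff_outer ?s (A q) \<le> ennreal \<kappa> * emeasure (perp_lebesgue v) (proj_perp v ` A q)"
      using graph_sets(4)[OF v c cA Lip, where B=UNIV] by simp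
    also have "\<dots> < \<infinity>"
      using emeasure_perp_bounded[OF v bd] by (simp add: ennreal_mult_less_top)
    finally show ?thesis using c by (auto simp: ennreal_mult_less_top)
  qed simp
  have "hausdorff_outer ?s (frontier K) = emeasure (hausdorff_borel ?s) (\<Union>q\<in>F. A q)"
  proof -
    have "frontier K = (\<Union>q\<in>F. A q)" using F(3) frontier_iff by (auto simp: A_def)
    then show ?thesis using compact_frontier_K by (simp add: emeasure_hausdorff_borel borel_compact)
  qed
  also have "\<dots> \<le> (\<Sum>q\<in>F. emeasure (hausdorff_borel ?s) (A q))"
    using F(1) cA by (intro emeasure_subadditive_finite) (auto intro: borel_compact)
  also have "\<dots> < \<infinity>" using fin F(1) cA by (simp add: emeasure_hausdorff_borel borel_compact less_top)
  finally show ?thesis .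
qed

section \<open>Boundary points with several normals form a null set\<close>

text \<open>If \<open>x\<close> has unit normals \<open>u1\<close>, \<open>u2\<close> with \<open>u1 \<bullet> w > 0 > u2 \<bullet> w\<close>, then the line through \<open>x\<close> in
  direction \<open>w\<close> meets \<open>K\<close> in \<open>x\<close> alone. So the projection of the set of these points along \<open>v\<close> meets each
  line in the direction of the projection of \<open>w\<close> at most once.\<close>

lemma singular_line_unique:
  assumes x: "x1 \<in> K" "x2 \<in> K"
    and u1: "u1 \<in> unit_normals K x1" "0 < u1 \<bullet> w" "0 < u1 \<bullet> v"
    and u2: "u2 \<in> unit_normals K x2" "u2 \<bullet> w < 0" "0 < u2 \<bullet> v"
    and t: "0 < t" "proj_perp v x2 - proj_perp v x1 = t *\<^sub>R proj_perp v w"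
  shows False
proof -
  define a where "a = (x2 - x1) \<bullet> v - t * (w \<bullet> v)"
  have d: "x2 - x1 = t *\<^sub>R w + a *\<^sub>R v"
    using t(2) by (simp add: proj_perp_def a_def algebra_simps)
  have "(x2 - x1) \<bullet> u1 \<le> 0" "0 \<le> (x2 - x1) \<bullet> u2"
    using u1 u2 x by (auto simp: unit_normals_def inner_diff_left)
  then have 1: "t * (u1 \<bullet> w) + a * (u1 \<bullet> v) \<le> 0" "0 \<le> t * (u2 \<bullet> w) + a * (u2 \<bullet> v)"
    unfolding d by (simp_all add: inner_add_left inner_add_right inner_commute)
  have "0 < t * (u1 \<bullet> w)" "t * (u2 \<bullet> w) < 0" using t u1 u2 by (auto simp: mult_pos_neg)
  then have "a * (u1 \<bullet> v) < 0" "0 < a * (u2 \<bullet> v)" using 1 by linarith+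
  then show False using u1 u2 by (auto simp: mult_less_0_iff zero_less_mult_iff)
qed

text \<open>The thresholds \<open>e\<close> and \<open>- e\<close>, instead of strict signs, make
  the piece compact; the ball keeps it within one radial graph.\<close>

definition sing_piece :: "real ^ 'n \<Rightarrow> real \<Rightarrow> real ^ 'n \<Rightarrow> (real ^ 'n) set" where
  "sing_piece w e q = {x \<in> K. {u. e \<le> u \<bullet> w} \<inter> unit_normals K x \<noteq> {}} \<inter>
     {x \<in> K. {u. u \<bullet> w \<le> - e} \<inter> unit_normals K x \<noteq> {}} \<inter> cball q (r / 2)"

lemma compact_sing_piece: "compact (sing_piece w e q)"
  unfolding sing_piece_def
  by (intro compact_Int compact_normals compact_cball closed_Collect_le continuous_intros)

text \<open>Project along the radial direction v. Inside the hyperplane, lines in the direction of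
  the projection of w meet the image at most once by \<open>singular_line_unique\<close>, so the
  image is null by Fubini, and the Lipschitz inverse carries this back to the piece.\<close>

lemma sing_piece_null:
  assumes e: "0 < e" and q: "norm q \<le> R"
  shows "hausdorff_outer (CARD('n) - 1) (sing_piece w e q) = 0"
proof (cases "sing_piece w e q = {}")
  case False
  let ?s = "CARD('n) - 1" and ?c = "r / (2 * R)" and ?Z = "sing_piece w e q"
  define v where "v = q /\<^sub>R norm q"
  have Zsub: "?Z \<subseteq> frontier K \<inter> cball q (r / 2)" using frontier_iff by (auto simp: sing_piece_def)
  have pos: "q \<noteq> 0 \<and> 0 < u \<bullet> v" if "x \<in> ?Z" "u \<in> unit_normals K x" for x u
  proof -
    have "norm (x - q) \<le> r / 2" using that Zsub by (auto simp: dist_norm norm_minus_commute)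
    moreover have "0 < r / (2 * R)" using r_pos R_pos by simp
    ultimately show ?thesis using radial_normal_ge[OF q, of x u] that unfolding v_def by auto
  qed
  obtain x0 u0 where "x0 \<in> ?Z" "u0 \<in> unit_normals K x0" "e \<le> u0 \<bullet> w"
    using False unfolding sing_piece_def by blast
  then have u0: "0 < u0 \<bullet> w" "0 < u0 \<bullet> v" "q \<noteq> 0" using pos e by auto
  obtain u0' where "u0' \<in> unit_normals K x0" "u0' \<bullet> w \<le> - e"
    using \<open>x0 \<in> ?Z\<close> by (auto simp: sing_piece_def)
  then have u0': "u0' \<bullet> w < 0" "0 < u0' \<bullet> v" using pos \<open>x0 \<in> ?Z\<close> e by auto
  have v: "norm v = 1" using u0 by (simp add: v_def)
  have c: "0 < ?c" using r_pos R_pos by simp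
  have Lip: "\<And>x y. x \<in> ?Z \<Longrightarrow> y \<in> ?Z \<Longrightarrow> ?c * norm (x - y) \<le> norm (proj_perp v x - proj_perp v y)"
    unfolding v_def using Zsub by (intro radial_Lipschitz[OF q]) auto
  define f where "f = proj_perp v w"
  \<comment> \<open>If w were parallel to v, all normals at x0 would have inner products with w of
    the same sign, since they all point towards v.\<close>
  have "f \<noteq> 0"
  proof
    assume "f = 0"
    then have "w = (w \<bullet> v) *\<^sub>R v" by (simp add: f_def proj_perp_def)
    then have "u0 \<bullet> w = (w \<bullet> v) * (u0 \<bullet> v)" "u0' \<bullet> w = (w \<bullet> v) * (u0' \<bullet> v)" by (metis inner_scaleR_right)+
    then show False using u0 u0' by (auto simp: zero_less_mult_iff mult_less_0_iff)
  qed
  define d where "d = f /\<^sub>R norm f"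
  have d: "norm d = 1" "d \<bullet> v = 0" "f = norm f *\<^sub>R d"
    using \<open>f \<noteq> 0\<close> proj_perp_inner[OF v, of w] by (auto simp: d_def f_def)
  \<comment> \<open>Fubini acts on full-dimensional Lebesgue measure, so the image is thickened to a
    unit cylinder and sliced along d, which is orthogonal to v.\<close>
  define W where "W = {z. proj_perp v z \<in> proj_perp v ` ?Z \<and> 0 \<le> z \<bullet> v \<and> z \<bullet> v \<le> 1}"
  have PZ [measurable]: "proj_perp v ` ?Z \<in> sets borel"
    by (intro borel_proj_perp_image compact_sing_piece)
  have [measurable]: "W \<in> sets borel" unfolding W_def by measurable
  have uniq: False if "t1 < t2" "y + t1 *\<^sub>R d \<in> W" "y + t2 *\<^sub>R d \<in> W" for y t1 t2
  proof -
    obtain x1 x2 where x: "x1 \<in> ?Z" "x2 \<in> ?Z" "proj_perp v (y + t1 *\<^sub>R d) = proj_perp v x1"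
      "proj_perp v (y + t2 *\<^sub>R d) = proj_perp v x2" using \<open>y + t1 *\<^sub>R d \<in> W\<close> \<open>y + t2 *\<^sub>R d \<in> W\<close> by (auto simp: W_def)
    have "proj_perp v x2 - proj_perp v x1 = proj_perp v ((t2 - t1) *\<^sub>R d)"
      unfolding x(3,4)[symmetric] by (simp add: proj_perp_diff[symmetric] algebra_simps)
    also have "\<dots> = (t2 - t1) *\<^sub>R d" using d by (intro proj_perp_id) simp
    also have "\<dots> = ((t2 - t1) / norm f) *\<^sub>R f"
      using d(3) \<open>f \<noteq> 0\<close> by (metis divide_eq_eq norm_eq_zero scaleR_scaleR)
    finally have eq: "proj_perp v x2 - proj_perp v x1 = ((t2 - t1) / norm f) *\<^sub>R proj_perp v w"
      by (simp only: f_def)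
    obtain u1 u2 where "u1 \<in> unit_normals K x1" "e \<le> u1 \<bullet> w" "u2 \<in> unit_normals K x2" "u2 \<bullet> w \<le> - e"
      using x(1,2) by (auto simp: sing_piece_def)
    moreover have "0 < (t2 - t1) / norm f" using \<open>t1 < t2\<close> \<open>f \<noteq> 0\<close> by simp
    moreover have "x1 \<in> K" "x2 \<in> K" using x by (auto simp: sing_piece_def)
    ultimately show False using singular_line_unique[of x1 x2 u1 w v u2, OF _ _ _ _ _ _ _ _ _ eq] pos x e by force
  qed
  have "emeasure (perp_lebesgue v) (proj_perp v ` ?Z) = emeasure lborel W"
    unfolding W_def by (rule emeasure_perp_lebesgue[OF PZ])
  also have "\<dots> = (\<integral>\<^sup>+z. indicator W z \<partial>lborel)" by simp
  also have "\<dots> = (\<integral>\<^sup>+y. (\<integral>\<^sup>+t. indicator W (y + t *\<^sub>R d) \<partial>lborel) \<partial>perp_lebesgue d)"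
    by (rule nn_integral_lborel_perp[OF d(1)]) measurable
  also have "\<dots> = (\<integral>\<^sup>+y. 0 \<partial>perp_lebesgue d)"
  proof (rule nn_integral_cong)
    fix y
    let ?T = "{t. y + t *\<^sub>R d \<in> W}"
    have [measurable]: "?T \<in> sets borel" by measurable
    have "(\<integral>\<^sup>+t. indicator W (y + t *\<^sub>R d) \<partial>lborel) = (\<integral>\<^sup>+t. indicator ?T t \<partial>lborel)"
      by (intro nn_integral_cong) (auto split: split_indicator)
    also have "\<dots> = emeasure lborel ?T" by simp
    also have "\<dots> = 0"
    proof (rule emeasure_lborel_countable)
      have "t1 = t2" if "t1 \<in> ?T" "t2 \<in> ?T" for t1 t2
        using uniq[of t1 t2 y] uniq[of t2 t1 y] that by (cases t1 t2 rule: linorder_cases) auto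
      then have "?T = {} \<or> (\<exists>t. ?T = {t})" by blast
      then show "countable ?T" by (metis countable_empty countable_insert)
    qed
    finally show "(\<integral>\<^sup>+t. indicator W (y + t *\<^sub>R d) \<partial>lborel) = 0" .
  qed
  finally have "emeasure (perp_lebesgue v) (proj_perp v ` ?Z) = 0" by simp
  then have "ennreal (?c ^ ?s) * hausdorff_outer ?s ?Z \<le> 0"
    using graph_sets(4)[OF v c compact_sing_piece[of w e q] Lip, where B=UNIV] by simp
  then show ?thesis using c by auto
qed simp

text \<open>Distinct unit normals u1, u2 are separated by w = u1 - u2. The separation is an open
  condition on w, so w can be taken from a countable dense set and the threshold from the numbers
  1/(m+1): a countable union of null pieces.\<close>

lemma singular_points_null:
  "singular_points K \<in> sets borel" "hausdorff_outer (CARD('n) - 1) (singular_points K) = 0"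
proof -
  obtain D :: "(real ^ 'n) set" where D: "countable D" "\<And>X. open X \<Longrightarrow> X \<noteq> {} \<Longrightarrow> \<exists>d\<in>D. d \<in> X"
    by (metis countable_dense_setE)
  obtain F where F: "finite F" "\<And>q. q \<in> F \<Longrightarrow> norm q \<le> R" "K \<subseteq> (\<Union>q\<in>F. cball q (r / 2))"
    using finite_cover by blast
  have eq: "singular_points K = (\<Union>w\<in>D. \<Union>m::nat. \<Union>q\<in>F. sing_piece w (1 / Suc m) q)"
  proof (intro set_eqI iffI)
    fix x assume "x \<in> singular_points K"
    then obtain u1 u2 where x: "x \<in> K" "u1 \<in> unit_normals K x" "u2 \<in> unit_normals K x" "u1 \<noteq> u2"
      by (auto simp: singular_points_def)
    let ?X = "{w. 0 < u1 \<bullet> w} \<inter> {w. u2 \<bullet> w < 0}"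
    have n: "u1 \<bullet> u1 = 1" "u2 \<bullet> u2 = 1" using x by (auto simp: unit_normals_def norm_eq_1)
    have "0 < (u1 - u2) \<bullet> (u1 - u2)" using x by simp
    then have "u1 \<bullet> u2 < 1" using n by (simp add: algebra_simps inner_commute)
    then have "u1 - u2 \<in> ?X" using n by (simp add: algebra_simps inner_commute)
    moreover have "open ?X" by (intro open_Int open_Collect_less continuous_intros)
    ultimately obtain w where w: "w \<in> D" "0 < u1 \<bullet> w" "u2 \<bullet> w < 0" using D(2)[of ?X] by blast
    obtain m where m: "1 / real (Suc m) < min (u1 \<bullet> w) (- (u2 \<bullet> w))"
      using reals_Archimedean[of "min (u1 \<bullet> w) (- (u2 \<bullet> w))"] w by (auto simp: inverse_eq_divide)
    obtain q where q: "q \<in> F" "x \<in> cball q (r / 2)" using F(3) x by blast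
    have "1 / real (Suc m) \<le> u1 \<bullet> w" "u2 \<bullet> w \<le> - (1 / real (Suc m))" using m by linarith+
    then have "x \<in> sing_piece w (1 / Suc m) q"
      using x q unfolding sing_piece_def by blast
    then show "x \<in> (\<Union>w\<in>D. \<Union>m::nat. \<Union>q\<in>F. sing_piece w (1 / Suc m) q)" using w q by blast
  next
    fix x assume "x \<in> (\<Union>w\<in>D. \<Union>m::nat. \<Union>q\<in>F. sing_piece w (1 / Suc m) q)"
    then obtain w m u1 u2 where "x \<in> K" "u1 \<in> unit_normals K x" "u2 \<in> unit_normals K x"
      "1 / real (Suc m) \<le> u1 \<bullet> w" "u2 \<bullet> w \<le> - (1 / real (Suc m))" unfolding sing_piece_def by blast
    moreover have "0 < 1 / real (Suc m)" by simp
    ultimately have "0 < u1 \<bullet> w" "u2 \<bullet> w < 0" by linarith+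
    then have "u1 \<noteq> u2" by auto
    then show "x \<in> singular_points K"
      using \<open>x \<in> K\<close> \<open>u1 \<in> unit_normals K x\<close> \<open>u2 \<in> unit_normals K x\<close> by (auto simp: singular_points_def)
  qed
  have "sing_piece w (1 / Suc m) q \<in> null_sets (hausdorff_borel (CARD('n) - 1))" if "q \<in> F" for w m q
    using sing_piece_null[OF _ F(2)[OF that], of "1 / Suc m" w] borel_compact[OF compact_sing_piece]
    by (auto simp: null_sets_def emeasure_hausdorff_borel)
  then have "singular_points K \<in> null_sets (hausdorff_borel (CARD('n) - 1))"
    unfolding eq by (intro null_sets_UN'[OF D(1)] null_sets_UN null_sets_UN'[OF countable_finite[OF F(1)]])
  then show "singular_points K \<in> sets borel" "hausdorff_outer (CARD('n) - 1) (singular_points K) = 0"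
    by (auto simp: null_sets_def emeasure_hausdorff_borel)
qed

end

section \<open>Gaussian measure and support functions\<close>

definition gauss_density :: "real ^ 'n \<Rightarrow> real" where
  "gauss_density x = 1 / sqrt (2 * pi) ^ CARD('n) * exp (- ((norm x)\<^sup>2) / 2)"

lemma gauss_density_pos: "0 < gauss_density x"
  by (simp add: gauss_density_def)

lemma gauss_density_le_1: "gauss_density (x :: real ^ 'n) \<le> 1"
proof -
  have "1 \<le> sqrt (2 * pi)" using pi_gt3 by simp
  then have "1 \<le> sqrt (2 * pi) ^ CARD('n)" by (rule one_le_power)
  moreover have "exp (- ((norm x)\<^sup>2) / 2) \<le> 1" by simp
  ultimately show ?thesis unfolding gauss_density_def
    by (intro mult_le_one) auto
qed

lemma gauss_density_minus [simp]: "gauss_density (- x) = gauss_density x"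
  by (simp add: gauss_density_def)

lemma gauss_density_measurable [measurable]: "gauss_density \<in> borel_measurable borel"
  unfolding gauss_density_def by measurable

lemma gauss_density_antimono: "norm x \<le> norm y \<Longrightarrow> gauss_density y \<le> gauss_density x"
  for x y :: "real ^ 'n"
  unfolding gauss_density_def by (auto intro!: divide_right_mono power_mono)

text \<open>On a ball of radius \<open>R\<close> the density varies over distance s by a factor that
  tends to 1 with s; so it may be frozen along the short segments of extrusions and caps.\<close>

lemma gauss_density_ratio:
  assumes "norm z \<le> R" "norm (x - z) \<le> s"
  shows "exp (- (2 * R * s + s\<^sup>2) / 2) * gauss_density z \<le> gauss_density x"
proof -
  have s: "0 \<le> s" using assms(2) norm_ge_zero order_trans by blast
  have "norm x \<le> norm z + s" using assms(2) norm_triangle_sub[of x z] by linarith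
  then have "(norm x)\<^sup>2 \<le> (norm z + s)\<^sup>2" by (intro power_mono) auto
  also have "\<dots> = (norm z)\<^sup>2 + 2 * norm z * s + s\<^sup>2" by (simp add: power2_sum)
  also have "\<dots> \<le> (norm z)\<^sup>2 + 2 * R * s + s\<^sup>2" using assms s by (simp add: mult_right_mono)
  finally have "- (2 * R * s + s\<^sup>2) / 2 + - ((norm z)\<^sup>2) / 2 \<le> - ((norm x)\<^sup>2) / 2"
    by (simp add: field_simps)
  then have "exp (- (2 * R * s + s\<^sup>2) / 2) * exp (- ((norm z)\<^sup>2) / 2) \<le> exp (- ((norm x)\<^sup>2) / 2)"
    unfolding exp_add[symmetric] by (rule iffD2[OF exp_le_cancel_iff])
  then show ?thesis
    unfolding gauss_density_def by (simp add: mult.left_commute mult_left_mono divide_right_mono)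
qed

lemma gaussian_measure_eq: "gaussian_measure = density lborel (\<lambda>x. ennreal (gauss_density x))"
  by (simp add: gaussian_measure_def gauss_density_def)

lemma sets_gaussian_measure [measurable_cong, simp]: "sets gaussian_measure = sets borel"
  by (simp add: gaussian_measure_eq)

lemma space_gaussian_measure [simp]: "space gaussian_measure = UNIV"
  by (simp add: gaussian_measure_eq)

lemma emeasure_gaussian:
  "A \<in> sets borel \<Longrightarrow> emeasure gaussian_measure A = (\<integral>\<^sup>+x. ennreal (gauss_density x) * indicator A x \<partial>lborel)"
  unfolding gaussian_measure_eq by (rule emeasure_density) auto

text \<open>The density is the product of the standard normal densities of the coordinates.\<close>

lemma prob_space_gaussian: "prob_space (gaussian_measure :: (real ^ 'n) measure)"
proof
  have eq: "gauss_density x = (\<Prod>b\<in>Basis. std_normal_density (x \<bullet> b))" for x :: "real ^ 'n"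
  proof -
    have "(norm x)\<^sup>2 = (\<Sum>b\<in>Basis. (x \<bullet> b)\<^sup>2)"
      unfolding power2_norm_eq_inner by (subst euclidean_inner) (simp add: power2_eq_square)
    then have "exp (- ((norm x)\<^sup>2) / 2) = (\<Prod>b\<in>Basis. exp (- (x \<bullet> b)\<^sup>2 / 2))"
      by (simp add: exp_sum[symmetric] sum_negf sum_divide_distrib[symmetric])
    then show ?thesis
      by (simp add: gauss_density_def std_normal_density_def prod_dividef prod.distrib power_divide[symmetric])
  qed
  have 1: "(\<integral>\<^sup>+x. ennreal (std_normal_density x) \<partial>lborel) = 1"
    using prob_space.emeasure_space_1[OF prob_space_normal_density[of 1 0]]
    by (simp add: emeasure_density)
  have "emeasure (gaussian_measure :: (real ^ 'n) measure) UNIV = (\<integral>\<^sup>+x. (\<Prod>b\<in>Basis. ennreal (std_normal_density (x \<bullet> b))) \<partial>(lborel :: (real ^ 'n) measure))"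
    by (subst emeasure_gaussian) (auto simp: eq prod_ennreal)
  also have "\<dots> = 1" by (subst nn_integral_lborel_prod) (auto simp: 1)
  finally show "emeasure (gaussian_measure :: (real ^ 'n) measure) (space gaussian_measure) = 1" by simp
qed

lemma emeasure_gaussian_eq_measure: "emeasure gaussian_measure A = ennreal (measure gaussian_measure A)"
  by (rule finite_measure.emeasure_eq_measure[OF prob_space.axioms(1)[OF prob_space_gaussian]])

lemma measure_gaussian_le_1: "measure gaussian_measure A \<le> 1"
  by (rule prob_space.prob_le_1[OF prob_space_gaussian])

lemma measure_gaussian_mono: "A \<subseteq> B \<Longrightarrow> B \<in> sets borel \<Longrightarrow> measure gaussian_measure A \<le> measure gaussian_measure B"
  by (rule finite_measure.finite_measure_mono[OF prob_space.axioms(1)[OF prob_space_gaussian]]) auto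

lemma borel_uminus_image:
  fixes A :: "'a::euclidean_space set"
  assumes "A \<in> sets borel" shows "uminus ` A \<in> sets borel"
proof -
  have "uminus ` A = uminus -` A" by (force simp: image_iff)
  then show ?thesis using measurable_sets[of uminus borel borel A] assms by simp
qed

lemma emeasure_gaussian_uminus:
  assumes [measurable]: "A \<in> sets borel"
  shows "emeasure gaussian_measure (uminus ` A) = emeasure gaussian_measure A"
proof -
  have eq: "uminus ` A = {z. 0 - z \<in> A}" by (force simp: image_iff)
  have [measurable]: "{z. 0 - z \<in> A} \<in> sets borel" by measurable
  have "emeasure gaussian_measure (uminus ` A) = (\<integral>\<^sup>+z. ennreal (gauss_density (0 - z)) * indicator A (0 - z) \<partial>lborel)"
    unfolding eq by (subst emeasure_gaussian) (auto intro!: nn_integral_cong split: split_indicator)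
  also have "\<dots> = emeasure gaussian_measure A"
    by (subst nn_integral_lborel_reflect) (auto simp: emeasure_gaussian)
  finally show ?thesis .
qed

lemma emeasure_gaussian_scaleR:
  fixes K :: "(real ^ 'n) set"
  assumes K [measurable]: "K \<in> sets borel" and s: "0 < s"
  shows "emeasure gaussian_measure ((*\<^sub>R) s ` K) =
    ennreal (s ^ CARD('n)) * (\<integral>\<^sup>+x. ennreal (gauss_density (s *\<^sub>R x)) * indicator K x \<partial>lborel)"
proof -
  have eq: "(*\<^sub>R) s ` K = {z. z /\<^sub>R s \<in> K}"
  proof (intro set_eqI iffI)
    fix z assume "z \<in> {z. z /\<^sub>R s \<in> K}"
    then show "z \<in> (*\<^sub>R) s ` K" using s by (intro image_eqI[of _ _ "z /\<^sub>R s"]) auto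
  qed (use s in auto)
  have [measurable]: "{z. z /\<^sub>R s \<in> K} \<in> sets borel" by measurable
  have "emeasure gaussian_measure ((*\<^sub>R) s ` K) = (\<integral>\<^sup>+z. ennreal (gauss_density z) * indicator {z. z /\<^sub>R s \<in> K} z \<partial>lborel)"
    unfolding eq by (subst emeasure_gaussian) auto
  also have "\<dots> = (\<integral>\<^sup>+z. ennreal (gauss_density z) * indicator {z. z /\<^sub>R s \<in> K} z
      \<partial>density (distr lborel borel (\<lambda>x. 0 + s *\<^sub>R x)) (\<lambda>_. ennreal (\<bar>s\<bar> ^ DIM(real ^ 'n))))"
    using lborel_affine[of s "0 :: real ^ 'n"] s by simp
  also have "\<dots> = (\<integral>\<^sup>+x. ennreal (s ^ CARD('n)) * (ennreal (gauss_density (s *\<^sub>R x)) * indicator K x) \<partial>lborel)"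
    using s by (subst nn_integral_density) (auto simp: nn_integral_distr intro!: nn_integral_cong split: split_indicator)
  also have "\<dots> = ennreal (s ^ CARD('n)) * (\<integral>\<^sup>+x. ennreal (gauss_density (s *\<^sub>R x)) * indicator K x \<partial>lborel)"
    by (rule nn_integral_cmult) measurable
  finally show ?thesis .
qed

text \<open>The density decreases along rays, so a dilation gains at most the Lebesgue factor. With
  its counterpart for contractions this controls the volume of perturbed bodies, which are compared
  with dilates of \<open>K\<close>.\<close>

lemma measure_gaussian_scaleR_le:
  fixes K :: "(real ^ 'n) set"
  assumes K [measurable]: "K \<in> sets borel" and s: "1 \<le> s"
  shows "measure gaussian_measure ((*\<^sub>R) s ` K) \<le> s ^ CARD('n) * measure gaussian_measure K"
proof -
  have "norm x \<le> norm (s *\<^sub>R x)" for x :: "real ^ 'n"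
    using s mult_right_mono[of 1 s "norm x"] by simp
  then have "(\<integral>\<^sup>+x. ennreal (gauss_density (s *\<^sub>R x)) * indicator K x \<partial>lborel) \<le> emeasure gaussian_measure K"
    unfolding emeasure_gaussian[OF K] by (intro nn_integral_mono mult_right_mono ennreal_leI gauss_density_antimono) auto
  then have "emeasure gaussian_measure ((*\<^sub>R) s ` K) \<le> ennreal (s ^ CARD('n)) * emeasure gaussian_measure K"
    using s by (subst emeasure_gaussian_scaleR) (auto intro!: mult_left_mono)
  then show ?thesis
    using s by (simp add: emeasure_gaussian_eq_measure ennreal_mult[symmetric])
qed

lemma measure_gaussian_scaleR_ge:
  fixes K :: "(real ^ 'n) set"
  assumes K [measurable]: "K \<in> sets borel" and s: "0 < s" "s \<le> 1"
  shows "s ^ CARD('n) * measure gaussian_measure K \<le> measure gaussian_measure ((*\<^sub>R) s ` K)"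
proof -
  have "norm (s *\<^sub>R x) \<le> norm x" for x :: "real ^ 'n"
    using s mult_right_mono[of s 1 "norm x"] by simp
  then have "emeasure gaussian_measure K \<le> (\<integral>\<^sup>+x. ennreal (gauss_density (s *\<^sub>R x)) * indicator K x \<partial>lborel)"
    unfolding emeasure_gaussian[OF K] by (intro nn_integral_mono mult_right_mono ennreal_leI gauss_density_antimono) auto
  then have "ennreal (s ^ CARD('n)) * emeasure gaussian_measure K \<le> emeasure gaussian_measure ((*\<^sub>R) s ` K)"
    using s by (subst emeasure_gaussian_scaleR) (auto intro!: mult_left_mono)
  then show ?thesis
    using s by (simp add: emeasure_gaussian_eq_measure ennreal_mult[symmetric])
qed

text \<open>Mean value theorem for the concave function s^\<alpha>/\<alpha>: its increment lies
  between those predicted by the slopes at the two ends.\<close>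

lemma powr_tangent:
  fixes a b \<alpha> :: real
  assumes "0 < a" "a \<le> b" "0 < \<alpha>" "\<alpha> < 1"
  shows "b powr (\<alpha> - 1) * (b - a) \<le> (b powr \<alpha> - a powr \<alpha>) / \<alpha>"
    and "(b powr \<alpha> - a powr \<alpha>) / \<alpha> \<le> a powr (\<alpha> - 1) * (b - a)"
proof -
  have "b powr (\<alpha> - 1) * (b - a) \<le> (b powr \<alpha> - a powr \<alpha>) / \<alpha> \<and>
    (b powr \<alpha> - a powr \<alpha>) / \<alpha> \<le> a powr (\<alpha> - 1) * (b - a)"
  proof (cases "a = b")
    case False
    then have "a < b" using assms by simp
    have "\<exists>z>a. z < b \<and> b powr \<alpha> - a powr \<alpha> = (b - a) * (\<alpha> * z powr (\<alpha> - 1))"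
      by (rule MVT2[OF \<open>a < b\<close>]) (use assms in \<open>auto intro!: derivative_eq_intros\<close>)
    then obtain z where z: "a < z" "z < b" "b powr \<alpha> - a powr \<alpha> = (b - a) * (\<alpha> * z powr (\<alpha> - 1))" by blast
    have "(b powr \<alpha> - a powr \<alpha>) / \<alpha> = z powr (\<alpha> - 1) * (b - a)" using z(3) assms by simp
    moreover have "b powr (\<alpha> - 1) \<le> z powr (\<alpha> - 1)" "z powr (\<alpha> - 1) \<le> a powr (\<alpha> - 1)"
      using z assms by (auto intro!: powr_mono2')
    ultimately show ?thesis using \<open>a < b\<close> by (simp add: mult_right_mono)
  qed simp
  then show "b powr (\<alpha> - 1) * (b - a) \<le> (b powr \<alpha> - a powr \<alpha>) / \<alpha>"
    "(b powr \<alpha> - a powr \<alpha>) / \<alpha> \<le> a powr (\<alpha> - 1) * (b - a)" by auto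
qed

section \<open>Support functions\<close>

definition support_fun :: "'a::euclidean_space set \<Rightarrow> 'a \<Rightarrow> real" where
  "support_fun L u = (SUP x\<in>L. x \<bullet> u)"

lemma support_fun_upper:
  assumes "bounded L" "x \<in> L" shows "x \<bullet> u \<le> support_fun L u"
  unfolding support_fun_def
proof (rule cSUP_upper[OF assms(2)])
  obtain B where B: "\<forall>x\<in>L. norm x \<le> B" using assms(1) by (auto simp: bounded_iff)
  show "bdd_above ((\<lambda>x. x \<bullet> u) ` L)"
  proof (rule bdd_aboveI2)
    fix x assume "x \<in> L"
    then show "x \<bullet> u \<le> B * norm u"
      using B Cauchy_Schwarz_ineq2[of x u] mult_right_mono[of "norm x" B "norm u"] by fastforce
  qed
qed

lemma support_fun_least:
  assumes "L \<noteq> {}" "\<And>x. x \<in> L \<Longrightarrow> x \<bullet> u \<le> c" shows "support_fun L u \<le> c"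
  unfolding support_fun_def using assms by (intro cSUP_least) auto

lemma support_fun_mono:
  "L \<noteq> {} \<Longrightarrow> L \<subseteq> M \<Longrightarrow> bounded M \<Longrightarrow> support_fun L u \<le> support_fun M u"
  by (rule support_fun_least) (auto intro: support_fun_upper)

text \<open>The constant depends only on the radius of an enclosing ball; this is the equicontinuity
  needed for compactness of a maximizing sequence.\<close>

lemma support_fun_Lipschitz:
  assumes L: "L \<noteq> {}" "L \<subseteq> cball 0 \<rho>"
  shows "\<bar>support_fun L u - support_fun L w\<bar> \<le> \<rho> * norm (u - w)"
proof -
  have b: "bounded L" using L bounded_subset by blast
  have "support_fun L u \<le> support_fun L w + \<rho> * norm (u - w)" for u w
  proof (rule support_fun_least[OF L(1)])
    fix x assume x: "x \<in> L"
    have "x \<bullet> u = x \<bullet> w + x \<bullet> (u - w)" by (simp add: inner_diff_right)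
    also have "x \<bullet> (u - w) \<le> norm x * norm (u - w)" using Cauchy_Schwarz_ineq2[of x "u - w"] by linarith
    also have "norm x * norm (u - w) \<le> \<rho> * norm (u - w)" using x L by (intro mult_right_mono) auto
    also have "x \<bullet> w \<le> support_fun L w" using b x by (rule support_fun_upper)
    finally show "x \<bullet> u \<le> support_fun L w + \<rho> * norm (u - w)" by simp
  qed
  from this[of u w] this[of w u] show ?thesis by (simp add: norm_minus_commute abs_le_iff)
qed

lemma support_fun_continuous:
  assumes L: "L \<noteq> {}" "bounded L"
  shows "continuous_on S (support_fun L)"
proof -
  obtain \<rho> where "0 < \<rho>" "\<forall>x\<in>L. norm x \<le> \<rho>" using L(2) unfolding bounded_pos by blast
  then have \<rho>: "L \<subseteq> cball 0 \<rho>" by auto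
  have "\<rho>-lipschitz_on S (support_fun L)"
    using support_fun_Lipschitz[OF L(1) \<rho>] \<open>0 < \<rho>\<close> by (intro lipschitz_onI) (auto simp: dist_norm)
  then show ?thesis by (rule lipschitz_on_continuous_on)
qed

lemma support_fun_bound:
  assumes L: "0 \<in> L" "L \<subseteq> cball 0 \<rho>"
  shows "0 \<le> support_fun L u" "support_fun L u \<le> \<rho> * norm u"
proof -
  have b: "bounded L" using L bounded_subset by blast
  show "0 \<le> support_fun L u" using support_fun_upper[OF b L(1), of u] by simp
  show "support_fun L u \<le> \<rho> * norm u"
  proof (rule support_fun_least)
    fix x assume "x \<in> L"
    then show "x \<bullet> u \<le> \<rho> * norm u"
      using L Cauchy_Schwarz_ineq2[of x u] mult_right_mono[of "norm x" \<rho> "norm u"] by force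
  qed (use L in auto)
qed

lemma support_fun_sym:
  assumes "\<And>x. x \<in> L \<Longrightarrow> - x \<in> L"
  shows "support_fun L (- u) = support_fun L u"
proof -
  have "(\<lambda>x. x \<bullet> (- u)) ` L = (\<lambda>x. x \<bullet> u) ` L"
  proof -
    have "(\<lambda>x. x \<bullet> (- u)) ` L = (\<lambda>x. x \<bullet> u) ` (uminus ` L)" by (auto simp: image_image)
    also have "uminus ` L = L" using assms by (force intro: image_eqI[of _ uminus "- x" for x])
    finally show ?thesis .
  qed
  then show ?thesis by (simp add: support_fun_def)
qed

locale sphere_measure =
  fixes \<mu> :: "(real ^ 'n) measure"
  assumes sets_\<mu>: "sets \<mu> = sets sphere_borel" and finite_\<mu>: "finite_measure \<mu>"
begin

lemma space_\<mu>: "space \<mu> = sphere 0 1"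
  using sets_eq_imp_space_eq[OF sets_\<mu>] by (simp add: sphere_borel_def space_restrict_space)

lemma sets_\<mu>_iff: "A \<in> sets \<mu> \<longleftrightarrow> A \<in> sets borel \<and> A \<subseteq> sphere 0 1"
  unfolding sets_\<mu> sphere_borel_def by (subst sets_restrict_space_iff) auto

lemma infdist_nbhd_sets: "{u \<in> sphere 0 1. infdist u \<eta> < \<delta>} \<in> sets \<mu>"
proof -
  have "{u \<in> sphere 0 1. infdist u \<eta> < \<delta>} = sphere 0 1 \<inter> {u. infdist u \<eta> < \<delta>}" by auto
  moreover have "open {u. infdist u \<eta> < \<delta>}" by (intro open_Collect_less continuous_intros)
  ultimately show ?thesis unfolding sets_\<mu>_iff by (auto intro: borel_open)
qed

lemma measurable_\<mu>: "f \<in> borel_measurable borel \<Longrightarrow> f \<in> borel_measurable \<mu>"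
  unfolding measurable_cong_sets[OF sets_\<mu> refl] sphere_borel_def by (rule measurable_restrict_space1)

lemma integrable_support_fun:
  assumes L: "0 \<in> L" "bounded L"
  shows "integrable \<mu> (support_fun L)"
proof -
  obtain \<rho> where "\<forall>x\<in>L. norm x \<le> \<rho>" using L(2) unfolding bounded_pos by blast
  then have \<rho>: "L \<subseteq> cball 0 \<rho>" by auto
  show ?thesis
  proof (rule finite_measure.integrable_const_bound[OF finite_\<mu>])
    show "AE u in \<mu>. norm (support_fun L u) \<le> \<rho>"
    proof (rule AE_I2)
      fix u assume "u \<in> space \<mu>"
      then show "norm (support_fun L u) \<le> \<rho>"
        using support_fun_bound[OF L(1) \<rho>, of u] by (simp add: space_\<mu>)
    qed
    show "support_fun L \<in> borel_measurable \<mu>"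
      using L by (intro measurable_\<mu> borel_measurable_continuous_onI support_fun_continuous) auto
  qed
qed

end

section \<open>Existence of a maximizer\<close>

definition sym_convex :: "(real ^ 'n) set \<Rightarrow> bool" where
  "sym_convex L \<longleftrightarrow> compact L \<and> convex L \<and> 0 \<in> L \<and> (\<forall>x\<in>L. - x \<in> L)"

text \<open>The free factor in front of the integral is absorbed into the measure.\<close>

definition gauss_functional :: "(real ^ 'n) measure \<Rightarrow> real \<Rightarrow> (real ^ 'n) set \<Rightarrow> real" where
  "gauss_functional \<mu> \<alpha> L = measure gaussian_measure L powr \<alpha> / \<alpha> - (LINT u|\<mu>. support_fun L u)"

lemma measure_gaussian_pos:
  fixes L :: "(real ^ 'n) set"
  assumes L: "L \<in> sets borel" "interior L \<noteq> {}"
  shows "0 < measure gaussian_measure L"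
proof -
  obtain x e where e: "0 < e" "ball x e \<subseteq> L" using L(2) by (metis all_not_in_conv mem_interior)
  have "\<not> (AE z in lborel. ennreal (gauss_density z) * indicator (ball x e) z = 0)"
  proof
    assume "AE z in lborel. ennreal (gauss_density z) * indicator (ball x e) z = 0"
    then have "AE z in lborel. z \<notin> ball x e"
    proof eventually_elim
      case (elim z)
      then show ?case using gauss_density_pos[of z] by (auto simp: indicator_def split: if_splits)
    qed
    then have "emeasure lborel (ball x e) = 0" by (subst (asm) AE_iff_measurable[of "ball x e"]) auto
    then show False using e(1) unit_ball_vol_pos[of "real CARD('n)"] by (simp add: emeasure_ball)
  qed
  moreover have [measurable]: "ball x e \<in> sets borel" by simp
  have "(\<lambda>z. ennreal (gauss_density z) * indicator (ball x e) z) \<in> borel_measurable lborel"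
    by measurable
  ultimately have "(\<integral>\<^sup>+z. ennreal (gauss_density z) * indicator (ball x e) z \<partial>lborel) \<noteq> 0"
    using nn_integral_0_iff_AE by blast
  moreover have "emeasure gaussian_measure (ball x e) = (\<integral>\<^sup>+z. ennreal (gauss_density z) * indicator (ball x e) z \<partial>lborel)"
    by (rule emeasure_gaussian) simp
  ultimately have "emeasure gaussian_measure (ball x e) \<noteq> 0" by simp
  then have "0 < measure gaussian_measure (ball x e)"
    by (simp add: emeasure_gaussian_eq_measure zero_less_measure_iff)
  also have "\<dots> \<le> measure gaussian_measure L" using e(2) L(1) by (rule measure_gaussian_mono)
  finally show ?thesis .
qed

lemma measure_gaussian_negligible:
  fixes L :: "(real ^ 'n) set"
  assumes "negligible L" "L \<in> sets borel"
  shows "measure gaussian_measure L = 0"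
proof -
  have "L \<in> null_sets lborel" using assms
    by (metis negligible_iff_null_sets null_sets_completion_iff sets_lborel)
  then have "AE z in lborel. z \<notin> L" by (rule AE_not_in)
  then have "emeasure gaussian_measure L = 0"
    unfolding emeasure_gaussian[OF assms(2)] by (subst nn_integral_0_iff_AE) (use assms(2) in auto)
  then show ?thesis by (simp add: measure_def)
qed

context sphere_measure
begin

lemma integrable_abs_inner: "integrable \<mu> (\<lambda>u. \<bar>u \<bullet> x\<bar>)"
proof (rule finite_measure.integrable_const_bound[OF finite_\<mu>])
  show "AE u in \<mu>. norm \<bar>u \<bullet> x\<bar> \<le> norm x"
  proof (rule AE_I2)
    fix u assume "u \<in> space \<mu>"
    then show "norm \<bar>u \<bullet> x\<bar> \<le> norm x" using Cauchy_Schwarz_ineq2[of u x] by (simp add: space_\<mu>)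
  qed
  show "(\<lambda>u. \<bar>u \<bullet> x\<bar>) \<in> borel_measurable \<mu>" by (rule measurable_\<mu>) measurable
qed

text \<open>The integral is Lipschitz in x, so it attains its minimum on the unit sphere. A minimum
  0 at v would put all mass on the hyperplane orthogonal to v, inside a closed hemisphere.
  Homogeneity extends the bound to all x.\<close>

lemma integral_abs_inner_lower:
  assumes nc: "not_concentrated_in_hemisphere \<mu>"
  obtains c where "0 < c" "\<And>x. norm x * c \<le> (LINT u|\<mu>. \<bar>u \<bullet> x\<bar>)"
proof -
  interpret finite_measure \<mu> by (rule finite_\<mu>)
  define I where "I x = (LINT u|\<mu>. \<bar>u \<bullet> x\<bar>)" for x
  note int = integrable_abs_inner
  have Lip: "I x \<le> I y + measure \<mu> (space \<mu>) * norm (x - y)" for x y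
  proof -
    have "I x \<le> (LINT u|\<mu>. \<bar>u \<bullet> y\<bar> + norm (x - y))"
      unfolding I_def
    proof (rule integral_mono)
      fix u assume "u \<in> space \<mu>"
      then have "\<bar>u \<bullet> (x - y)\<bar> \<le> norm (x - y)" using Cauchy_Schwarz_ineq2[of u "x - y"] by (simp add: space_\<mu>)
      then show "\<bar>u \<bullet> x\<bar> \<le> \<bar>u \<bullet> y\<bar> + norm (x - y)" by (simp add: inner_diff_right)
    qed (use int in auto)
    also have "\<dots> = I y + measure \<mu> (space \<mu>) * norm (x - y)" unfolding I_def using int by simp
    finally show ?thesis .
  qed
  have "continuous_on (sphere 0 1) I"
  proof (rule lipschitz_on_continuous_on)
    show "(measure \<mu> (space \<mu>))-lipschitz_on (sphere 0 1) I"
    proof (rule lipschitz_onI)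
      fix x y :: "real ^ 'n"
      show "dist (I x) (I y) \<le> measure \<mu> (space \<mu>) * dist x y"
        using Lip[of x y] Lip[of y x] by (simp add: dist_norm norm_minus_commute abs_le_iff)
    qed simp
  qed
  moreover have "sphere (0 :: real ^ 'n) 1 \<noteq> {}"
    by (metis SOME_Basis empty_iff mem_sphere_0 norm_Basis)
  ultimately obtain v where v: "v \<in> sphere 0 1" "\<And>x. x \<in> sphere 0 1 \<Longrightarrow> I v \<le> I x"
    using continuous_attains_inf[of "sphere 0 1" I] by (metis compact_sphere)
  have "I v \<noteq> 0"
  proof
    assume "I v = 0"
    then have "AE u in \<mu>. \<bar>u \<bullet> v\<bar> = 0"
      using integral_nonneg_eq_0_iff_AE[OF int] by (simp add: I_def)
    then have "AE u in \<mu>. u \<notin> sphere 0 1 - closed_hemisphere v"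
      by eventually_elim (auto simp: closed_hemisphere_def)
    moreover have "sphere 0 1 - closed_hemisphere v \<in> sets \<mu>"
    proof -
      have "sphere 0 1 - closed_hemisphere v = sphere 0 1 \<inter> {u. u \<bullet> v < 0}" by (auto simp: closed_hemisphere_def)
      also have "\<dots> \<in> sets \<mu>" unfolding sets_\<mu>_iff by (auto intro!: sets.Int)
      finally show ?thesis .
    qed
    ultimately have "emeasure \<mu> (sphere 0 1 - closed_hemisphere v) = 0"
      by (subst (asm) AE_iff_measurable[of "sphere 0 1 - closed_hemisphere v"])
        (auto simp: space_\<mu>)
    then show False using nc v(1) unfolding not_concentrated_in_hemisphere_def by (metis less_irrefl)
  qed
  moreover have "0 \<le> I v" unfolding I_def by simp
  ultimately have "0 < I v" by simp
  show ?thesis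
  proof (rule that[OF \<open>0 < I v\<close>])
    fix x :: "real ^ 'n"
    show "norm x * I v \<le> (LINT u|\<mu>. \<bar>u \<bullet> x\<bar>)"
    proof (cases "x = 0")
      case False
      have "I v \<le> I (x /\<^sub>R norm x)" using False by (intro v) simp
      also have "\<dots> = I x / norm x"
        unfolding I_def by (simp add: abs_mult divide_inverse mult.commute)
      finally show ?thesis using False by (simp add: I_def field_simps)
    qed simp
  qed
qed

text \<open>On the ball of radius r the volume term is at least a multiple of r^(n \<alpha>), while
  the integral is at most r times the total mass; as n \<alpha> < 1, the first wins for small
  r.\<close>

lemma gauss_functional_ball_pos:
  assumes \<alpha>: "0 < \<alpha>" "\<alpha> < 1 / real CARD('n)"
  obtains L where "sym_convex L" "0 < gauss_functional \<mu> \<alpha> L"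
proof -
  interpret finite_measure \<mu> by (rule finite_\<mu>)
  define g where "g = measure gaussian_measure (cball (0 :: real ^ 'n) 1)"
  define m where "m = measure \<mu> (space \<mu>) + 1"
  define p where "p = 1 - real CARD('n) * \<alpha>"
  have p: "0 < p" using \<alpha> by (simp add: p_def field_simps)
  have g: "0 < g" unfolding g_def by (rule measure_gaussian_pos) auto
  have m: "1 \<le> m" by (simp add: m_def)
  \<comment> \<open>The condition r^p \<le> B is exactly r m \<le> r^(1-p) g^\<alpha>/\<alpha>; m
    exceeds the total mass by 1, which makes the final inequality strict.\<close>
  define B where "B = g powr \<alpha> / \<alpha> / m"
  have B: "0 < B" using g \<alpha> m by (simp add: B_def)
  define r where "r = min 1 (B powr (1 / p))"
  have r: "0 < r" "r \<le> 1" using B by (auto simp: r_def)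
  have "r powr p \<le> (B powr (1 / p)) powr p" using r p by (intro powr_mono2) (auto simp: r_def)
  also have "\<dots> = B" using p B by (simp add: powr_powr)
  finally have rB: "r powr p \<le> B" .
  let ?L = "cball (0 :: real ^ 'n) r"
  have L: "sym_convex ?L" using r by (simp add: sym_convex_def)
  have eq: "?L = (*\<^sub>R) r ` cball 0 1"
    using r cball_scale[of r "0 :: real ^ 'n" 1] by simp
  have "r ^ CARD('n) * g \<le> measure gaussian_measure ?L"
    unfolding eq g_def using r by (intro measure_gaussian_scaleR_ge) auto
  then have "(r ^ CARD('n) * g) powr \<alpha> \<le> measure gaussian_measure ?L powr \<alpha>"
    using r g \<alpha> by (intro powr_mono2) auto
  moreover have "(r ^ CARD('n) * g) powr \<alpha> = r powr (1 - p) * g powr \<alpha>"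
    using r g by (simp add: powr_mult powr_realpow[symmetric] powr_powr p_def)
  ultimately have 1: "r powr (1 - p) * g powr \<alpha> / \<alpha> \<le> measure gaussian_measure ?L powr \<alpha> / \<alpha>"
    using \<alpha> by (simp add: divide_right_mono)
  have "(LINT u|\<mu>. support_fun ?L u) \<le> (LINT u|\<mu>. r)"
  proof (rule integral_mono)
    show "integrable \<mu> (support_fun ?L)" using r by (intro integrable_support_fun) auto
    fix u assume "u \<in> space \<mu>"
    then show "support_fun ?L u \<le> r"
      using support_fun_bound(2)[of ?L r u] r by (simp add: space_\<mu>)
  qed simp
  then have 2: "(LINT u|\<mu>. support_fun ?L u) \<le> r * (m - 1)" by (simp add: m_def mult.commute)
  have "r * (m - 1) < r * m" using r by simp
  also have "r * m = r powr (1 - p) * r powr p * m" using r by (simp add: powr_add[symmetric])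
  also have "\<dots> \<le> r powr (1 - p) * B * m" using rB m by (intro mult_right_mono mult_left_mono) auto
  also have "\<dots> = r powr (1 - p) * g powr \<alpha> / \<alpha>" using m by (simp add: B_def)
  finally have "0 < gauss_functional \<mu> \<alpha> ?L"
    using 1 2 unfolding gauss_functional_def by linarith
  with L show ?thesis by (rule that)
qed

text \<open>Support functions of a maximizing sequence converge uniformly on the sphere along a
  subsequence, by Arzela-Ascoli. The maximizer is the Wulff shape of the limit h. It need not be
  known that h is its support function: an inequality and upper semicontinuity of the volume
  suffice.\<close>

lemma gauss_functional_maximizer:
  assumes nc: "not_concentrated_in_hemisphere \<mu>" and \<alpha>: "0 < \<alpha>" "\<alpha> < 1 / real CARD('n)"
  obtains K where "sym_convex K" "interior K \<noteq> {}"
    "\<And>L. sym_convex L \<Longrightarrow> gauss_functional \<mu> \<alpha> L \<le> gauss_functional \<mu> \<alpha> K"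
proof -
  interpret finite_measure \<mu> by (rule finite_\<mu>)
  let ?F = "gauss_functional \<mu> \<alpha>" and ?m = "measure \<mu> (space \<mu>)"
  obtain c where c: "0 < c" "\<And>x. norm x * c \<le> (LINT u|\<mu>. \<bar>u \<bullet> x\<bar>)"
    using integral_abs_inner_lower[OF nc] by blast
  \<comment> \<open>If the functional is nonnegative at L and x is in L, then |x| c is at most the
    integral of the support function, hence at most 1/\<alpha>.\<close>
  define \<rho> where "\<rho> = 1 / (\<alpha> * c)"
  have int: "integrable \<mu> (support_fun L)" if "sym_convex L" for L
    using that by (intro integrable_support_fun) (auto simp: sym_convex_def compact_imp_bounded)
  have powr_le_1: "measure gaussian_measure L powr \<alpha> \<le> 1" for L :: "(real ^ 'n) set"
    using \<alpha> measure_gaussian_le_1[of L] powr_mono2[of \<alpha> "measure gaussian_measure L" 1] by simp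
  have norm_le: "norm x \<le> \<rho>" if L: "sym_convex L" "0 \<le> ?F L" and x: "x \<in> L" for L x
  proof -
    have "norm x * c \<le> (LINT u|\<mu>. \<bar>u \<bullet> x\<bar>)" by (rule c)
    also have "\<dots> \<le> (LINT u|\<mu>. support_fun L u)"
    proof (rule integral_mono)
      show "integrable \<mu> (\<lambda>u. \<bar>u \<bullet> x\<bar>)" by (rule integrable_abs_inner)
      fix u
      have b: "bounded L" "- x \<in> L" using L x by (auto simp: sym_convex_def compact_imp_bounded)
      show "\<bar>u \<bullet> x\<bar> \<le> support_fun L u"
        using support_fun_upper[OF b(1) x, of u] support_fun_upper[OF b, of u]
        by (simp add: abs_le_iff inner_commute)
    qed (rule int[OF L(1)])
    also have "\<dots> \<le> measure gaussian_measure L powr \<alpha> / \<alpha>" using L(2) by (simp add: gauss_functional_def)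
    also have "\<dots> \<le> 1 / \<alpha>" using \<alpha> powr_le_1 by (intro divide_right_mono) auto
    finally show ?thesis using c(1) \<alpha> by (simp add: \<rho>_def field_simps)
  qed
  have F_le: "?F L \<le> 1 / \<alpha>" if "sym_convex L" for L
  proof -
    have "0 \<le> (LINT u|\<mu>. support_fun L u)"
    proof (rule integral_nonneg_AE, rule AE_I2)
      fix u
      have "0 \<bullet> u \<le> support_fun L u"
        using that by (intro support_fun_upper) (auto simp: sym_convex_def compact_imp_bounded)
      then show "0 \<le> support_fun L u" by simp
    qed
    moreover have "measure gaussian_measure L powr \<alpha> / \<alpha> \<le> 1 / \<alpha>"
      using \<alpha> powr_le_1 by (intro divide_right_mono) auto
    ultimately show ?thesis by (simp add: gauss_functional_def)
  qed
  define S where "S = (SUP L\<in>Collect sym_convex. ?F L)"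
  have bdd: "bdd_above (?F ` Collect sym_convex)" using F_le by (auto intro!: bdd_aboveI2)
  have F_le_S: "?F L \<le> S" if "sym_convex L" for L
    unfolding S_def using that bdd by (intro cSUP_upper) auto
  obtain L0 where L0: "sym_convex L0" "0 < ?F L0" using gauss_functional_ball_pos[OF \<alpha>] by blast
  have S: "0 < S" using F_le_S[OF L0(1)] L0(2) by simp
  \<comment> \<open>The maximum with 0 keeps the functional positive along the sequence, so that the
    radius bound applies to every member.\<close>
  have "\<exists>L. sym_convex L \<and> max 0 (S - 1 / Suc j) < ?F L" for j
  proof -
    have "max 0 (S - 1 / Suc j) < S" using S by simp
    then show ?thesis
      unfolding S_def using less_cSUP_iff[of "Collect sym_convex" ?F "max 0 (S - 1 / Suc j)"] bdd L0
      by (auto simp: S_def)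
  qed
  then obtain L where L: "\<And>j. sym_convex (L j)" "\<And>j. max 0 (S - 1 / Suc j) < ?F (L j)" by metis
  have L\<rho>: "L j \<subseteq> cball 0 \<rho>" for j using norm_le[OF L(1), of j] L(2)[of j] by auto
  have L0in: "0 \<in> L j" and Lne: "L j \<noteq> {}" and Lb: "bounded (L j)" for j
    using L(1)[of j] by (auto simp: sym_convex_def compact_imp_bounded)
  have \<rho>: "0 < \<rho>" using c(1) \<alpha> by (simp add: \<rho>_def)
  obtain h and k :: "nat \<Rightarrow> nat" where h: "continuous_on (sphere 0 1) h" and k: "strict_mono k"
    and unif: "\<And>e. 0 < e \<Longrightarrow> \<exists>N. \<forall>n u. n \<ge> N \<and> u \<in> sphere 0 1 \<longrightarrow> norm (support_fun (L (k n)) u - h u) < e"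
  proof (rule Arzela_Ascoli[of "sphere (0 :: real ^ 'n) 1" "\<lambda>j. support_fun (L j)" \<rho>])
    show "norm (support_fun (L n) x) \<le> \<rho>" if "x \<in> sphere 0 1" for n x
      using support_fun_bound[OF L0in L\<rho>, of n x] that by simp
    show "\<exists>d>0. \<forall>n y. y \<in> sphere 0 1 \<and> norm (x - y) < d \<longrightarrow> norm (support_fun (L n) x - support_fun (L n) y) < e"
      if "0 < e" for x e
    proof (intro exI[of _ "e / \<rho>"] conjI allI impI)
      show "0 < e / \<rho>" using that \<rho> by simp
      fix n y assume "y \<in> sphere 0 1 \<and> norm (x - y) < e / \<rho>"
      then have "\<rho> * norm (x - y) < e" using \<rho> by (simp add: field_simps)
      then show "norm (support_fun (L n) x - support_fun (L n) y) < e"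
        using support_fun_Lipschitz[OF Lne L\<rho>, of n x y] by simp
    qed
  next
    fix g and k' :: "nat \<Rightarrow> nat"
    assume a: "continuous_on (sphere 0 1) g" "strict_mono k'"
      "\<And>e. 0 < e \<Longrightarrow> \<exists>N. \<forall>n x. n \<ge> N \<and> x \<in> sphere 0 1 \<longrightarrow> norm (support_fun (L (k' n)) x - g x) < e"
    show thesis by (rule that[OF a(1,2)], rule a(3))
  qed simp
  \<comment> \<open>\<open>Ke e\<close> is the Wulff shape of h + e. It contains all late members of
    the sequence and shrinks to \<open>K\<close>, so it bounds their volumes from above.\<close>
  define K where "K = {x. \<forall>u\<in>sphere 0 1. x \<bullet> u \<le> h u}"
  define Ke where "Ke e = {x. \<forall>u\<in>sphere 0 1. x \<bullet> u \<le> h u + e}" for e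
  have lim: "(\<lambda>n. support_fun (L (k n)) u) \<longlonglongrightarrow> h u" if "u \<in> sphere 0 1" for u
  proof (rule LIMSEQ_I)
    fix e :: real assume "0 < e"
    from unif[OF this] show "\<exists>N. \<forall>n\<ge>N. norm (support_fun (L (k n)) u - h u) < e" using that by blast
  qed
  have h_nonneg: "0 \<le> h u" and h_le: "h u \<le> \<rho>" and h_sym: "h (- u) = h u" if u: "u \<in> sphere 0 1" for u
  proof -
    show "0 \<le> h u" by (rule tendsto_lowerbound[OF lim[OF u]]) (auto simp: support_fun_bound[OF L0in L\<rho>])
    have "support_fun (L j) u \<le> \<rho>" for j using support_fun_bound(2)[OF L0in L\<rho>, of j u] u by simp
    then show "h u \<le> \<rho>" by (intro tendsto_upperbound[OF lim[OF u]]) auto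
    have "(\<lambda>n. support_fun (L (k n)) u) \<longlonglongrightarrow> h (- u)"
      using lim[of "- u"] u L(1) by (simp add: support_fun_sym sym_convex_def)
    then show "h (- u) = h u" using lim[OF u] LIMSEQ_unique by blast
  qed
  have closed_Ke: "closed (Ke e)" for e
  proof -
    have "Ke e = (\<Inter>u\<in>sphere 0 1. {x. x \<bullet> u \<le> h u + e})" by (auto simp: Ke_def)
    then show ?thesis by (auto intro!: closed_INT closed_Collect_le continuous_intros)
  qed
  have K0: "K = Ke 0" by (simp add: K_def Ke_def)
  have K_sub: "K \<subseteq> cball 0 \<rho>"
  proof
    fix x assume x: "x \<in> K"
    show "x \<in> cball 0 \<rho>"
    proof (cases "x = 0")
      case False
      then have u: "x /\<^sub>R norm x \<in> sphere 0 1" by simp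
      then have "x \<bullet> (x /\<^sub>R norm x) \<le> h (x /\<^sub>R norm x)" using x unfolding K_def by blast
      also have "\<dots> \<le> \<rho>" by (rule h_le[OF u])
      finally show ?thesis using False by (simp add: power2_norm_eq_inner[symmetric] power2_eq_square field_simps)
    qed (use \<rho> in simp)
  qed
  have "convex K"
  proof -
    have "K = (\<Inter>u\<in>sphere 0 1. {x. u \<bullet> x \<le> h u})" by (auto simp: K_def inner_commute)
    then show ?thesis by (auto intro!: convex_INT convex_halfspace_le)
  qed
  moreover have "compact K"
    using closed_Ke[of 0] K_sub bounded_subset[OF bounded_cball] unfolding K0[symmetric]
    by (auto simp: compact_eq_bounded_closed)
  moreover have "- x \<in> K" if x: "x \<in> K" for x
    unfolding K_def
  proof (intro CollectI ballI)
    fix u :: "real ^ 'n" assume u: "u \<in> sphere 0 1"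
    then have "- u \<in> sphere 0 1" by simp
    then have "x \<bullet> (- u) \<le> h (- u)" using x unfolding K_def by blast
    then show "- x \<bullet> u \<le> h u" using h_sym[OF u] by simp
  qed
  ultimately have K: "sym_convex K" using h_nonneg by (auto simp: sym_convex_def K_def)
  have h_meas: "h \<in> borel_measurable \<mu>"
    unfolding measurable_cong_sets[OF sets_\<mu> refl] sphere_borel_def
    using h by (rule borel_measurable_continuous_on_restrict)
  have int_h: "integrable \<mu> h"
  proof (rule integrable_const_bound[of _ \<rho>])
    show "AE u in \<mu>. norm (h u) \<le> \<rho>"
      using h_nonneg h_le by (intro AE_I2) (auto simp: space_\<mu>)
  qed (rule h_meas)
  have "(LINT u|\<mu>. support_fun K u) \<le> (LINT u|\<mu>. h u)"
  proof (rule integral_mono[OF int[OF K] int_h])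
    fix u assume "u \<in> space \<mu>"
    then show "support_fun K u \<le> h u"
    proof (intro support_fun_least)
      show "K \<noteq> {}" using K by (auto simp: sym_convex_def)
    qed (auto simp: K_def space_\<mu>)
  qed
  then have FK: "measure gaussian_measure K powr \<alpha> / \<alpha> - (LINT u|\<mu>. h u) \<le> ?F K"
    by (simp add: gauss_functional_def)
  have S_le: "S \<le> measure gaussian_measure (Ke e) powr \<alpha> / \<alpha> - (LINT u|\<mu>. h u) + e * ?m" if e: "0 < e" for e
  proof -
    obtain N where N: "\<And>n u. n \<ge> N \<Longrightarrow> u \<in> sphere 0 1 \<Longrightarrow> norm (support_fun (L (k n)) u - h u) < e"
      using unif[OF e] by blast
    have "S - 1 / Suc n \<le> measure gaussian_measure (Ke e) powr \<alpha> / \<alpha> - (LINT u|\<mu>. h u) + e * ?m" if n: "n \<ge> N" for n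
    proof -
      have "L (k n) \<subseteq> Ke e"
      proof
        fix x assume x: "x \<in> L (k n)"
        show "x \<in> Ke e"
          unfolding Ke_def
        proof (intro CollectI ballI)
          fix u :: "real ^ 'n" assume u: "u \<in> sphere 0 1"
          have "x \<bullet> u \<le> support_fun (L (k n)) u" using Lb x by (rule support_fun_upper)
          then show "x \<bullet> u \<le> h u + e" using N[OF n u] by (simp add: abs_less_iff)
        qed
      qed
      then have "measure gaussian_measure (L (k n)) \<le> measure gaussian_measure (Ke e)"
        using closed_Ke by (intro measure_gaussian_mono) (auto intro: borel_closed)
      then have "measure gaussian_measure (L (k n)) powr \<alpha> / \<alpha> \<le> measure gaussian_measure (Ke e) powr \<alpha> / \<alpha>"
        using \<alpha> by (intro divide_right_mono powr_mono2) auto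
      moreover have "(LINT u|\<mu>. h u - e) \<le> (LINT u|\<mu>. support_fun (L (k n)) u)"
      proof (rule integral_mono)
        fix u assume "u \<in> space \<mu>"
        then show "h u - e \<le> support_fun (L (k n)) u" using N[OF n, of u] by (simp add: space_\<mu> abs_less_iff)
      qed (use int_h int[OF L(1)] in auto)
      moreover have "(LINT u|\<mu>. h u - e) = (LINT u|\<mu>. h u) - e * ?m" using int_h by (simp add: mult.commute)
      ultimately have "?F (L (k n)) \<le> measure gaussian_measure (Ke e) powr \<alpha> / \<alpha> - (LINT u|\<mu>. h u) + e * ?m"
        unfolding gauss_functional_def by linarith
      moreover have "S - 1 / Suc (k n) < ?F (L (k n))" using L(2)[of "k n"] by simp
      moreover have "1 / real (Suc (k n)) \<le> 1 / real (Suc n)"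
        using seq_suble[OF k, of n] by (intro divide_left_mono) auto
      ultimately show ?thesis by linarith
    qed
    then have ev: "\<forall>\<^sub>F n in sequentially. S - 1 / Suc n \<le> measure gaussian_measure (Ke e) powr \<alpha> / \<alpha> - (LINT u|\<mu>. h u) + e * ?m"
      by (auto simp: eventually_sequentially)
    have "(\<lambda>n. S - 1 / Suc n) \<longlonglongrightarrow> S - 0"
      by (intro tendsto_diff tendsto_const) (use LIMSEQ_Suc[OF lim_1_over_n] in simp)
    from tendsto_upperbound[OF this ev] show ?thesis by simp
  qed
  have "(\<lambda>j. measure gaussian_measure (Ke (1 / Suc j))) \<longlonglongrightarrow> measure gaussian_measure (\<Inter>j. Ke (1 / Suc j))"
  proof (rule finite_measure.finite_Lim_measure_decseq[OF prob_space.axioms(1)[OF prob_space_gaussian]])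
    show "range (\<lambda>j. Ke (1 / Suc j)) \<subseteq> sets gaussian_measure" using closed_Ke by (auto intro: borel_closed)
    show "decseq (\<lambda>j. Ke (1 / Suc j))"
    proof (rule decseq_SucI, rule subsetI)
      fix j x assume x: "x \<in> Ke (1 / Suc (Suc j))"
      have "1 / real (Suc (Suc j)) \<le> 1 / real (Suc j)" by (intro divide_left_mono) auto
      then show "x \<in> Ke (1 / Suc j)" using x unfolding Ke_def by force
    qed
  qed
  also have "(\<Inter>j. Ke (1 / Suc j)) = K"
  proof (intro set_eqI iffI)
    fix x assume x: "x \<in> (\<Inter>j. Ke (1 / Suc j))"
    show "x \<in> K"
      unfolding K_def
    proof (intro CollectI ballI)
      fix u :: "real ^ 'n" assume u: "u \<in> sphere 0 1"
      have "(\<lambda>j. h u + 1 / Suc j) \<longlonglongrightarrow> h u + 0"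
        by (intro tendsto_add tendsto_const) (use LIMSEQ_Suc[OF lim_1_over_n] in simp)
      moreover have "\<And>j. x \<bullet> u \<le> h u + 1 / Suc j" using x u by (auto simp: Ke_def)
      ultimately have "x \<bullet> u \<le> h u + 0" by (intro tendsto_lowerbound[of "\<lambda>j. h u + 1 / Suc j"]) auto
      then show "x \<bullet> u \<le> h u" by simp
    qed
  next
    fix x assume "x \<in> K"
    then have "x \<bullet> u \<le> h u + 1 / Suc j" if "u \<in> sphere 0 1" for u j
      using that unfolding K_def by (auto intro: add_increasing2)
    then show "x \<in> (\<Inter>j. Ke (1 / Suc j))" by (auto simp: Ke_def simp del: of_nat_Suc)
  qed
  finally have limg: "(\<lambda>j. measure gaussian_measure (Ke (1 / Suc j))) \<longlonglongrightarrow> measure gaussian_measure K" .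
  have "(\<lambda>j. measure gaussian_measure (Ke (1 / Suc j)) powr \<alpha> / \<alpha> - (LINT u|\<mu>. h u) + 1 / Suc j * ?m)
      \<longlonglongrightarrow> measure gaussian_measure K powr \<alpha> / \<alpha> - (LINT u|\<mu>. h u) + 0 * ?m"
  proof (intro tendsto_add tendsto_diff tendsto_divide tendsto_mult tendsto_const)
    show "(\<lambda>j. measure gaussian_measure (Ke (1 / Suc j)) powr \<alpha>) \<longlonglongrightarrow> measure gaussian_measure K powr \<alpha>"
      using \<alpha> by (intro tendsto_powr'[OF limg tendsto_const]) auto
    show "(\<lambda>j. 1 / real (Suc j)) \<longlonglongrightarrow> 0" using LIMSEQ_Suc[OF lim_1_over_n] by simp
  qed (use \<alpha> in auto)
  moreover have "S \<le> measure gaussian_measure (Ke (1 / Suc j)) powr \<alpha> / \<alpha> - (LINT u|\<mu>. h u) + 1 / Suc j * ?m" for j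
    by (rule S_le) simp
  ultimately have "S \<le> measure gaussian_measure K powr \<alpha> / \<alpha> - (LINT u|\<mu>. h u) + 0 * ?m"
    by (rule tendsto_lowerbound[OF _ always_eventually[OF allI] sequentially_bot])
  then have SK: "S \<le> ?F K" using FK by simp
  \<comment> \<open>A convex set without interior has Gaussian measure 0, so its functional is at
    most 0, below the positive supremum.\<close>
  have "interior K \<noteq> {}"
  proof
    assume "interior K = {}"
    then have "negligible K" using K by (simp add: negligible_convex_interior sym_convex_def)
    then have "measure gaussian_measure K = 0"
      using K by (intro measure_gaussian_negligible) (auto simp: sym_convex_def intro: borel_compact)
    moreover have "0 \<le> (LINT u|\<mu>. support_fun K u)"
    proof (rule integral_nonneg_AE, rule AE_I2)
      fix u
      have "0 \<bullet> u \<le> support_fun K u"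
        using K by (intro support_fun_upper) (auto simp: sym_convex_def compact_imp_bounded)
      then show "0 \<le> support_fun K u" by simp
    qed
    ultimately have "?F K \<le> 0" using \<alpha> by (simp add: gauss_functional_def)
    then show False using SK S by simp
  qed
  moreover have "?F L \<le> ?F K" if "sym_convex L" for L using F_le_S[OF that] SK by simp
  ultimately show ?thesis using that K by blast
qed

end

section \<open>Variation of a maximizer\<close>

locale maximizer = body \<kappa> dummy K r R + sphere_measure \<mu>
  for \<kappa> and dummy :: "'n::finite itself" and K :: "(real ^ 'n) set" and r R and \<mu> :: "(real ^ 'n) measure" +
  fixes \<alpha> :: real
  assumes K_sym: "\<And>x. x \<in> K \<Longrightarrow> - x \<in> K"
    and even: "\<And>\<eta>. \<eta> \<in> sets \<mu> \<Longrightarrow> emeasure \<mu> (uminus ` \<eta>) = emeasure \<mu> \<eta>"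
    and \<alpha>: "0 < \<alpha>" "\<alpha> < 1"
    and maximal: "\<And>L. sym_convex L \<Longrightarrow> gauss_functional \<mu> \<alpha> L \<le> gauss_functional \<mu> \<alpha> K"
begin

definition gK :: real where "gK = measure gaussian_measure K"

lemma K_bounded: "bounded K" and K_borel: "K \<in> sets borel" and K_0: "0 \<in> K"
  using K_compact K_inner r_pos by (auto simp: compact_imp_bounded borel_compact)

lemma gK_pos: "0 < gK"
proof -
  have "ball 0 r \<subseteq> interior K" using K_inner ball_subset_cball by (intro interior_maximal) auto
  then have "interior K \<noteq> {}" using r_pos by (metis centre_in_ball empty_iff subsetD)
  then show ?thesis unfolding gK_def by (rule measure_gaussian_pos[OF K_borel])
qed

lemma measure_even: "\<eta> \<in> sets \<mu> \<Longrightarrow> measure \<mu> (uminus ` \<eta>) = measure \<mu> \<eta>"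
  using even by (simp add: measure_def)

lemma uminus_sets: "\<eta> \<in> sets \<mu> \<Longrightarrow> uminus ` \<eta> \<in> sets \<mu>"
  using borel_uminus_image[of \<eta>] by (auto simp: sets_\<mu>_iff)

text \<open>The gain in the volume term cannot exceed the growth of the integral. The tangent is
  taken at the larger volume, where the slope underestimates the gain.\<close>

lemma perturb_outer:
  assumes L: "sym_convex L" "K \<subseteq> L" and E: "E \<in> sets \<mu>"
    and le: "\<And>u. u \<in> sphere 0 1 \<Longrightarrow> support_fun L u \<le> support_fun K u + t * indicator E u"
  shows "measure gaussian_measure L powr (\<alpha> - 1) * (measure gaussian_measure L - gK) \<le> t * measure \<mu> E"
proof -
  interpret finite_measure \<mu> by (rule finite_\<mu>)
  let ?g = "measure gaussian_measure"
  have Lb: "bounded L" "0 \<in> L" "L \<in> sets borel"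
    using L by (auto simp: sym_convex_def compact_imp_bounded borel_compact)
  have int: "integrable \<mu> (support_fun L)" "integrable \<mu> (support_fun K)" "integrable \<mu> (\<lambda>u. t * indicator E u :: real)"
    using Lb K_bounded K_0 E by (auto intro!: integrable_support_fun simp: emeasure_eq_measure)
  have "?g L powr (\<alpha> - 1) * (?g L - gK) \<le> (?g L powr \<alpha> - gK powr \<alpha>) / \<alpha>"
    using gK_pos \<alpha> measure_gaussian_mono[OF L(2) Lb(3)] by (intro powr_tangent) (auto simp: gK_def)
  also have "\<dots> \<le> (LINT u|\<mu>. support_fun L u) - (LINT u|\<mu>. support_fun K u)"
    using maximal[OF L(1)] by (simp add: gauss_functional_def gK_def diff_divide_distrib)
  also have "(LINT u|\<mu>. support_fun L u) \<le> (LINT u|\<mu>. support_fun K u + t * indicator E u)"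
    using int le by (intro integral_mono) (auto simp: space_\<mu>)
  also have "\<dots> = (LINT u|\<mu>. support_fun K u) + t * measure \<mu> E"
    using int E by simp
  finally show ?thesis by simp
qed

text \<open>Counterpart for shrinking: the drop of the integral cannot exceed the loss in the volume
  term, which the slope at the smaller volume overestimates.\<close>

lemma perturb_inner:
  assumes L: "sym_convex L" "L \<subseteq> K" "0 < measure gaussian_measure L" and E: "E \<in> sets \<mu>"
    and le: "\<And>u. u \<in> sphere 0 1 \<Longrightarrow> support_fun L u + t * indicator E u \<le> support_fun K u"
  shows "t * measure \<mu> E \<le> measure gaussian_measure L powr (\<alpha> - 1) * (gK - measure gaussian_measure L)"
proof -
  interpret finite_measure \<mu> by (rule finite_\<mu>)
  let ?g = "measure gaussian_measure"
  have Lb: "bounded L" "0 \<in> L"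
    using L by (auto simp: sym_convex_def compact_imp_bounded borel_compact)
  have int: "integrable \<mu> (support_fun L)" "integrable \<mu> (support_fun K)" "integrable \<mu> (\<lambda>u. t * indicator E u :: real)"
    using Lb K_bounded K_0 E by (auto intro!: integrable_support_fun simp: emeasure_eq_measure)
  have "(LINT u|\<mu>. support_fun L u) + t * measure \<mu> E = (LINT u|\<mu>. support_fun L u + t * indicator E u)"
    using int E by simp
  also have "\<dots> \<le> (LINT u|\<mu>. support_fun K u)"
    using int le by (intro integral_mono) (auto simp: space_\<mu>)
  also have "\<dots> \<le> (LINT u|\<mu>. support_fun L u) + (gK powr \<alpha> - ?g L powr \<alpha>) / \<alpha>"
    using maximal[OF L(1)] by (simp add: gauss_functional_def gK_def diff_divide_distrib)
  finally have "t * measure \<mu> E \<le> (gK powr \<alpha> - ?g L powr \<alpha>) / \<alpha>" by simp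
  also have "\<dots> \<le> ?g L powr (\<alpha> - 1) * (gK - ?g L)"
    using \<alpha> L(3) measure_gaussian_mono[OF L(2) K_borel] by (intro powr_tangent) (auto simp: gK_def)
  finally show ?thesis .
qed

section \<open>Pushing pieces of the boundary outwards\<close>

text \<open>Up to a factor close to 1, the Gaussian surface area of a part \<open>A\<close> of the boundary whose normals
  are close to \<open>v\<close>.\<close>

definition flux :: "real ^ 'n \<Rightarrow> (real ^ 'n) set \<Rightarrow> ennreal" where
  "flux v A = (\<integral>\<^sup>+y. indicator (proj_perp v ` A) y * ennreal (gauss_density (lift_perp v A y)) \<partial>perp_lebesgue v)"

lemma flux_finite:
  assumes v: "norm v = 1" and A: "compact A"
  shows "flux v A < \<infinity>"
proof -
  have cPA: "compact (proj_perp v ` A)" by (intro compact_continuous_image continuous_proj_perp A)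
  have "flux v A \<le> (\<integral>\<^sup>+y. indicator (proj_perp v ` A) y \<partial>perp_lebesgue v)"
    unfolding flux_def
  proof (rule nn_integral_mono)
    fix y
    have "ennreal (gauss_density (lift_perp v A y)) \<le> 1" using gauss_density_le_1 by (simp add: ennreal_le_1)
    then show "indicator (proj_perp v ` A) y * ennreal (gauss_density (lift_perp v A y)) \<le> indicator (proj_perp v ` A) y"
      by (auto simp: indicator_def)
  qed
  also have "\<dots> = emeasure (perp_lebesgue v) (proj_perp v ` A)" using borel_compact[OF cPA] by simp
  also have "\<dots> < \<infinity>" using compact_imp_bounded[OF cPA] by (rule emeasure_perp_bounded[OF v])
  finally show ?thesis .
qed

text \<open>The region swept by \<open>A\<close> when it moves by t along v. The lower bound is
  strict, so that the region is disjoint from \<open>K\<close>.\<close>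

definition extrusion :: "real ^ 'n \<Rightarrow> (real ^ 'n) set \<Rightarrow> real \<Rightarrow> (real ^ 'n) set" where
  "extrusion v A t = {z. proj_perp v z \<in> proj_perp v ` A \<and> lift_perp v A (proj_perp v z) \<bullet> v < z \<bullet> v \<and>
     z \<bullet> v \<le> lift_perp v A (proj_perp v z) \<bullet> v + t}"

lemma extrusionD:
  assumes inj: "inj_on (proj_perp v) A" and z: "z \<in> extrusion v A t"
  obtains x s where "x \<in> A" "0 < s" "s \<le> t" "z = x + s *\<^sub>R v"
proof -
  obtain x where x: "x \<in> A" "proj_perp v z = proj_perp v x" using z by (auto simp: extrusion_def)
  define s where "s = z \<bullet> v - x \<bullet> v"
  have "0 < s" "s \<le> t" using z x lift_perp_proj[OF inj x(1)] by (auto simp: extrusion_def s_def)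
  moreover have "z = x + s *\<^sub>R v"
    using x(2) by (simp add: proj_perp_def s_def algebra_simps)
  ultimately show ?thesis using that x by blast
qed

lemma extrusion_borel:
  assumes "compact A" "inj_on (proj_perp v) A"
  shows "extrusion v A t \<in> sets borel"
proof -
  have [measurable]: "lift_perp v A \<in> borel_measurable borel" using assms by (rule lift_perp_measurable)
  have [measurable]: "proj_perp v ` A \<in> sets borel"
    using assms by (intro borel_compact compact_continuous_image continuous_proj_perp)
  show ?thesis unfolding extrusion_def by measurable
qed

lemma gaussian_extrusion:
  assumes v: "norm v = 1" and A: "compact A" "A \<subseteq> K" and inj: "inj_on (proj_perp v) A" and t: "0 \<le> t"
  shows "ennreal (t * exp (- (2 * R * t + t\<^sup>2) / 2)) * flux v A \<le> emeasure gaussian_measure (extrusion v A t)"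
proof -
  let ?q = "exp (- (2 * R * t + t\<^sup>2) / 2)"
  have [measurable]: "lift_perp v A \<in> borel_measurable borel" using A(1) inj by (rule lift_perp_measurable)
  have PA [measurable]: "proj_perp v ` A \<in> sets borel"
    using A by (intro borel_compact compact_continuous_image continuous_proj_perp)
  have X [measurable]: "extrusion v A t \<in> sets borel" using A(1) inj by (rule extrusion_borel)
  have "ennreal (t * ?q) * flux v A =
      (\<integral>\<^sup>+y. ennreal (t * ?q) * (indicator (proj_perp v ` A) y * ennreal (gauss_density (lift_perp v A y))) \<partial>perp_lebesgue v)"
    unfolding flux_def by (rule nn_integral_cmult[symmetric]) measurable
  also have "\<dots> \<le> (\<integral>\<^sup>+y. (\<integral>\<^sup>+\<tau>. ennreal (gauss_density (y + \<tau> *\<^sub>R v)) * indicator (extrusion v A t) (y + \<tau> *\<^sub>R v) \<partial>lborel) \<partial>perp_lebesgue v)"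
  proof (rule nn_integral_mono_AE, use AE_perp_lebesgue[OF v] in eventually_elim)
    case (elim y)
    show ?case
    proof (cases "y \<in> proj_perp v ` A")
      case True
      then obtain x where x: "x \<in> A" "y = proj_perp v x" by auto
      have lx: "lift_perp v A y = x" using x lift_perp_proj[OF inj] by simp
      have xy: "x = y + (x \<bullet> v) *\<^sub>R v" using x by (simp add: proj_perp_def)
      have nx: "norm x \<le> R" using x A K_outer by auto
      have "ennreal (t * ?q) * ennreal (gauss_density x) = ennreal (?q * gauss_density x) * ennreal t"
        using t gauss_density_pos[of x] by (simp add: ennreal_mult[symmetric] mult_ac less_imp_le)
      also have "\<dots> = (\<integral>\<^sup>+\<tau>. ennreal (?q * gauss_density x) * indicator {x \<bullet> v<..x \<bullet> v + t} \<tau> \<partial>lborel)"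
        using t by (subst nn_integral_cmult_indicator) auto
      also have "\<dots> \<le> (\<integral>\<^sup>+\<tau>. ennreal (gauss_density (y + \<tau> *\<^sub>R v)) * indicator (extrusion v A t) (y + \<tau> *\<^sub>R v) \<partial>lborel)"
      proof (rule nn_integral_mono)
        fix \<tau>
        show "ennreal (?q * gauss_density x) * indicator {x \<bullet> v<..x \<bullet> v + t} \<tau>
          \<le> ennreal (gauss_density (y + \<tau> *\<^sub>R v)) * indicator (extrusion v A t) (y + \<tau> *\<^sub>R v)"
        proof (cases "\<tau> \<in> {x \<bullet> v<..x \<bullet> v + t}")
          case True
          have P: "proj_perp v (y + \<tau> *\<^sub>R v) = y"
            using elim by (simp add: proj_perp_add proj_perp_scaleR_self[OF v] proj_perp_id)
          have "y + \<tau> *\<^sub>R v \<in> extrusion v A t"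
            unfolding extrusion_def using P lx True x elim v by (auto simp: inner_add_left norm_eq_1)
          moreover have "norm (y + \<tau> *\<^sub>R v - x) \<le> t"
          proof -
            have "y + \<tau> *\<^sub>R v - x = (\<tau> - x \<bullet> v) *\<^sub>R v" by (subst xy) (simp add: algebra_simps)
            then show ?thesis using True v by simp
          qed
          then have "?q * gauss_density x \<le> gauss_density (y + \<tau> *\<^sub>R v)"
            by (rule gauss_density_ratio[OF nx])
          ultimately show ?thesis using True by (simp add: ennreal_leI)
        qed simp
      qed
      finally show ?thesis using True lx by simp
    qed simp
  qed
  also have "\<dots> = (\<integral>\<^sup>+z. ennreal (gauss_density z) * indicator (extrusion v A t) z \<partial>lborel)"
    by (rule nn_integral_lborel_perp[OF v, symmetric]) measurable
  also have "\<dots> = emeasure gaussian_measure (extrusion v A t)" by (simp add: emeasure_gaussian[OF X])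
  finally show ?thesis .
qed

lemma scaled_K_iff: "0 < s \<Longrightarrow> z \<in> (*\<^sub>R) s ` K \<longleftrightarrow> z /\<^sub>R s \<in> K"
  by (auto intro!: image_eqI[of z "(*\<^sub>R) s" "z /\<^sub>R s"])

text \<open>As r v lies in \<open>K\<close>, the point x + (t/r) (r v) is 1 + t/r times a convex
  combination of points of \<open>K\<close>.\<close>

lemma add_in_scaled_K:
  assumes x: "x \<in> K" and v: "norm v \<le> 1" and t: "0 \<le> t"
  shows "x + t *\<^sub>R v \<in> (*\<^sub>R) (1 + t / r) ` K"
proof -
  let ?s = "1 + t / r"
  have s: "0 < ?s" using t r_pos by (simp add: add_pos_nonneg)
  have rv: "r *\<^sub>R v \<in> K" using K_inner v r_pos by (auto simp: mult_le_cancel_left1)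
  have "(1 / ?s) *\<^sub>R x + ((t / r) / ?s) *\<^sub>R (r *\<^sub>R v) \<in> K"
  proof (rule convexD[OF K_convex x rv])
    have "1 / ?s + t / r / ?s = ?s / ?s" by (simp only: add_divide_distrib)
    then show "1 / ?s + t / r / ?s = 1" using s by simp
  qed (use s t r_pos in auto)
  also have "(1 / ?s) *\<^sub>R x + ((t / r) / ?s) *\<^sub>R (r *\<^sub>R v) = (x + t *\<^sub>R v) /\<^sub>R ?s"
    using r_pos by (simp add: scaleR_add_right divide_inverse mult.commute)
  finally show ?thesis using s by (simp only: scaled_K_iff)
qed

text \<open>The second projection of the compact set of pairs of a point and a normal at it.\<close>

lemma compact_normals_image:
  assumes A: "compact A"
  shows "compact (\<Union>x\<in>A. unit_normals K x)"
proof -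
  define T where "T = (A \<times> sphere 0 1) \<inter> (\<Inter>y\<in>K. {p. y \<bullet> snd p \<le> fst p \<bullet> snd p})"
  have "closed (\<Inter>y\<in>K. {p :: (real^'n) \<times> (real^'n). y \<bullet> snd p \<le> fst p \<bullet> snd p})"
    by (intro closed_INT ballI closed_Collect_le continuous_intros)
  then have "compact T" unfolding T_def
    using A by (intro compact_Int_closed compact_Times) auto
  then have "compact (snd ` T)" by (intro compact_continuous_image continuous_intros)
  also have "snd ` T = (\<Union>x\<in>A. unit_normals K x)"
  proof (rule set_eqI)
    fix u
    have "u \<in> snd ` T \<longleftrightarrow> (\<exists>x. (x, u) \<in> T)" by force
    also have "\<dots> \<longleftrightarrow> u \<in> (\<Union>x\<in>A. unit_normals K x)"
      unfolding T_def unit_normals_def by auto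
    finally show "u \<in> snd ` T \<longleftrightarrow> u \<in> (\<Union>x\<in>A. unit_normals K x)" .
  qed
  finally show ?thesis .
qed

text \<open>Push the part \<open>A\<close> of the boundary and its mirror image outwards by \<open>t\<close>. The support function
  changes only near the normals at \<open>A\<close>, and by at most \<open>t\<close>.\<close>

lemma outer_local_nbhd:
  assumes v: "norm v = 1" and A: "compact A" "A \<subseteq> K" and c: "0 < c"
    and Av: "\<And>x. x \<in> A \<Longrightarrow> 0 < x \<bullet> v"
    and nrm: "\<And>x u. x \<in> A \<Longrightarrow> u \<in> unit_normals K x \<Longrightarrow> c \<le> u \<bullet> v"
    and ne: "\<And>x. x \<in> A \<Longrightarrow> unit_normals K x \<noteq> {}"
    and \<delta>: "0 < \<delta>"
  defines "\<eta> \<equiv> \<Union>x\<in>A. unit_normals K x"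
  defines "E \<equiv> {u \<in> sphere 0 1. infdist u \<eta> < \<delta>}"
  shows "gK powr (\<alpha> - 1) * (2 * enn2real (flux v A)) \<le> measure \<mu> (E \<union> uminus ` E)"
proof -
  let ?g = "measure gaussian_measure" and ?h = "support_fun K"
  define J where "J = enn2real (flux v A)"
  have J: "flux v A = ennreal J" "0 \<le> J"
    using flux_finite[OF v A(1)] by (auto simp: J_def)
  have Lip: "\<And>x y. x \<in> A \<Longrightarrow> y \<in> A \<Longrightarrow> c * norm (x - y) \<le> norm (proj_perp v x - proj_perp v y)"
  proof -
    fix x y assume xy: "x \<in> A" "y \<in> A"
    obtain u w where u: "u \<in> unit_normals K x" and w: "w \<in> unit_normals K y" using ne xy by blast
    show "c * norm (x - y) \<le> norm (proj_perp v x - proj_perp v y)"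
      using xy A(2) by (intro normals_Lipschitz[OF v c _ _ u nrm[OF xy(1) u] w nrm[OF xy(2) w]]) auto
  qed
  have inj: "inj_on (proj_perp v) A" using c Lip by (rule graph_inj)
  have E_borel: "E \<in> sets \<mu>" unfolding E_def by (rule infdist_nbhd_sets)
  let ?E = "E \<union> uminus ` E"
  have EE: "?E \<in> sets \<mu>" using E_borel uminus_sets by auto
  \<comment> \<open>The gap between \<open>?h u\<close> and the inner product of x and u is
    continuous and, as u is not a normal at x, positive on a compact set; m is its minimum. A push
    by at most m therefore leaves the support function unchanged outside \<open>E\<close> and its
    mirror image.\<close>
  obtain m where m: "0 < m" "\<And>x u. x \<in> A \<Longrightarrow> u \<in> sphere 0 1 \<Longrightarrow> u \<notin> E \<Longrightarrow> x \<bullet> u + m \<le> ?h u"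
  proof -
    let ?T = "A \<times> (sphere 0 1 \<inter> {u. \<delta> \<le> infdist u \<eta>})"
    have cT: "compact ?T"
      using A by (intro compact_Times compact_Int_closed closed_Collect_le continuous_intros) auto
    show ?thesis
    proof (cases "?T = {}")
      case True
      show ?thesis
      proof (rule that[of 1])
        fix x u assume "x \<in> A" "u \<in> sphere (0 :: real ^ 'n) 1" "u \<notin> E"
        then have "(x, u) \<in> ?T" by (auto simp: E_def)
        then show "x \<bullet> u + 1 \<le> ?h u" using True by blast
      qed simp
    next
      case False
      have "continuous_on ?T (\<lambda>p. ?h (snd p) - fst p \<bullet> snd p)"
        using K_0 K_bounded
        by (intro continuous_intros continuous_on_compose2[OF support_fun_continuous[of K UNIV]]) auto
      then obtain p where p: "p \<in> ?T" "\<And>q. q \<in> ?T \<Longrightarrow> ?h (snd p) - fst p \<bullet> snd p \<le> ?h (snd q) - fst q \<bullet> snd q"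
        using continuous_attains_inf[OF cT False] by blast
      obtain x u where xu: "p = (x, u)" "x \<in> A" "norm u = 1" "\<delta> \<le> infdist u \<eta>" using p(1) by auto
      have "0 < ?h u - x \<bullet> u"
      proof (rule ccontr)
        assume "\<not> 0 < ?h u - x \<bullet> u"
        then have "y \<bullet> u \<le> x \<bullet> u" if "y \<in> K" for y using support_fun_upper[OF K_bounded that, of u] by simp
        then have "u \<in> \<eta>" using xu by (auto simp: \<eta>_def unit_normals_def)
        then show False using xu \<delta> by simp
      qed
      show ?thesis
      proof (rule that[OF \<open>0 < ?h u - x \<bullet> u\<close>])
        fix y w assume "y \<in> A" "w \<in> sphere (0 :: real ^ 'n) 1" "w \<notin> E"
        then have "(y, w) \<in> ?T" by (auto simp: E_def)
        from p(2)[OF this] show "y \<bullet> w + (?h u - x \<bullet> u) \<le> ?h w" by (simp add: xu)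
      qed
    qed
  qed
  have main: "((1 + t / r) ^ CARD('n) * gK) powr (\<alpha> - 1) * (2 * (exp (- (2 * R * t + t\<^sup>2) / 2) * J)) \<le> measure \<mu> ?E"
    if t: "0 < t" "t \<le> m" for t
  proof -
    let ?q = "exp (- (2 * R * t + t\<^sup>2) / 2)"
    define T where "T = (\<lambda>x. x + t *\<^sub>R v) ` A"
    define L where "L = convex hull (K \<union> T \<union> uminus ` T)"
    define X where "X = extrusion v A t"
    have cT: "compact T" unfolding T_def using A by (intro compact_continuous_image continuous_intros)
    have sym0: "- x \<in> K \<union> T \<union> uminus ` T" if "x \<in> K \<union> T \<union> uminus ` T" for x
      using that K_sym by auto
    have L: "sym_convex L"
      unfolding sym_convex_def
    proof (intro conjI ballI)
      show "compact L" unfolding L_def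
        using K_compact cT by (intro compact_convex_hull compact_Un compact_continuous_image continuous_intros)
      show "convex L" by (simp add: L_def)
      show "0 \<in> L" unfolding L_def using K_0 by (intro hull_inc) auto
      fix x assume x: "x \<in> L"
      have "uminus ` L = convex hull (uminus ` (K \<union> T \<union> uminus ` T))"
        unfolding L_def by (rule convex_hull_linear_image) (simp add: linear_iff)
      also have "uminus ` (K \<union> T \<union> uminus ` T) = K \<union> T \<union> uminus ` T"
      proof
        show "uminus ` (K \<union> T \<union> uminus ` T) \<subseteq> K \<union> T \<union> uminus ` T" using sym0 by blast
        show "K \<union> T \<union> uminus ` T \<subseteq> uminus ` (K \<union> T \<union> uminus ` T)"
        proof
          fix x assume "x \<in> K \<union> T \<union> uminus ` T"
          then show "x \<in> uminus ` (K \<union> T \<union> uminus ` T)" using sym0 by (metis image_eqI minus_minus)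
        qed
      qed
      finally show "- x \<in> L" using x unfolding L_def by blast
    qed
    have KL: "K \<subseteq> L" unfolding L_def by (meson hull_subset le_sup_iff)
    have TL: "T \<subseteq> L" unfolding L_def by (meson hull_subset le_sup_iff)
    have XL: "X \<subseteq> L"
    proof
      fix z assume "z \<in> X"
      then obtain x s where z: "x \<in> A" "0 < s" "s \<le> t" "z = x + s *\<^sub>R v"
        unfolding X_def using extrusionD[OF inj] by blast
      have "(1 - s / t) *\<^sub>R x + (s / t) *\<^sub>R (x + t *\<^sub>R v) \<in> L"
        using L z t KL TL A(2) by (intro convexD[of L]) (auto simp: sym_convex_def T_def)
      also have "(1 - s / t) *\<^sub>R x + (s / t) *\<^sub>R (x + t *\<^sub>R v) = z"
        using t z by (simp add: algebra_simps)
      finally show "z \<in> L" .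
    qed
    have X_borel: "X \<in> sets borel" unfolding X_def by (rule extrusion_borel[OF A(1) inj])
    have mX_borel: "uminus ` X \<in> sets borel" using X_borel by (rule borel_uminus_image)
    have Lb: "L \<in> sets borel" "bounded L" "L \<noteq> {}" using L by (auto simp: sym_convex_def borel_compact compact_imp_bounded)
    have XK: "X \<inter> K = {}"
    proof (rule ccontr)
      assume "X \<inter> K \<noteq> {}"
      then obtain z where "z \<in> X" "z \<in> K" by blast
      then obtain x s where z: "x \<in> A" "0 < s" "z = x + s *\<^sub>R v"
        unfolding X_def using extrusionD[OF inj] by blast
      obtain u where u: "u \<in> unit_normals K x" using ne z by blast
      then have "z \<bullet> u \<le> x \<bullet> u" using \<open>z \<in> K\<close> by (simp add: unit_normals_def)
      moreover have "z \<bullet> u = x \<bullet> u + s * (u \<bullet> v)" using z by (simp add: inner_add_left inner_add_right inner_commute)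
      moreover have "0 < s * (u \<bullet> v)" using nrm[OF z(1) u] c z by simp
      ultimately show False by simp
    qed
    have XX: "X \<inter> uminus ` X = {}"
    proof (rule ccontr)
      \<comment> \<open>By \<open>Av\<close> the extrusion lies strictly on the side of v, so it
        cannot meet its mirror image.\<close>
      have pos: "0 < z \<bullet> v" if zX: "z \<in> X" for z
      proof -
        obtain x s where z: "x \<in> A" "0 < s" "z = x + s *\<^sub>R v"
          using zX unfolding X_def using extrusionD[OF inj] by blast
        then show ?thesis using Av[OF z(1)] v by (simp add: inner_add_left norm_eq_1)
      qed
      assume "X \<inter> uminus ` X \<noteq> {}"
      then obtain z where z: "z \<in> X" "- z \<in> X" by auto
      show False using pos[OF z(1)] pos[OF z(2)] by simp
    qed
    interpret G: prob_space "gaussian_measure :: (real ^ 'n) measure" by (rule prob_space_gaussian)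
    have "gK + ?g X + ?g (uminus ` X) = ?g (K \<union> X) + ?g (uminus ` X)"
      unfolding gK_def using XK K_borel X_borel by (subst G.finite_measure_Union) auto
    also have "\<dots> = ?g (K \<union> X \<union> uminus ` X)"
    proof (rule G.finite_measure_Union[symmetric])
      have "uminus ` X \<inter> K = {}" using XK K_sym by fastforce
      then show "(K \<union> X) \<inter> uminus ` X = {}" using XX by blast
    qed (use K_borel X_borel mX_borel in auto)
    also have "\<dots> \<le> ?g L"
    proof (rule measure_gaussian_mono)
      have "uminus ` X \<subseteq> L" using XL L by (auto simp: sym_convex_def)
      then show "K \<union> X \<union> uminus ` X \<subseteq> L" using KL XL by blast
    qed (rule Lb)
    also have "?g (uminus ` X) = ?g X"
      using emeasure_gaussian_uminus[OF X_borel] by (simp add: measure_def)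
    finally have gL: "gK + 2 * ?g X \<le> ?g L" by simp
    have "ennreal (t * ?q) * ennreal J \<le> ennreal (?g X)"
      using gaussian_extrusion[OF v A(1,2) inj, of t] t J unfolding X_def emeasure_gaussian_eq_measure by simp
    then have gX: "t * ?q * J \<le> ?g X"
      using t J by (simp add: ennreal_mult[symmetric])
    \<comment> \<open>Enclosing \<open>L\<close> in a dilate bounds its volume from above; as the
      exponent \<alpha> - 1 is negative, this bounds the slope at \<open>L\<close> from
      below.\<close>
    have "L \<subseteq> (*\<^sub>R) (1 + t / r) ` K"
      unfolding L_def
    proof (rule hull_minimal)
      have TK: "T \<subseteq> (*\<^sub>R) (1 + t / r) ` K"
        unfolding T_def using add_in_scaled_K[of _ v t] v t A(2) by auto
      have mK: "- z \<in> (*\<^sub>R) (1 + t / r) ` K" if "z \<in> (*\<^sub>R) (1 + t / r) ` K" for z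
        using that K_sym by (auto simp: image_iff) (metis scaleR_minus_right)
      have "K \<subseteq> (*\<^sub>R) (1 + t / r) ` K"
        using add_in_scaled_K[of _ 0 t] t by auto
      then show "K \<union> T \<union> uminus ` T \<subseteq> (*\<^sub>R) (1 + t / r) ` K" using TK mK by blast
      show "convex ((*\<^sub>R) (1 + t / r) ` K)" using K_convex by (rule convex_scaling)
    qed
    then have "?g L \<le> ?g ((*\<^sub>R) (1 + t / r) ` K)"
      using K_compact by (intro measure_gaussian_mono borel_compact compact_scaling)
    also have "\<dots> \<le> (1 + t / r) ^ CARD('n) * gK"
      unfolding gK_def using K_borel t r_pos by (intro measure_gaussian_scaleR_le) auto
    finally have gL_le: "?g L \<le> (1 + t / r) ^ CARD('n) * gK" .
    have gL_pos: "0 < ?g L" using measure_gaussian_mono[OF KL Lb(1)] gK_pos by (simp add: gK_def)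
    have supp: "support_fun L u \<le> ?h u + t * indicator ?E u" if u: "u \<in> sphere 0 1" for u
    proof (rule support_fun_least[OF Lb(3)])
      let ?b = "?h u + t * indicator ?E u"
      have T_le: "(x + t *\<^sub>R v) \<bullet> w \<le> ?h w + t * indicator ?E w" if x: "x \<in> A" and w: "w \<in> sphere 0 1" for x w
      proof -
        have "v \<bullet> w \<le> 1" using Cauchy_Schwarz_ineq2[of v w] v w by simp
        then have tv: "t * (v \<bullet> w) \<le> t" using t by simp
        show ?thesis
        proof (cases "w \<in> ?E")
          case True
          have "x \<bullet> w \<le> ?h w" using x A(2) by (intro support_fun_upper K_bounded) auto
          then show ?thesis using tv True by (simp add: inner_add_left)
        next
          case False
          then have "x \<bullet> w + m \<le> ?h w" using m(2)[OF x w] by blast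
          then have "x \<bullet> w + t * (v \<bullet> w) \<le> ?h w" using tv t by linarith
          then show ?thesis using False by (simp add: inner_add_left)
        qed
      qed
      have "L \<subseteq> {z. u \<bullet> z \<le> ?b}"
        unfolding L_def
      proof (rule hull_minimal)
        show "convex {z. u \<bullet> z \<le> ?b}" by (rule convex_halfspace_le)
        have "x \<bullet> u \<le> ?b" if "x \<in> K" for x
          using support_fun_upper[OF K_bounded that, of u] t by (simp add: add_increasing2)
        moreover have "x \<bullet> u \<le> ?b" if "x \<in> T" for x using that T_le u by (auto simp: T_def)
        moreover have "- x \<bullet> u \<le> ?b" if "x \<in> T" for x
        proof -
          have "x \<bullet> (- u) \<le> ?h (- u) + t * indicator ?E (- u)" using that T_le[of _ "- u"] u by (auto simp: T_def)
          moreover have "- u \<in> ?E \<longleftrightarrow> u \<in> ?E" by (force simp: image_iff)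
          then have "indicator ?E (- u) = (indicator ?E u :: real)" by (simp only: indicator_def)
          ultimately show ?thesis using support_fun_sym[of K u, OF K_sym]
            by (simp only: inner_minus_right inner_minus_left)
        qed
        ultimately show "K \<union> T \<union> uminus ` T \<subseteq> {z. u \<bullet> z \<le> ?b}" by (auto simp: inner_commute)
      qed
      then show "z \<bullet> u \<le> ?b" if "z \<in> L" for z using that by (auto simp: inner_commute)
    qed
    have "((1 + t / r) ^ CARD('n) * gK) powr (\<alpha> - 1) * (2 * (t * ?q * J))
        \<le> ?g L powr (\<alpha> - 1) * (?g L - gK)"
    proof (rule mult_mono)
      show "((1 + t / r) ^ CARD('n) * gK) powr (\<alpha> - 1) \<le> ?g L powr (\<alpha> - 1)"
        using gL_le gL_pos \<alpha> by (intro powr_mono2') auto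
      show "2 * (t * ?q * J) \<le> ?g L - gK" using gX gL by linarith
      show "0 \<le> 2 * (t * ?q * J)" using t J by simp
    qed simp
    also have "\<dots> \<le> t * measure \<mu> ?E" by (rule perturb_outer[OF L KL EE supp])
    finally have "t * (((1 + t / r) ^ CARD('n) * gK) powr (\<alpha> - 1) * (2 * (?q * J))) \<le> t * measure \<mu> ?E"
      by (simp add: mult_ac)
    then show ?thesis using t by simp
  qed
  \<comment> \<open>Both correction factors tend to 1 as t decreases to 0, while \<delta> stays
    fixed.\<close>
  have "((\<lambda>t. ((1 + t / r) ^ CARD('n) * gK) powr (\<alpha> - 1) * (2 * (exp (- (2 * R * t + t\<^sup>2) / 2) * J)))
      \<longlongrightarrow> ((1 + 0 / r) ^ CARD('n) * gK) powr (\<alpha> - 1) * (2 * (exp (- (2 * R * 0 + 0\<^sup>2) / 2) * J))) (at_right 0)"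
    using gK_pos r_pos by (intro tendsto_intros) auto
  moreover have "\<forall>\<^sub>F t in at_right 0. ((1 + t / r) ^ CARD('n) * gK) powr (\<alpha> - 1) * (2 * (exp (- (2 * R * t + t\<^sup>2) / 2) * J)) \<le> measure \<mu> ?E"
    unfolding eventually_at_right_field using main m(1) by (intro exI[of _ m]) auto
  ultimately have "((1 + 0 / r) ^ CARD('n) * gK) powr (\<alpha> - 1) * (2 * (exp (- (2 * R * 0 + 0\<^sup>2) / 2) * J)) \<le> measure \<mu> ?E"
    by (rule tendsto_upperbound) simp
  then show ?thesis by (simp add: J_def)
qed

text \<open>As \<delta> decreases to 0 the neighbourhoods shrink to the set of normals and its
  mirror image, because that set is compact; by evenness the two together have at most twice the
  mass of one.\<close>

lemma outer_local:
  assumes v: "norm v = 1" and A: "compact A" "A \<subseteq> K" and c: "0 < c"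
    and Av: "\<And>x. x \<in> A \<Longrightarrow> 0 < x \<bullet> v"
    and nrm: "\<And>x u. x \<in> A \<Longrightarrow> u \<in> unit_normals K x \<Longrightarrow> c \<le> u \<bullet> v"
    and ne: "\<And>x. x \<in> A \<Longrightarrow> unit_normals K x \<noteq> {}"
  shows "ennreal (gK powr (\<alpha> - 1)) * flux v A \<le> emeasure \<mu> (\<Union>x\<in>A. unit_normals K x)"
proof (cases "A = {}")
  case True then show ?thesis by (simp add: flux_def)
next
  case False
  interpret finite_measure \<mu> by (rule finite_\<mu>)
  define \<eta> where "\<eta> = (\<Union>x\<in>A. unit_normals K x)"
  define E where "E \<delta> = {u \<in> sphere 0 1. infdist u \<eta> < \<delta>}" for \<delta>
  have c\<eta>: "compact \<eta>" unfolding \<eta>_def by (rule compact_normals_image[OF A(1)])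
  have \<eta>_ne: "\<eta> \<noteq> {}" using False ne by (auto simp: \<eta>_def)
  have \<eta>_sub: "\<eta> \<subseteq> sphere 0 1" by (auto simp: \<eta>_def unit_normals_def)
  have \<eta>_sets: "\<eta> \<in> sets \<mu>" using c\<eta> \<eta>_sub by (simp add: sets_\<mu>_iff borel_compact)
  have E_borel: "E \<delta> \<in> sets \<mu>" for \<delta> unfolding E_def by (rule infdist_nbhd_sets)
  have le: "gK powr (\<alpha> - 1) * (2 * enn2real (flux v A)) \<le> measure \<mu> (E \<delta> \<union> uminus ` E \<delta>)" if "0 < \<delta>" for \<delta>
    unfolding E_def \<eta>_def using outer_local_nbhd[OF v A c Av nrm ne that] by simp
  let ?W = "\<lambda>j. E (1 / Suc j) \<union> uminus ` E (1 / Suc j)"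
  have "(\<lambda>j. measure \<mu> (?W j)) \<longlonglongrightarrow> measure \<mu> (\<Inter>j. ?W j)"
  proof (rule finite_Lim_measure_decseq)
    show "range ?W \<subseteq> sets \<mu>" using E_borel uminus_sets by auto
    have "E (1 / Suc (Suc j)) \<subseteq> E (1 / Suc j)" for j
    proof -
      have "1 / real (Suc (Suc j)) \<le> 1 / real (Suc j)" by (intro divide_left_mono) auto
      then show ?thesis unfolding E_def by force
    qed
    then show "decseq ?W" by (intro decseq_SucI Un_mono image_mono)
  qed
  then have 1: "gK powr (\<alpha> - 1) * (2 * enn2real (flux v A)) \<le> measure \<mu> (\<Inter>j. ?W j)"
    by (rule tendsto_lowerbound) (auto intro!: always_eventually le)
  have "(\<Inter>j. ?W j) \<subseteq> \<eta> \<union> uminus ` \<eta>"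
  proof
    fix u assume u: "u \<in> (\<Inter>j. ?W j)"
    \<comment> \<open>Whether u or its opposite is close to \<eta> may depend on j; the minimum of
      the two distances removes this dependence.\<close>
    define d where "d = min (infdist u \<eta>) (infdist (- u) \<eta>)"
    have "d < 1 / Suc j" for j
      using u unfolding d_def E_def by (force simp: min_less_iff_disj)
    moreover have "0 \<le> d" by (simp add: d_def infdist_nonneg)
    ultimately have "d = 0"
      by (metis inverse_eq_divide not_less order_le_less reals_Archimedean less_asym)
    then have "infdist u \<eta> = 0 \<or> infdist (- u) \<eta> = 0" by (auto simp: d_def min_def split: if_splits)
    then have "u \<in> \<eta> \<or> - u \<in> \<eta>"
      using in_closed_iff_infdist_zero[OF compact_imp_closed[OF c\<eta>] \<eta>_ne] by blast
    then show "u \<in> \<eta> \<union> uminus ` \<eta>" by (force simp: image_iff)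
  qed
  then have "measure \<mu> (\<Inter>j. ?W j) \<le> measure \<mu> (\<eta> \<union> uminus ` \<eta>)"
    using \<eta>_sets uminus_sets by (intro finite_measure_mono) auto
  also have "\<dots> \<le> measure \<mu> \<eta> + measure \<mu> (uminus ` \<eta>)"
    using \<eta>_sets uminus_sets by (intro measure_Un_le) auto
  also have "\<dots> = 2 * measure \<mu> \<eta>" using measure_even[OF \<eta>_sets] by simp
  finally have "gK powr (\<alpha> - 1) * enn2real (flux v A) \<le> measure \<mu> \<eta>" using 1 by simp
  then have "ennreal (gK powr (\<alpha> - 1) * enn2real (flux v A)) \<le> emeasure \<mu> \<eta>"
    by (simp add: emeasure_eq_measure ennreal_leI)
  moreover have "ennreal (enn2real (flux v A)) = flux v A" using flux_finite[OF v A(1)] by simp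
  ultimately show ?thesis unfolding \<eta>_def by (simp add: ennreal_mult)
qed

end

section \<open>Cutting off caps\<close>

context maximizer
begin

definition cap :: "(real ^ 'n) set \<Rightarrow> real \<Rightarrow> (real ^ 'n) set" where
  "cap C t = {x \<in> K. \<exists>u\<in>C. support_fun K u - t \<le> x \<bullet> u}"

lemma compact_cap:
  assumes "compact C"
  shows "compact (cap C t)"
proof -
  define T where "T = (K \<times> C) \<inter> {p. support_fun K (snd p) - t \<le> fst p \<bullet> snd p}"
  have "closed {p :: (real^'n) \<times> (real^'n). support_fun K (snd p) - t \<le> fst p \<bullet> snd p}"
    using K_0 K_bounded
    by (intro closed_Collect_le continuous_intros continuous_on_compose2[OF support_fun_continuous[of K UNIV]]) auto
  then have "compact T" unfolding T_def
    using K_compact assms by (intro compact_Int_closed compact_Times) auto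
  then have "compact (fst ` T)" by (intro compact_continuous_image continuous_intros)
  also have "fst ` T = cap C t"
  proof (rule set_eqI)
    fix x
    have "x \<in> fst ` T \<longleftrightarrow> (\<exists>u. (x, u) \<in> T)" by force
    also have "\<dots> \<longleftrightarrow> x \<in> cap C t" unfolding T_def cap_def by auto
    finally show "x \<in> fst ` T \<longleftrightarrow> x \<in> cap C t" .
  qed
  finally show ?thesis .
qed

text \<open>If the lower point is within t of the supporting hyperplane for u, a step s along v
  rises by at least c s in direction u, and so leaves \<open>K\<close> once s exceeds t/c.\<close>

lemma cap_vertical:
  assumes c: "0 < c" and Cv: "\<And>u. u \<in> C \<Longrightarrow> c \<le> u \<bullet> v" and t: "0 \<le> t"
    and z: "y + a *\<^sub>R v \<in> cap C t" "y + b *\<^sub>R v \<in> cap C t"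
  shows "b - a \<le> t / c"
proof (cases "a \<le> b")
  case True
  obtain u where u: "u \<in> C" "support_fun K u - t \<le> (y + a *\<^sub>R v) \<bullet> u" using z by (auto simp: cap_def)
  have "(y + b *\<^sub>R v) \<bullet> u \<le> support_fun K u"
    using z(2) by (intro support_fun_upper K_bounded) (simp add: cap_def)
  then have "(b - a) * (u \<bullet> v) \<le> t" using u(2) by (simp add: inner_add_left inner_commute algebra_simps)
  moreover have "(b - a) * c \<le> (b - a) * (u \<bullet> v)" using True Cv[OF u(1)] by (intro mult_left_mono) auto
  ultimately show ?thesis using c by (simp add: field_simps)
next
  case False
  have "0 \<le> t / c" using c t by simp
  then show ?thesis using False by linarith
qed

text \<open>For \<open>C\<close> on the sphere this is \<open>reverse_gauss_image K C\<close>,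
  written without reference to the frontier.\<close>

definition normal_preimage :: "(real ^ 'n) set \<Rightarrow> (real ^ 'n) set" where
  "normal_preimage C = {x \<in> K. C \<inter> unit_normals K x \<noteq> {}}"

lemma normal_preimage_Lipschitz:
  assumes v: "norm v = 1" and c: "0 < c" and Cv: "\<And>u. u \<in> C \<Longrightarrow> c \<le> u \<bullet> v"
    and xy: "x \<in> normal_preimage C" "y \<in> normal_preimage C"
  shows "c * norm (x - y) \<le> norm (proj_perp v x - proj_perp v y)"
proof -
  obtain u where u: "u \<in> C" "u \<in> unit_normals K x" using xy by (auto simp: normal_preimage_def)
  obtain w where w: "w \<in> C" "w \<in> unit_normals K y" using xy by (auto simp: normal_preimage_def)
  show ?thesis
    using xy by (intro normals_Lipschitz[OF v c _ _ u(2) Cv[OF u(1)] w(2) Cv[OF w(1)]]) (auto simp: normal_preimage_def)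
qed

lemma normal_preimage_subset_cap: "C \<subseteq> sphere 0 1 \<Longrightarrow> 0 \<le> t \<Longrightarrow> normal_preimage C \<subseteq> cap C t"
proof
  fix x assume "C \<subseteq> sphere 0 1" "0 \<le> t" "x \<in> normal_preimage C"
  then obtain u where u: "x \<in> K" "u \<in> C" "u \<in> unit_normals K x" by (auto simp: normal_preimage_def)
  have "support_fun K u \<le> x \<bullet> u"
    using u K_0 by (intro support_fun_least) (auto simp: unit_normals_def)
  then show "x \<in> cap C t" using u \<open>0 \<le> t\<close> by (auto simp: cap_def intro!: bexI[of _ u])
qed

text \<open>Fubini along v: every fibre has length at most t/c. Over the projection of the boundary
  piece the density is compared with its value at the lifted point; over the remaining base points
  it is bounded by 1, which leaves an error term that vanishes with t.\<close>

lemma gaussian_cap_le: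
  assumes v: "norm v = 1" and C: "compact C" "C \<subseteq> sphere 0 1" and c: "0 < c"
    and Cv: "\<And>u. u \<in> C \<Longrightarrow> c \<le> u \<bullet> v" and t: "0 < t"
  defines "q \<equiv> exp (- (2 * R * (t / c) + (t / c)\<^sup>2) / 2)"
  shows "emeasure gaussian_measure (cap C t) \<le> ennreal (t / c) *
    (ennreal (1 / q) * flux v (normal_preimage C)
      + emeasure (perp_lebesgue v) (proj_perp v ` cap C t - proj_perp v ` normal_preimage C))"
proof -
  let ?A = "normal_preimage C"
  have cA: "compact ?A" unfolding normal_preimage_def using C by (intro compact_normals compact_imp_closed)
  have inj: "inj_on (proj_perp v) ?A"
    using c normal_preimage_Lipschitz[OF v c Cv] by (rule graph_inj)
  have lm [measurable]: "lift_perp v ?A \<in> borel_measurable borel" by (rule lift_perp_measurable[OF cA inj])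
  have cap_b [measurable]: "cap C t \<in> sets borel" by (intro borel_compact compact_cap C)
  have D [measurable]: "proj_perp v ` ?A \<in> sets borel"
    by (intro borel_proj_perp_image cA)
  have Dt [measurable]: "proj_perp v ` cap C t \<in> sets borel"
    by (intro borel_proj_perp_image compact_cap C)
  have q: "0 < q" by (simp add: q_def)
  have tc: "0 < t / c" using t c by simp
  have "emeasure gaussian_measure (cap C t) = (\<integral>\<^sup>+z. ennreal (gauss_density z) * indicator (cap C t) z \<partial>lborel)"
    by (rule emeasure_gaussian[OF cap_b])
  also have "\<dots> = (\<integral>\<^sup>+y. (\<integral>\<^sup>+\<tau>. ennreal (gauss_density (y + \<tau> *\<^sub>R v)) * indicator (cap C t) (y + \<tau> *\<^sub>R v) \<partial>lborel) \<partial>perp_lebesgue v)"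
    by (rule nn_integral_lborel_perp[OF v]) measurable
  also have "\<dots> \<le> (\<integral>\<^sup>+y. ennreal (t / c) * (ennreal (1 / q) * (indicator (proj_perp v ` ?A) y * ennreal (gauss_density (lift_perp v ?A y)))
      + indicator (proj_perp v ` cap C t - proj_perp v ` ?A) y) \<partial>perp_lebesgue v)"
  proof (rule nn_integral_mono_AE, use AE_perp_lebesgue[OF v] in eventually_elim)
    case (elim y)
    define S where "S = {\<tau>. y + \<tau> *\<^sub>R v \<in> cap C t}"
    have [measurable]: "S \<in> sets borel" unfolding S_def by measurable
    have S_len: "b - a \<le> t / c" if "a \<in> S" "b \<in> S" for a b
      using that t by (intro cap_vertical[OF c Cv]) (auto simp: S_def)
    have eS: "emeasure lborel S \<le> ennreal (t / c)"
    proof (cases "S = {}")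
      case False
      then obtain s where s: "s \<in> S" by blast
      have bdd: "bdd_below S" using S_len[OF _ s] by (intro bdd_belowI[of _ "s - t / c"]) (simp add: algebra_simps)
      have "S \<subseteq> {Inf S..Inf S + t / c}"
      proof
        fix \<tau> assume \<tau>: "\<tau> \<in> S"
        have "\<tau> - t / c \<le> Inf S" using False S_len[OF _ \<tau>] by (intro cInf_greatest) (auto simp: algebra_simps)
        then show "\<tau> \<in> {Inf S..Inf S + t / c}" using cInf_lower[OF \<tau> bdd] by simp
      qed
      then have "emeasure lborel S \<le> emeasure lborel {Inf S..Inf S + t / c}" by (intro emeasure_mono) auto
      also have "\<dots> = ennreal (t / c)" using tc by simp
      finally show ?thesis .
    qed simp
    have P: "proj_perp v (y + \<tau> *\<^sub>R v) = y" for \<tau>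
      using elim by (simp add: proj_perp_add proj_perp_scaleR_self[OF v] proj_perp_id)
    have bound: "(\<integral>\<^sup>+\<tau>. ennreal (gauss_density (y + \<tau> *\<^sub>R v)) * indicator (cap C t) (y + \<tau> *\<^sub>R v) \<partial>lborel) \<le> ennreal (t / c) * ennreal k"
      if k: "\<And>\<tau>. \<tau> \<in> S \<Longrightarrow> gauss_density (y + \<tau> *\<^sub>R v) \<le> k" for k
    proof -
      have "(\<integral>\<^sup>+\<tau>. ennreal (gauss_density (y + \<tau> *\<^sub>R v)) * indicator (cap C t) (y + \<tau> *\<^sub>R v) \<partial>lborel)
          \<le> (\<integral>\<^sup>+\<tau>. ennreal k * indicator S \<tau> \<partial>lborel)"
        using k by (intro nn_integral_mono) (auto simp: S_def indicator_def intro: ennreal_leI)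
      also have "\<dots> = ennreal k * emeasure lborel S" by (rule nn_integral_cmult_indicator) simp
      also have "\<dots> \<le> ennreal k * ennreal (t / c)" using eS by (rule mult_left_mono) simp
      finally show ?thesis by (simp add: mult.commute)
    qed
    consider "y \<in> proj_perp v ` ?A" | "y \<in> proj_perp v ` cap C t - proj_perp v ` ?A" | "y \<notin> proj_perp v ` cap C t" "y \<notin> proj_perp v ` ?A"
      by blast
    then show ?case
    proof cases
      case 1
      then obtain x where x: "x \<in> ?A" "y = proj_perp v x" by auto
      have lx: "lift_perp v ?A y = x" using x lift_perp_proj[OF inj] by simp
      have xy: "x = y + (x \<bullet> v) *\<^sub>R v" using x by (simp add: proj_perp_def)
      have xS: "x \<bullet> v \<in> S" using x(1) normal_preimage_subset_cap[OF C(2), of t] t xy by (auto simp: S_def)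
      have "gauss_density (y + \<tau> *\<^sub>R v) \<le> 1 / q * gauss_density x" if \<tau>: "\<tau> \<in> S" for \<tau>
      proof -
        have "norm (y + \<tau> *\<^sub>R v) \<le> R" using \<tau> K_outer by (auto simp: S_def cap_def)
        moreover have "norm (x - (y + \<tau> *\<^sub>R v)) \<le> t / c"
        proof -
          have "x - (y + \<tau> *\<^sub>R v) = (x \<bullet> v - \<tau>) *\<^sub>R v" by (subst xy) (simp add: algebra_simps)
          then show ?thesis using S_len[OF xS \<tau>] S_len[OF \<tau> xS] v by (simp add: abs_le_iff)
        qed
        ultimately have "q * gauss_density (y + \<tau> *\<^sub>R v) \<le> gauss_density x"
          unfolding q_def by (rule gauss_density_ratio)
        then show ?thesis using q by (simp add: field_simps)
      qed
      note le = bound[OF this]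
      have "ennreal (1 / q * gauss_density x) = ennreal (1 / q) * ennreal (gauss_density x)"
        using q gauss_density_pos[of x] by (intro ennreal_mult) auto
      then show ?thesis using le 1 lx by simp
    next
      case 2
      from bound[of 1, OF gauss_density_le_1] show ?thesis using 2 by simp
    next
      case 3
      have "y + \<tau> *\<^sub>R v \<notin> cap C t" for \<tau> using 3(1) P by (metis image_eqI)
      then show ?thesis by simp
    qed
  qed
  also have "\<dots> = ennreal (t / c) * (ennreal (1 / q) * flux v ?A + emeasure (perp_lebesgue v) (proj_perp v ` cap C t - proj_perp v ` ?A))"
    unfolding flux_def by (simp add: nn_integral_cmult nn_integral_add)
  finally show ?thesis .
qed

lemma support_fun_ge_r: "norm u = 1 \<Longrightarrow> r \<le> support_fun K u"
proof -
  assume u: "norm u = 1"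
  then have "r *\<^sub>R u \<in> K" using K_inner r_pos by auto
  from support_fun_upper[OF K_bounded this, of u] show ?thesis using u by (simp add: norm_eq_1)
qed

text \<open>Cutting \<open>K\<close> at depth t in all directions of \<open>C\<close> and of its
  mirror image lowers the support function there by at least t and costs at most twice the volume of
  the caps. The remainder contains (1 - t/r) \<open>K\<close>, which bounds its volume from
  below.\<close>

lemma inner_cap_bound:
  assumes C: "compact C" "C \<subseteq> sphere 0 1" and pos: "\<And>u. u \<in> C \<Longrightarrow> 0 < u \<bullet> v" and t: "0 < t" "t < r"
  shows "t * measure \<mu> C \<le> ((1 - t / r) ^ CARD('n) * gK) powr (\<alpha> - 1) * measure gaussian_measure (cap C t)"
proof -
  interpret finite_measure \<mu> by (rule finite_\<mu>)
  interpret G: prob_space "gaussian_measure :: (real ^ 'n) measure" by (rule prob_space_gaussian)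
  let ?g = "measure gaussian_measure" and ?h = "support_fun K" and ?s = "1 - t / r"
  have Cs: "C \<in> sets \<mu>" using C by (simp add: sets_\<mu>_iff borel_compact)
  have s: "0 < ?s" "?s \<le> 1" using t r_pos by auto
  have h_sym: "?h (- u) = ?h u" for u using K_sym by (rule support_fun_sym)
  have hr: "r \<le> ?h u" if "u \<in> C" for u using support_fun_ge_r[of u] that C by auto
  define L where "L = K \<inter> (\<Inter>u\<in>C. {x. u \<bullet> x \<le> ?h u - t} \<inter> {x. u \<bullet> x \<ge> - (?h u - t)})"
  have L_iff: "x \<in> L \<longleftrightarrow> x \<in> K \<and> (\<forall>u\<in>C. \<bar>x \<bullet> u\<bar> \<le> ?h u - t)" for x
    unfolding L_def by (auto simp: abs_le_iff inner_commute)
  have L: "sym_convex L"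
    unfolding sym_convex_def
  proof (intro conjI ballI)
    show "compact L" unfolding L_def
      by (intro compact_Int_closed K_compact closed_INT ballI closed_Int closed_halfspace_le closed_halfspace_ge)
    show "convex L" unfolding L_def
      by (intro convex_Int K_convex convex_INT convex_halfspace_le convex_halfspace_ge)
    show "0 \<in> L" unfolding L_iff using K_0 hr t by force
    show "- x \<in> L" if "x \<in> L" for x using that K_sym by (auto simp: L_iff)
  qed
  have LK: "L \<subseteq> K" by (auto simp: L_iff)
  have Lb: "L \<in> sets borel" "L \<noteq> {}" using L by (auto simp: sym_convex_def borel_compact)
  have "(*\<^sub>R) ?s ` K \<subseteq> L"
  proof
    fix z assume "z \<in> (*\<^sub>R) ?s ` K"
    then obtain x where x: "x \<in> K" "z = ?s *\<^sub>R x" by blast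
    have "?s *\<^sub>R x + (t / r) *\<^sub>R 0 \<in> K" using s t r_pos by (intro convexD[OF K_convex x(1) K_0]) auto
    moreover have "\<bar>z \<bullet> u\<bar> \<le> ?h u - t" if u: "u \<in> C" for u
    proof -
      have "\<bar>x \<bullet> u\<bar> \<le> ?h u"
        using support_fun_upper[OF K_bounded x(1), of u] support_fun_upper[OF K_bounded K_sym[OF x(1)], of u]
        by (simp add: abs_le_iff)
      then have "?s * \<bar>x \<bullet> u\<bar> \<le> ?s * ?h u" using s by (intro mult_left_mono) auto
      \<comment> \<open>Since \<open>?h u\<close> is at least r, contraction by 1 - t/r moves the
        supporting hyperplane inwards by at least t.\<close>
      also have "\<dots> = ?h u - t * (?h u / r)" by (simp add: algebra_simps)
      also have "\<dots> \<le> ?h u - t"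
        using hr[OF u] r_pos t by (simp add: le_divide_eq)
      finally show ?thesis using s x by (simp add: abs_mult)
    qed
    ultimately show "z \<in> L" using x by (simp add: L_iff)
  qed
  then have "?g ((*\<^sub>R) ?s ` K) \<le> ?g L" using Lb by (intro measure_gaussian_mono) auto
  then have gL: "?s ^ CARD('n) * gK \<le> ?g L"
    using measure_gaussian_scaleR_ge[OF K_borel s] by (simp add: gK_def)
  have sg: "0 < ?s ^ CARD('n) * gK" using s gK_pos by simp
  have cap_b: "cap C t \<in> sets borel" by (intro borel_compact compact_cap C)
  have mcap_b: "uminus ` cap C t \<in> sets borel" using cap_b by (rule borel_uminus_image)
  have "K \<subseteq> L \<union> cap C t \<union> uminus ` cap C t"
  proof
    fix x assume x: "x \<in> K"
    show "x \<in> L \<union> cap C t \<union> uminus ` cap C t"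
    proof (cases "x \<in> L")
      case False
      then obtain u where u: "u \<in> C" "?h u - t < \<bar>x \<bullet> u\<bar>" using x by (auto simp: L_iff not_le)
      then consider "?h u - t \<le> x \<bullet> u" | "?h u - t \<le> (- x) \<bullet> u" by (cases "0 \<le> x \<bullet> u") auto
      then show ?thesis
      proof cases
        case 1 then show ?thesis using x u by (auto simp: cap_def)
      next
        case 2
        then have "- x \<in> cap C t" using K_sym[OF x] u by (auto simp: cap_def)
        then show ?thesis by (metis UnI2 image_eqI minus_minus)
      qed
    qed simp
  qed
  then have "gK \<le> ?g (L \<union> cap C t \<union> uminus ` cap C t)"
    unfolding gK_def using Lb cap_b mcap_b by (intro measure_gaussian_mono) auto
  also have "\<dots> \<le> ?g (L \<union> cap C t) + ?g (uminus ` cap C t)"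
    using Lb cap_b mcap_b by (intro measure_Un_le) auto
  also have "\<dots> \<le> ?g L + ?g (cap C t) + ?g (uminus ` cap C t)"
    using Lb cap_b mcap_b by (intro add_right_mono measure_Un_le) auto
  also have "?g (uminus ` cap C t) = ?g (cap C t)"
    using emeasure_gaussian_uminus[OF cap_b] by (simp add: measure_def)
  finally have gcap: "gK - ?g L \<le> 2 * ?g (cap C t)" by simp
  let ?E = "C \<union> uminus ` C"
  have EE: "?E \<in> sets \<mu>" using Cs uminus_sets by auto
  \<comment> \<open>\<open>C\<close> lies strictly on the side of v, so with its mirror image it
    carries exactly twice its own mass.\<close>
  have disj: "C \<inter> uminus ` C = {}" 
  proof (rule ccontr)
    assume "C \<inter> uminus ` C \<noteq> {}"
    then obtain u where u: "u \<in> C" "- u \<in> C" by auto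
    show False using pos[OF u(1)] pos[OF u(2)] by simp
  qed
  have "t * measure \<mu> ?E \<le> ?g L powr (\<alpha> - 1) * (gK - ?g L)"
  proof (rule perturb_inner[OF L LK _ EE])
    show "0 < ?g L" using gL sg by linarith
    fix u assume "u \<in> sphere (0 :: real ^ 'n) 1"
    show "support_fun L u + t * indicator ?E u \<le> ?h u"
    proof (cases "u \<in> ?E")
      case True
      then have "u \<in> C \<or> - u \<in> C" by auto
      then have "x \<bullet> u \<le> ?h u - t" if "x \<in> L" for x
      proof
        assume "u \<in> C"
        then show ?thesis using that by (force simp: L_iff)
      next
        assume "- u \<in> C"
        then have "\<bar>x \<bullet> (- u)\<bar> \<le> ?h (- u) - t" using that unfolding L_iff by blast
        then show ?thesis by (simp add: h_sym)
      qed
      then have "support_fun L u \<le> ?h u - t" using Lb by (intro support_fun_least) auto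
      then show ?thesis using True by simp
    next
      case False
      then show ?thesis using support_fun_mono[OF Lb(2) LK K_bounded, of u] by simp
    qed
  qed
  also have "\<dots> \<le> (?s ^ CARD('n) * gK) powr (\<alpha> - 1) * (2 * ?g (cap C t))"
    using gL sg \<alpha> gcap measure_gaussian_mono[OF LK K_borel] by (intro mult_mono powr_mono2') (auto simp: gK_def)
  also have "measure \<mu> ?E = measure \<mu> C + measure \<mu> (uminus ` C)"
    using Cs uminus_sets disj by (intro finite_measure_Union) auto
  also have "\<dots> = 2 * measure \<mu> C" using measure_even[OF Cs] by simp
  finally show ?thesis by simp
qed

text \<open>As the depth tends to 0 the base points outside the projected boundary piece disappear,
  so the error term of \<open>gaussian_cap_le\<close> vanishes. The factor 1/c remains from the
  length t/c of slanted fibres.\<close>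

lemma inner_local:
  assumes v: "norm v = 1" and C: "compact C" "C \<subseteq> sphere 0 1" and c: "0 < c"
    and Cv: "\<And>u. u \<in> C \<Longrightarrow> c \<le> u \<bullet> v"
  shows "emeasure \<mu> C \<le> ennreal (gK powr (\<alpha> - 1) / c) * flux v (normal_preimage C)"
proof -
  interpret finite_measure \<mu> by (rule finite_\<mu>)
  let ?A = "normal_preimage C" and ?g = "measure gaussian_measure" and ?M = "perp_lebesgue v"
  have cA: "compact ?A" unfolding normal_preimage_def using C by (intro compact_normals compact_imp_closed)
  define J where "J = enn2real (flux v ?A)"
  have J: "flux v ?A = ennreal J" "0 \<le> J" using flux_finite[OF v cA] by (auto simp: J_def)
  \<comment> \<open>Starting at r/2 keeps the depth below r, as \<open>inner_cap_bound\<close>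
    requires.\<close>
  define t where "t j = r / real (Suc (Suc j))" for j
  have t: "0 < t j" "t j < r" for j
  proof -
    have "0 \<le> r * real j" using r_pos by simp
    then have "r < r * real (Suc (Suc j))" using r_pos by (simp add: algebra_simps add_pos_nonneg)
    then show "0 < t j" "t j < r" using r_pos by (simp_all add: t_def divide_less_eq)
  qed
  have t_dec: "t n \<le> t m" if "m \<le> n" for m n
    unfolding t_def using that r_pos by (intro divide_left_mono) auto
  have t_lim: "t \<longlonglongrightarrow> 0"
  proof -
    have "(\<lambda>j. r * (1 / real (Suc (Suc j)))) \<longlonglongrightarrow> r * 0"
      by (intro tendsto_mult tendsto_const LIMSEQ_Suc[OF LIMSEQ_Suc[OF lim_1_over_n]])
    then show ?thesis by (simp add: t_def[abs_def])
  qed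
  define D where "D j = proj_perp v ` cap C (t j) - proj_perp v ` ?A" for j
  have PA: "proj_perp v ` ?A \<in> sets borel"
    by (intro borel_proj_perp_image cA)
  have Pcap: "compact (proj_perp v ` cap C t)" for t
    by (intro compact_continuous_image continuous_proj_perp compact_cap C)
  have D_borel: "D j \<in> sets ?M" for j unfolding D_def using PA borel_compact[OF Pcap] by simp
  have D_fin: "emeasure ?M (D j) \<noteq> \<infinity>" for j
  proof -
    have "bounded (D j)" unfolding D_def by (intro bounded_diff compact_imp_bounded Pcap)
    from emeasure_perp_bounded[OF v this] show ?thesis by simp
  qed
  \<comment> \<open>Over a base point in every \<open>D j\<close> the fibres of the caps are nested
    nonempty compact sets. A common point lies in all caps, so by compactness of \<open>C\<close> it
    has a normal in \<open>C\<close>, and its projection was excluded from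
    \<open>D j\<close>.\<close>
  have D_empty: "(\<Inter>j. D j) = {}"
  proof (rule ccontr)
    assume "(\<Inter>j. D j) \<noteq> {}"
    then obtain y where y: "\<And>j. y \<in> D j" by blast
    define S where "S j = cap C (t j) \<inter> {z. proj_perp v z = y}" for j
    have "\<Inter> (range S) \<noteq> {}"
    proof (rule compact_nest)
      show "compact (S j)" for j
        unfolding S_def by (intro compact_Int_closed compact_cap C closed_Collect_eq continuous_intros)
      show "S j \<noteq> {}" for j using y[of j] by (auto simp: S_def D_def)
      show "S n \<subseteq> S m" if "m \<le> n" for m n
        using t_dec[OF that] unfolding S_def cap_def by force
    qed
    then obtain x where x: "\<And>j. x \<in> S j" by blast
    then have xK: "x \<in> K" and Px: "proj_perp v x = y" by (auto simp: S_def cap_def)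
    have "C \<noteq> {}" using x[of 0] by (auto simp: S_def cap_def)
    moreover have "continuous_on C (\<lambda>u. support_fun K u - x \<bullet> u)"
      using K_0 K_bounded by (intro continuous_intros support_fun_continuous) auto
    ultimately obtain u where u: "u \<in> C" "\<And>w. w \<in> C \<Longrightarrow> support_fun K u - x \<bullet> u \<le> support_fun K w - x \<bullet> w"
      using continuous_attains_inf[OF C(1)] by blast
    have "support_fun K u - x \<bullet> u \<le> t j" for j
    proof -
      obtain w where "w \<in> C" "support_fun K w - t j \<le> x \<bullet> w" using x[of j] by (auto simp: S_def cap_def)
      then show ?thesis using u(2)[of w] by linarith
    qed
    then have "support_fun K u - x \<bullet> u \<le> 0"
      by (intro tendsto_lowerbound[OF t_lim]) auto
    then have "y' \<bullet> u \<le> x \<bullet> u" if "y' \<in> K" for y'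
      using support_fun_upper[OF K_bounded that, of u] by simp
    moreover have "norm u = 1" using u(1) C(2) by auto
    ultimately have "u \<in> unit_normals K x" by (simp add: unit_normals_def)
    then have "x \<in> ?A" using u(1) xK by (auto simp: normal_preimage_def)
    then show False using y[of 0] Px by (auto simp: D_def)
  qed
  have "(\<lambda>j. measure ?M (D j)) \<longlonglongrightarrow> measure ?M (\<Inter>j. D j)"
  proof (rule Lim_measure_decseq)
    show "range D \<subseteq> sets ?M" using D_borel by auto
    show "decseq D"
    proof (rule decseq_SucI)
      fix j
      have "cap C (t (Suc j)) \<subseteq> cap C (t j)" using t_dec[of j "Suc j"] unfolding cap_def by force
      then show "D (Suc j) \<subseteq> D j" unfolding D_def by blast
    qed
  qed (rule D_fin)
  then have e_lim: "(\<lambda>j. measure ?M (D j)) \<longlonglongrightarrow> 0" by (simp add: D_empty)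
  define q where "q j = exp (- (2 * R * (t j / c) + (t j / c)\<^sup>2) / 2)" for j
  have main: "measure \<mu> C \<le> ((1 - t j / r) ^ CARD('n) * gK) powr (\<alpha> - 1) * ((1 / c) * ((1 / q j) * J + measure ?M (D j)))" for j
  proof -
    have q: "0 < q j" by (simp add: q_def)
    have "ennreal (?g (cap C (t j))) \<le> ennreal (t j / c) * (ennreal (1 / q j) * flux v ?A + emeasure ?M (D j))"
      using gaussian_cap_le[OF v C c Cv t(1)] unfolding D_def q_def emeasure_gaussian_eq_measure .
    also have "\<dots> = ennreal (t j / c * (1 / q j * J + measure ?M (D j)))"
      using J t c q D_fin[of j] by (simp add: emeasure_eq_ennreal_measure ennreal_mult[symmetric] ennreal_plus[symmetric] less_imp_le del: ennreal_plus)
    finally have g: "?g (cap C (t j)) \<le> t j / c * (1 / q j * J + measure ?M (D j))"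
      using J t[of j] c q by (subst (asm) ennreal_le_iff) (auto intro!: mult_nonneg_nonneg add_nonneg_nonneg)
    have "t j * measure \<mu> C \<le> ((1 - t j / r) ^ CARD('n) * gK) powr (\<alpha> - 1) * ?g (cap C (t j))"
    proof (rule inner_cap_bound[OF C _ t])
      show "0 < u \<bullet> v" if "u \<in> C" for u using Cv[OF that] c by linarith
    qed
    also have "\<dots> \<le> ((1 - t j / r) ^ CARD('n) * gK) powr (\<alpha> - 1) * (t j / c * (1 / q j * J + measure ?M (D j)))"
      using g by (rule mult_left_mono) simp
    finally have "t j * measure \<mu> C \<le> t j * (((1 - t j / r) ^ CARD('n) * gK) powr (\<alpha> - 1) * ((1 / c) * ((1 / q j) * J + measure ?M (D j))))"
      by (simp add: mult_ac)
    then show ?thesis using t[of j] by (simp only: mult_le_cancel_left_pos)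
  qed
  have q_lim: "q \<longlonglongrightarrow> exp (- (2 * R * (0 / c) + (0 / c)\<^sup>2) / 2)"
    unfolding q_def[abs_def] using c by (intro tendsto_intros t_lim) auto
  have "(\<lambda>j. ((1 - t j / r) ^ CARD('n) * gK) powr (\<alpha> - 1) * ((1 / c) * ((1 / q j) * J + measure ?M (D j))))
      \<longlonglongrightarrow> ((1 - 0 / r) ^ CARD('n) * gK) powr (\<alpha> - 1) * ((1 / c) * ((1 / exp (- (2 * R * (0 / c) + (0 / c)\<^sup>2) / 2)) * J + 0))"
    using gK_pos r_pos by (intro tendsto_intros t_lim q_lim e_lim) auto
  then have "measure \<mu> C \<le> ((1 - 0 / r) ^ CARD('n) * gK) powr (\<alpha> - 1) * ((1 / c) * ((1 / exp (- (2 * R * (0 / c) + (0 / c)\<^sup>2) / 2)) * J + 0))"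
    by (rule tendsto_lowerbound[OF _ always_eventually[OF allI[OF main]] sequentially_bot])
  then have "measure \<mu> C \<le> gK powr (\<alpha> - 1) / c * J" by simp
  then have "emeasure \<mu> C \<le> ennreal (gK powr (\<alpha> - 1) / c * J)"
    by (simp add: emeasure_eq_measure ennreal_leI)
  also have "\<dots> = ennreal (gK powr (\<alpha> - 1) / c) * flux v ?A"
    unfolding J(1) using J(2) c by (intro ennreal_mult) auto
  finally show ?thesis .
qed

end

section \<open>The Euler-Lagrange equation\<close>

text \<open>The balls are peeled off one at a time: both sides are additive over the resulting
  disjoint pieces, each inside a single ball.\<close>

lemma local_le_imp_le:
  fixes M N :: "'a::metric_space measure" and a b :: ennreal
  assumes F: "finite F"
    and M: "\<And>A. A \<in> sets M \<Longrightarrow> A \<in> sets borel" and N: "sets N = sets M"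
    and le: "\<And>A v. A \<in> sets M \<Longrightarrow> v \<in> F \<Longrightarrow> A \<subseteq> ball v e \<Longrightarrow> a * emeasure M A \<le> b * emeasure N A"
    and B: "\<And>v A. A \<in> sets M \<Longrightarrow> A \<inter> ball v e \<in> sets M"
    and A: "A \<in> sets M" "A \<subseteq> (\<Union>v\<in>F. ball v e)"
  shows "a * emeasure M A \<le> b * emeasure N A"
  using F le A
proof (induction F arbitrary: A rule: finite_induct)
  case (insert v F)
  let ?B = "A \<inter> ball v e" and ?C = "A - A \<inter> ball v e"
  have s: "?B \<in> sets M" "?C \<in> sets M" using B insert.prems(2) by auto
  have "emeasure M A = emeasure M ?B + emeasure M ?C"
    using s by (subst plus_emeasure) (auto intro!: arg_cong[where f="emeasure M"])
  then have "a * emeasure M A = a * emeasure M ?B + a * emeasure M ?C" by (simp add: distrib_left)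
  also have "\<dots> \<le> b * emeasure N ?B + b * emeasure N ?C"
  proof (rule add_mono)
    show "a * emeasure M ?B \<le> b * emeasure N ?B" using s by (intro insert.prems(1)[of _ v]) auto
    show "a * emeasure M ?C \<le> b * emeasure N ?C"
    proof (rule insert.IH)
      show "?C \<subseteq> (\<Union>v\<in>F. ball v e)" using insert.prems(3) by auto
    qed (use s insert.prems(1) in auto)
  qed
  also have "\<dots> = b * emeasure N A"
  proof -
    have "emeasure N A = emeasure N ?B + emeasure N ?C"
      using s N by (subst plus_emeasure) (auto intro!: arg_cong[where f="emeasure N"])
    then show ?thesis by (simp add: distrib_left)
  qed
  finally show ?case .
qed simp

lemma one_minus_le_inner:
  fixes u v :: "'a::real_inner"
  assumes "norm v = 1" "norm (u - v) \<le> e"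
  shows "1 - e \<le> u \<bullet> v"
proof -
  have "u \<bullet> v = 1 + (u - v) \<bullet> v" using assms(1) by (simp add: inner_diff_left norm_eq_1)
  moreover have "\<bar>(u - v) \<bullet> v\<bar> \<le> e" using Cauchy_Schwarz_ineq2[of "u - v" v] assms by simp
  ultimately show ?thesis by linarith
qed

section \<open>The Gauss map and the image of the surface measure\<close>

context body
begin

definition regular_points :: "(real ^ 'n) set" where
  "regular_points = frontier K - singular_points K"

text \<open>The default 0 is not on the sphere, so the preimage of a set of unit vectors contains
  only regular points.\<close>

definition gauss_map :: "real ^ 'n \<Rightarrow> real ^ 'n" where
  "gauss_map x = (if x \<in> regular_points then THE u. u \<in> unit_normals K x else 0)"

lemma unit_normals_regular:
  assumes "x \<in> regular_points" shows "unit_normals K x = {gauss_map x}"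
proof -
  obtain u where u: "u \<in> unit_normals K x" and x: "x \<in> K"
    using assms frontier_iff by (auto simp: regular_points_def)
  have uniq: "w = u" if "w \<in> unit_normals K x" for w
    using assms that u x unfolding regular_points_def singular_points_def by blast
  have "(THE u. u \<in> unit_normals K x) = u" using u uniq by (rule the_equality)
  then have gm: "gauss_map x = u" using assms by (simp add: gauss_map_def)
  show ?thesis
    unfolding gm
  proof (intro equalityI subsetI)
    show "w \<in> {u}" if "w \<in> unit_normals K x" for w using uniq[OF that] by simp
    show "w \<in> unit_normals K x" if "w \<in> {u}" for w using that u by simp
  qed
qed

lemma regular_points_borel: "regular_points \<in> sets borel"
  unfolding regular_points_def
  by (intro sets.Diff borel_compact compact_frontier_K singular_points_null(1))

text \<open>For closed sets of normals \<open>compact_normals\<close> describes the preimage;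
  complements then give the open sets.\<close>

lemma gauss_map_measurable: "gauss_map \<in> borel_measurable borel"
proof (rule borel_measurableI)
  fix S :: "(real ^ 'n) set" assume "open S"
  define F where "F = - S"
  have "closed F" using \<open>open S\<close> by (simp add: F_def closed_def)
  have "gauss_map -` F = (regular_points \<inter> {x \<in> K. F \<inter> unit_normals K x \<noteq> {}}) \<union> (if 0 \<in> F then - regular_points else {})"
  proof (rule set_eqI)
    fix x
    show "x \<in> gauss_map -` F \<longleftrightarrow> x \<in> (regular_points \<inter> {x \<in> K. F \<inter> unit_normals K x \<noteq> {}}) \<union> (if 0 \<in> F then - regular_points else {})"
    proof (cases "x \<in> regular_points")
      case True
      then have "x \<in> K" using frontier_iff by (auto simp: regular_points_def)
      then show ?thesis using True unit_normals_regular[OF True] by auto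
    next
      case False then show ?thesis by (auto simp: gauss_map_def)
    qed
  qed
  also have "\<dots> \<in> sets borel"
    using regular_points_borel borel_compact[OF compact_normals[OF \<open>closed F\<close>]] by auto
  finally have "UNIV - gauss_map -` F \<in> sets borel" by (intro sets.Diff) auto
  moreover have "UNIV - gauss_map -` F = gauss_map -` S" by (auto simp: F_def)
  ultimately show "gauss_map -` S \<inter> space borel \<in> sets borel" by simp
qed

definition boundary_gauss :: "(real ^ 'n) measure" where
  "boundary_gauss = density (hausdorff_borel (CARD('n) - 1)) (\<lambda>x. indicator regular_points x * ennreal (gauss_density x))"

lemma sets_boundary_gauss [simp, measurable_cong]: "sets boundary_gauss = sets borel"
  by (simp add: boundary_gauss_def)

lemma emeasure_boundary_gauss:
  assumes A: "A \<in> sets borel"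
  shows "emeasure boundary_gauss A =
    (\<integral>\<^sup>+x. indicator (A \<inter> regular_points) x * ennreal (gauss_density x) \<partial>hausdorff_borel (CARD('n) - 1))"
proof -
  have [measurable]: "regular_points \<in> sets borel" by (rule regular_points_borel)
  have "emeasure boundary_gauss A =
    (\<integral>\<^sup>+x. indicator regular_points x * ennreal (gauss_density x) * indicator A x \<partial>hausdorff_borel (CARD('n) - 1))"
    unfolding boundary_gauss_def
  proof (rule emeasure_density)
    show "(\<lambda>x. indicator regular_points x * ennreal (gauss_density x)) \<in> borel_measurable (hausdorff_borel (CARD('n) - 1))"
      by measurable
  qed (use A in simp)
  also have "\<dots> = (\<integral>\<^sup>+x. indicator (A \<inter> regular_points) x * ennreal (gauss_density x) \<partial>hausdorff_borel (CARD('n) - 1))"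
    by (intro nn_integral_cong) (auto split: split_indicator)
  finally show ?thesis .
qed

lemma finite_boundary_gauss: "finite_measure boundary_gauss"
proof (rule finite_measureI)
  have "emeasure boundary_gauss UNIV \<le> (\<integral>\<^sup>+x. indicator (frontier K) x \<partial>hausdorff_borel (CARD('n) - 1))"
  proof (subst emeasure_boundary_gauss)
    show "(\<integral>\<^sup>+x. indicator (UNIV \<inter> regular_points) x * ennreal (gauss_density x) \<partial>hausdorff_borel (CARD('n) - 1))
      \<le> (\<integral>\<^sup>+x. indicator (frontier K) x \<partial>hausdorff_borel (CARD('n) - 1))"
    proof (rule nn_integral_mono)
      fix x :: "real ^ 'n"
      have "ennreal (gauss_density x) \<le> 1" using gauss_density_le_1 by (simp add: ennreal_le_1)
      then show "indicator (UNIV \<inter> regular_points) x * ennreal (gauss_density x) \<le> indicator (frontier K) x"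
        by (auto simp: regular_points_def split: split_indicator)
    qed
  qed simp
  also have "\<dots> = hausdorff_outer (CARD('n) - 1) (frontier K)"
    using borel_compact[OF compact_frontier_K] by (simp add: emeasure_hausdorff_borel)
  also have "\<dots> < \<infinity>" by (rule hausdorff_frontier_finite)
  finally show "emeasure boundary_gauss (space boundary_gauss) \<noteq> \<infinity>"
    by (simp add: boundary_gauss_def)
qed

text \<open>The Gaussian surface area as an image measure, hence countably additive by
  construction.\<close>

definition sphere_gauss :: "(real ^ 'n) measure" where
  "sphere_gauss = distr boundary_gauss borel gauss_map"

lemma sets_sphere_gauss [simp, measurable_cong]: "sets sphere_gauss = sets borel"
  by (simp add: sphere_gauss_def)

lemma emeasure_sphere_gauss:
  "\<eta> \<in> sets borel \<Longrightarrow> emeasure sphere_gauss \<eta> = emeasure boundary_gauss (gauss_map -` \<eta>)"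
  unfolding sphere_gauss_def using gauss_map_measurable
  by (subst emeasure_distr) (auto simp: boundary_gauss_def)

lemma finite_sphere_gauss: "finite_measure sphere_gauss"
  unfolding sphere_gauss_def using finite_boundary_gauss gauss_map_measurable
  by (intro finite_measure.finite_measure_distr) (auto simp: measurable_cong_sets[OF sets_boundary_gauss refl])

lemma AE_not_singular: "AE x in hausdorff_measure (CARD('n) - 1). x \<notin> singular_points K"
  using singular_points_null
  by (intro AE_not_in) (auto simp: null_sets_def emeasure_hausdorff borel_in_sets_hausdorff)

lemma mem_normal_image_iff:
  assumes "x \<notin> singular_points K" "\<eta> \<subseteq> sphere 0 1"
  shows "x \<in> K \<and> \<eta> \<inter> unit_normals K x \<noteq> {} \<longleftrightarrow> x \<in> gauss_map -` \<eta> \<inter> regular_points"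
proof (cases "x \<in> regular_points")
  case True
  then show ?thesis using unit_normals_regular[OF True] frontier_iff by (auto simp: regular_points_def)
next
  case False
  then show ?thesis using assms frontier_iff by (auto simp: regular_points_def)
qed

text \<open>The reverse image, which need not be Borel, differs from a Borel preimage under the
  Gauss map only at singular points, a null set.\<close>

lemma surface_area_sphere_gauss:
  assumes \<eta>: "\<eta> \<in> sets borel" "\<eta> \<subseteq> sphere 0 1"
  shows "ennreal (1 / sqrt (2 * pi) ^ CARD('n)) *
      (\<integral>\<^sup>+x\<in>reverse_gauss_image K \<eta>. ennreal (exp (- ((norm x)\<^sup>2) / 2)) \<partial>hausdorff_measure (CARD('n) - 1))
    = emeasure sphere_gauss \<eta>"
proof -
  let ?s = "CARD('n) - 1" and ?B = "gauss_map -` \<eta> \<inter> regular_points"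
  let ?e = "\<lambda>x :: real ^ 'n. ennreal (exp (- ((norm x)\<^sup>2) / 2))"
  have B0: "gauss_map -` \<eta> \<in> sets borel" using measurable_sets[OF gauss_map_measurable \<eta>(1)] by simp
  then have [measurable]: "?B \<in> sets borel" using regular_points_borel by simp
  have "(\<integral>\<^sup>+x\<in>reverse_gauss_image K \<eta>. ?e x \<partial>hausdorff_measure ?s) = (\<integral>\<^sup>+x\<in>?B. ?e x \<partial>hausdorff_measure ?s)"
  proof (rule nn_integral_cong_AE, use AE_not_singular in eventually_elim)
    case (elim x)
    then have "x \<in> reverse_gauss_image K \<eta> \<longleftrightarrow> x \<in> ?B"
      using mem_normal_image_iff[OF elim \<eta>(2)] unfolding reverse_gauss_image_eq[OF \<eta>(2)] by simp
    then show ?case by (simp only: indicator_def)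
  qed
  also have "\<dots> = (\<integral>\<^sup>+x. ?e x * indicator ?B x \<partial>hausdorff_borel ?s)"
    unfolding hausdorff_borel_def by (subst nn_integral_distr) (auto simp: id_measurable_hausdorff)
  finally have "ennreal (1 / sqrt (2 * pi) ^ CARD('n)) * (\<integral>\<^sup>+x\<in>reverse_gauss_image K \<eta>. ?e x \<partial>hausdorff_measure ?s)
     = (\<integral>\<^sup>+x. ennreal (1 / sqrt (2 * pi) ^ CARD('n)) * (?e x * indicator ?B x) \<partial>hausdorff_borel ?s)"
    by (simp add: nn_integral_cmult)
  also have "\<dots> = (\<integral>\<^sup>+x. indicator ?B x * ennreal (gauss_density x) \<partial>hausdorff_borel ?s)"
    by (intro nn_integral_cong) (simp add: gauss_density_def ennreal_mult[symmetric] split: split_indicator)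
  also have "\<dots> = emeasure sphere_gauss \<eta>"
    using B0 \<eta> by (simp add: emeasure_sphere_gauss emeasure_boundary_gauss)
  finally show ?thesis .
qed

end

section \<open>Local comparison of the two measures on the sphere, and equality\<close>

context maximizer
begin

text \<open>\<open>flux\<close> is measured by Lebesgue measure on hyperplanes and
  \<open>sphere_gauss\<close> by Hausdorff measure; the division by \<kappa> converts between
  them.\<close>

definition w :: real where "w = gK powr (\<alpha> - 1) / \<kappa>"

lemma w_pos: "0 < w" using gK_pos \<kappa>_pos by (simp add: w_def)

lemma w_\<kappa>: "ennreal w * ennreal \<kappa> = ennreal (gK powr (\<alpha> - 1))"
  using w_pos \<kappa>_pos by (simp add: ennreal_mult[symmetric] w_def)

text \<open>\<open>outer_local\<close> applies to compact sets of regular points whose normals lie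
  in \<eta>, with c = 1 - e. Inner regularity of the boundary measure then exhausts the preimage of
  \<eta>.\<close>

lemma sphere_gauss_local_le:
  assumes v: "norm v = 1" and e: "0 < e" "e < 1" "e * R < r"
    and \<eta>: "\<eta> \<in> sets \<mu>" "\<eta> \<subseteq> ball v e"
  shows "ennreal ((1 - e) ^ (CARD('n) - 1)) * ennreal w * emeasure sphere_gauss \<eta> \<le> emeasure \<mu> \<eta>"
proof -
  let ?s = "CARD('n) - 1" and ?c = "1 - e"
  have \<eta>b: "\<eta> \<in> sets borel" "\<eta> \<subseteq> sphere 0 1" using \<eta> by (auto simp: sets_\<mu>_iff)
  have B0: "gauss_map -` \<eta> \<in> sets borel" using measurable_sets[OF gauss_map_measurable \<eta>b(1)] by simp
  have reg: "gauss_map -` \<eta> \<subseteq> regular_points"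
    using \<eta>b(2) by (auto simp: gauss_map_def split: if_splits)
  have uv: "?c \<le> u \<bullet> v" if "u \<in> \<eta>" for u
    using that \<eta>(2) by (intro one_minus_le_inner[OF v]) (auto simp: dist_norm norm_minus_commute)
  have main: "ennreal (?c ^ ?s) * ennreal w * emeasure boundary_gauss A \<le> emeasure \<mu> \<eta>"
    if A: "A \<subseteq> gauss_map -` \<eta>" "compact A" for A
  proof -
    have AK: "A \<subseteq> K" using A reg frontier_iff by (auto simp: regular_points_def)
    have nrm: "unit_normals K x = {gauss_map x} \<and> gauss_map x \<in> \<eta>" if "x \<in> A" for x
      using that A(1) reg unit_normals_regular by blast
    have c: "0 < ?c" using e by simp
    have Lip: "?c * norm (x - y) \<le> norm (proj_perp v x - proj_perp v y)" if "x \<in> A" "y \<in> A" for x y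
      using that nrm AK uv by (intro normals_Lipschitz[OF v c, where u="gauss_map x" and w="gauss_map y"]) auto
    \<comment> \<open>The normal u at x satisfies x u \<ge> r, and replacing u by v changes the
      inner product by at most R e, which is less than r.\<close>
    have "0 < x \<bullet> v" if x: "x \<in> A" for x
    proof -
      have u: "gauss_map x \<in> unit_normals K x" "gauss_map x \<in> ball v e" using nrm[OF x] \<eta>(2) by auto
      have "\<bar>x \<bullet> (gauss_map x - v)\<bar> \<le> norm x * norm (gauss_map x - v)" by (rule Cauchy_Schwarz_ineq2)
      also have "\<dots> \<le> R * e"
        using u(2) x AK K_outer R_pos e by (intro mult_mono) (auto simp: dist_norm norm_minus_commute)
      finally have "x \<bullet> gauss_map x - x \<bullet> v \<le> R * e" by (simp add: inner_diff_right)
      then show ?thesis using normal_ge[OF u(1)] e(3) by (simp add: mult.commute)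
    qed
    then have "ennreal (gK powr (\<alpha> - 1)) * flux v A \<le> emeasure \<mu> (\<Union>x\<in>A. unit_normals K x)"
      using nrm uv by (intro outer_local[OF v A(2) AK c]) auto
    also have "\<dots> \<le> emeasure \<mu> \<eta>" using \<eta> nrm by (intro emeasure_mono) auto
    finally have 1: "ennreal (gK powr (\<alpha> - 1)) * flux v A \<le> emeasure \<mu> \<eta>" .
    have "A \<inter> regular_points = A" using A(1) reg by blast
    then have "ennreal (?c ^ ?s) * emeasure boundary_gauss A \<le> ennreal \<kappa> * flux v A"
      using graph_integral(2)[OF v c A(2) Lip, of "\<lambda>x. ennreal (gauss_density x)"]
      by (simp add: emeasure_boundary_gauss[OF borel_compact[OF A(2)]] flux_def)
    then have "ennreal w * (ennreal (?c ^ ?s) * emeasure boundary_gauss A) \<le> ennreal w * (ennreal \<kappa> * flux v A)"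
      by (rule mult_left_mono) simp
    also have "\<dots> = ennreal (gK powr (\<alpha> - 1)) * flux v A"
      unfolding mult.assoc[symmetric] w_\<kappa> ..
    finally show ?thesis using 1 by (simp add: mult_ac)
  qed
  have "emeasure boundary_gauss (gauss_map -` \<eta>) = (SUP A\<in>{A. A \<subseteq> gauss_map -` \<eta> \<and> compact A}. emeasure boundary_gauss A)"
    using finite_measure.emeasure_finite[OF finite_boundary_gauss] B0 by (intro inner_regular) auto
  then have "ennreal (?c ^ ?s) * ennreal w * emeasure sphere_gauss \<eta> =
      (SUP A\<in>{A. A \<subseteq> gauss_map -` \<eta> \<and> compact A}. ennreal (?c ^ ?s) * ennreal w * emeasure boundary_gauss A)"
    by (simp add: emeasure_sphere_gauss[OF \<eta>b(1)] SUP_mult_left_ennreal)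
  also have "\<dots> \<le> emeasure \<mu> \<eta>" by (rule SUP_least) (use main in auto)
  finally show ?thesis .
qed

text \<open>\<open>inner_local\<close> bounds the mass of compact subsets of \<eta>, and inner
  regularity of \<mu> extends this to \<eta>. One factor 1/(1 - e) comes from the fibre length; the
  projection does not increase area, so the passage to Hausdorff measure costs nothing.\<close>

lemma sphere_gauss_local_ge:
  assumes v: "norm v = 1" and e: "0 < e" "e < 1"
    and \<eta>: "\<eta> \<in> sets \<mu>" "\<eta> \<subseteq> ball v e"
  shows "emeasure \<mu> \<eta> \<le> ennreal (1 / (1 - e)) * ennreal w * emeasure sphere_gauss \<eta>"
proof -
  interpret finite_measure \<mu> by (rule finite_\<mu>)
  let ?s = "CARD('n) - 1" and ?c = "1 - e"
  have \<eta>b: "\<eta> \<in> sets borel" "\<eta> \<subseteq> sphere 0 1" using \<eta> by (auto simp: sets_\<mu>_iff)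
  have uv: "?c \<le> u \<bullet> v" if "u \<in> \<eta>" for u
    using that \<eta>(2) by (intro one_minus_le_inner[OF v]) (auto simp: dist_norm norm_minus_commute)
  have main: "emeasure \<mu> C \<le> ennreal (1 / ?c) * ennreal w * emeasure sphere_gauss \<eta>"
    if C: "C \<subseteq> \<eta>" "compact C" for C
  proof -
    let ?A = "normal_preimage C"
    have c: "0 < ?c" using e by simp
    have Cs: "C \<subseteq> sphere 0 1" using C \<eta>b by auto
    have Cb: "C \<in> sets borel" using C(2) by (rule borel_compact)
    have cv: "?c \<le> u \<bullet> v" if "u \<in> C" for u using uv that C(1) by auto
    have cA: "compact ?A" unfolding normal_preimage_def using C by (intro compact_normals compact_imp_closed)
    have B0: "gauss_map -` C \<in> sets borel" using measurable_sets[OF gauss_map_measurable Cb] by simp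
    have "ennreal \<kappa> * flux v ?A \<le> (\<integral>\<^sup>+x. indicator ?A x * ennreal (gauss_density x) \<partial>hausdorff_borel ?s)"
      unfolding flux_def
      by (rule graph_integral(1)[OF v c cA normal_preimage_Lipschitz[OF v c cv]]) auto
    also have "\<dots> = (\<integral>\<^sup>+x. indicator (gauss_map -` C \<inter> regular_points) x * ennreal (gauss_density x) \<partial>hausdorff_borel ?s)"
    proof (rule nn_integral_cong_AE)
      have "AE x in hausdorff_borel ?s. x \<notin> singular_points K"
        using singular_points_null by (intro AE_not_in) (auto simp: null_sets_def emeasure_hausdorff_borel)
      then show "AE x in hausdorff_borel ?s. indicator ?A x * ennreal (gauss_density x) =
          indicator (gauss_map -` C \<inter> regular_points) x * ennreal (gauss_density x)"
      proof eventually_elim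
        case (elim x)
        then have "x \<in> ?A \<longleftrightarrow> x \<in> gauss_map -` C \<inter> regular_points"
          using mem_normal_image_iff[OF elim Cs] by (simp add: normal_preimage_def)
        then show ?case by (simp only: indicator_def)
      qed
    qed
    also have "\<dots> = emeasure sphere_gauss C"
      using B0 by (simp add: emeasure_sphere_gauss[OF Cb] emeasure_boundary_gauss)
    also have "\<dots> \<le> emeasure sphere_gauss \<eta>" using C \<eta>b by (intro emeasure_mono) auto
    finally have 1: "ennreal \<kappa> * flux v ?A \<le> emeasure sphere_gauss \<eta>" .
    have "emeasure \<mu> C \<le> ennreal (gK powr (\<alpha> - 1) / ?c) * flux v ?A"
      using cv by (rule inner_local[OF v C(2) Cs c])
    also have "ennreal (gK powr (\<alpha> - 1) / ?c) = ennreal (1 / ?c) * ennreal (gK powr (\<alpha> - 1))"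
      using c by (simp add: ennreal_mult[symmetric])
    also have "\<dots> * flux v ?A = ennreal (1 / ?c) * ennreal w * (ennreal \<kappa> * flux v ?A)"
      unfolding w_\<kappa>[symmetric] by (simp only: mult.assoc)
    also have "\<dots> \<le> ennreal (1 / ?c) * ennreal w * emeasure sphere_gauss \<eta>"
      using 1 by (rule mult_left_mono) simp
    finally show ?thesis .
  qed
  \<comment> \<open>Inner regularity is applied to a Borel measure on the whole space, so \<mu> is
    extended from the sphere.\<close>
  define \<mu>' where "\<mu>' = distr \<mu> borel (\<lambda>x. x)"
  have id: "(\<lambda>x. x) \<in> borel_measurable \<mu>" by (rule measurable_\<mu>) simp
  have \<mu>': "emeasure \<mu>' A = emeasure \<mu> A" if "A \<in> sets borel" "A \<subseteq> sphere 0 1" for A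
    unfolding \<mu>'_def using that id by (subst emeasure_distr) (auto simp: space_\<mu> Int_absorb2)
  have "emeasure \<mu>' \<eta> = (SUP C\<in>{C. C \<subseteq> \<eta> \<and> compact C}. emeasure \<mu>' C)"
  proof (rule inner_regular)
    show "emeasure \<mu>' (space \<mu>') \<noteq> \<infinity>"
      unfolding \<mu>'_def using id by (subst emeasure_distr) auto
  qed (use \<eta>b in \<open>auto simp: \<mu>'_def\<close>)
  also have "\<dots> \<le> ennreal (1 / ?c) * ennreal w * emeasure sphere_gauss \<eta>"
  proof (rule SUP_least)
    fix C assume "C \<in> {C. C \<subseteq> \<eta> \<and> compact C}"
    then have C: "C \<subseteq> \<eta>" "compact C" by auto
    then have "emeasure \<mu>' C = emeasure \<mu> C" using \<eta>b by (intro \<mu>') (auto intro: borel_compact)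
    then show "emeasure \<mu>' C \<le> ennreal (1 / ?c) * ennreal w * emeasure sphere_gauss \<eta>" using main[OF C] by simp
  qed
  finally show ?thesis using \<mu>'[OF \<eta>b] by simp
qed

text \<open>For each small e finitely many balls of radius e cover the sphere, so the local
  inequalities hold for \<eta> itself; their factors tend to 1 with e.\<close>

lemma \<mu>_eq_sphere_gauss:
  assumes \<eta>: "\<eta> \<in> sets \<mu>"
  shows "emeasure \<mu> \<eta> = ennreal w * emeasure sphere_gauss \<eta>"
proof -
  interpret finite_measure \<mu> by (rule finite_\<mu>)
  let ?s = "CARD('n) - 1"
  define G where "G = restrict_space sphere_gauss (sphere 0 1)"
  have \<eta>b: "\<eta> \<in> sets borel" "\<eta> \<subseteq> sphere 0 1" using \<eta> by (auto simp: sets_\<mu>_iff)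
  have G_sets: "sets G = sets \<mu>"
    unfolding G_def sets_\<mu> sphere_borel_def by (rule sets_restrict_space_cong) simp
  have G: "emeasure G A = emeasure sphere_gauss A" if "A \<in> sets \<mu>" for A
    unfolding G_def using that by (intro emeasure_restrict_space) (auto simp: sets_\<mu>_iff)
  define a where "a = measure sphere_gauss \<eta>"
  have a: "emeasure sphere_gauss \<eta> = ennreal a"
    unfolding a_def by (rule finite_measure.emeasure_eq_measure[OF finite_sphere_gauss])
  \<comment> \<open>For e below b both e < 1 and e R < r hold, as the local estimates
    require.\<close>
  define b where "b = min 1 (r / R)"
  have b: "0 < b" "b \<le> 1" using r_pos R_pos by (auto simp: b_def)
  have main: "(1 - e) ^ ?s * w * a \<le> measure \<mu> \<eta> \<and> measure \<mu> \<eta> \<le> 1 / (1 - e) * w * a" if e: "0 < e" "e < b" for e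
  proof -
    have e1: "e < 1" "e * R < r" using e R_pos by (auto simp: b_def pos_less_divide_eq)
    obtain F where F: "F \<subseteq> sphere (0 :: real ^ 'n) 1" "finite F" "sphere 0 1 \<subseteq> (\<Union>v\<in>F. ball v e)"
    proof (rule compactE_image[OF compact_sphere, of "sphere (0 :: real ^ 'n) 1" "\<lambda>v. ball v e"])
      show "sphere (0 :: real ^ 'n) 1 \<subseteq> (\<Union>v\<in>sphere 0 1. ball v e)" using e by force
    qed (use that in auto)
    have ball: "A \<inter> ball v e \<in> sets \<mu>" if "A \<in> sets \<mu>" for A v
      using that by (auto simp: sets_\<mu>_iff)
    have cov: "\<eta> \<subseteq> (\<Union>v\<in>F. ball v e)" using \<eta>b F(3) by auto
    have "ennreal ((1 - e) ^ ?s) * ennreal w * emeasure G \<eta> \<le> 1 * emeasure \<mu> \<eta>"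
    proof (rule local_le_imp_le[OF F(2) _ _ _ _ _ cov])
      fix A v assume A: "A \<in> sets G" "v \<in> F" "A \<subseteq> ball v e"
      then have "norm v = 1" using F(1) by auto
      then show "ennreal ((1 - e) ^ ?s) * ennreal w * emeasure G A \<le> 1 * emeasure \<mu> A"
        using sphere_gauss_local_le[of v e A] A e e1 G G_sets by simp
    qed (use G_sets ball \<eta> in \<open>auto simp: sets_\<mu>_iff\<close>)
    then have "ennreal ((1 - e) ^ ?s * w * a) \<le> ennreal (measure \<mu> \<eta>)"
      using e1 w_pos by (simp add: G[OF \<eta>] a emeasure_eq_measure ennreal_mult a_def)
    then have 1: "(1 - e) ^ ?s * w * a \<le> measure \<mu> \<eta>" by simp
    have "1 * emeasure \<mu> \<eta> \<le> ennreal (1 / (1 - e)) * ennreal w * emeasure G \<eta>"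
    proof (rule local_le_imp_le[OF F(2) _ _ _ _ _ cov])
      fix A v assume A: "A \<in> sets \<mu>" "v \<in> F" "A \<subseteq> ball v e"
      then have "norm v = 1" using F(1) by auto
      then show "1 * emeasure \<mu> A \<le> ennreal (1 / (1 - e)) * ennreal w * emeasure G A"
        using sphere_gauss_local_ge[of v e A] A e e1 G by simp
    qed (use G_sets ball \<eta> in \<open>auto simp: sets_\<mu>_iff\<close>)
    then have "ennreal (measure \<mu> \<eta>) \<le> ennreal (1 / (1 - e) * w * a)"
      using e1 w_pos by (simp add: G[OF \<eta>] a emeasure_eq_measure ennreal_mult[symmetric] a_def)
    then have "measure \<mu> \<eta> \<le> 1 / (1 - e) * w * a"
      using e1 w_pos by (subst (asm) ennreal_le_iff) (auto simp: a_def)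
    with 1 show ?thesis by simp
  qed
  have ev: "\<forall>\<^sub>F e in at_right 0. 0 < e \<and> e < b"
    unfolding eventually_at_right_field using b by (intro exI[of _ b]) auto
  have "((\<lambda>e. (1 - e) ^ ?s * w * a) \<longlongrightarrow> (1 - 0) ^ ?s * w * a) (at_right 0)" by (intro tendsto_intros)
  moreover have "\<forall>\<^sub>F e in at_right 0. (1 - e) ^ ?s * w * a \<le> measure \<mu> \<eta>"
    using ev by eventually_elim (use main in blast)
  ultimately have 1: "(1 - 0) ^ ?s * w * a \<le> measure \<mu> \<eta>" by (rule tendsto_upperbound) simp
  have "((\<lambda>e. 1 / (1 - e) * w * a) \<longlongrightarrow> 1 / (1 - 0) * w * a) (at_right 0)" by (intro tendsto_intros) auto
  moreover have "\<forall>\<^sub>F e in at_right 0. measure \<mu> \<eta> \<le> 1 / (1 - e) * w * a"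
    using ev by eventually_elim (use main in blast)
  ultimately have 2: "measure \<mu> \<eta> \<le> 1 / (1 - 0) * w * a" by (rule tendsto_lowerbound) simp
  have "measure \<mu> \<eta> = w * a" using 1 2 by simp
  then show ?thesis using w_pos by (simp add: emeasure_eq_measure a ennreal_mult a_def)
qed

end

text \<open>\<open>measure_of\<close> returns the given set function only if that function is a
  measure; countable additivity is inherited from \<open>sphere_gauss\<close>, with which it agrees
  on Borel subsets of the sphere.\<close>

lemma (in body) emeasure_gaussian_surface_area:
  assumes \<eta>: "\<eta> \<in> sets sphere_borel"
  shows "emeasure (gaussian_surface_area K) \<eta> = emeasure sphere_gauss \<eta>"
proof -
  let ?f = "\<lambda>\<eta>. ennreal (1 / sqrt (2 * pi) ^ CARD('n)) *
      (\<integral>\<^sup>+x\<in>reverse_gauss_image K \<eta>. ennreal (exp (- ((norm x)\<^sup>2) / 2)) \<partial>hausdorff_measure (CARD('n) - 1))"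
  have sb: "A \<in> sets borel \<and> A \<subseteq> sphere 0 1" if "A \<in> sets sphere_borel" for A :: "(real ^ 'n) set"
    using that unfolding sphere_borel_def by (subst (asm) sets_restrict_space_iff) auto
  have f: "?f A = emeasure sphere_gauss A" if "A \<in> sets sphere_borel" for A
    using sb[OF that] by (intro surface_area_sphere_gauss) auto
  have sp: "space sphere_borel = sphere (0 :: real ^ 'n) 1" by (simp add: sphere_borel_def space_restrict_space)
  have "emeasure (gaussian_surface_area K) \<eta> = ?f \<eta>"
    unfolding gaussian_surface_area_def
  proof (rule emeasure_measure_of_sigma[OF _ _ _ \<eta>])
    show "sigma_algebra (sphere 0 1) (sets (sphere_borel :: (real ^ 'n) measure))"
      using sets.sigma_algebra_axioms[of "sphere_borel :: (real ^ 'n) measure"] by (simp add: sp)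
    show "positive (sets sphere_borel) ?f"
      using f[of "{}"] by (simp add: positive_def)
    show "countably_additive (sets sphere_borel) ?f"
    proof (rule countably_additiveI)
      fix A :: "nat \<Rightarrow> (real ^ 'n) set"
      assume A: "range A \<subseteq> sets sphere_borel" "disjoint_family A" "(\<Union>i. A i) \<in> sets sphere_borel"
      have "(\<Sum>i. ?f (A i)) = (\<Sum>i. emeasure sphere_gauss (A i))" using A by (intro suminf_cong f) auto
      also have "\<dots> = emeasure sphere_gauss (\<Union>i. A i)" using A sb by (intro suminf_emeasure) auto
      also have "\<dots> = ?f (\<Union>i. A i)" using f[OF A(3)] by simp
      finally show "(\<Sum>i. ?f (A i)) = ?f (\<Union>i. A i)" .
    qed
  qed
  then show ?thesis using f[OF \<eta>] by simp
qed

theorem theorem1p2: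
  fixes \<mu> :: "(real ^ 'n) measure" and \<alpha> :: real
  assumes "sets \<mu> = sets sphere_borel"
    and "finite_measure \<mu>"
    and "even_measure \<mu>"
    and "not_concentrated_in_hemisphere \<mu>"
    and "0 < \<alpha>" and "\<alpha> < 1 / real CARD('n)"
  shows "\<exists>K :: (real ^ 'n) set. convex_body K \<and> o_symmetric K \<and>
           \<mu> = scale_measure (ennreal (1 / measure gaussian_measure K powr (1 - \<alpha>)))
                 (gaussian_surface_area K)"
proof -
  obtain \<kappa> :: real where \<kappa>: "0 < \<kappa>"
    "\<And>(v :: real ^ 'n) A. norm v = 1 \<Longrightarrow> A \<in> sets borel \<Longrightarrow> A \<subseteq> {y. y \<bullet> v = 0} \<Longrightarrow>
      hausdorff_outer (CARD('n) - 1) A = ennreal \<kappa> * emeasure (perp_lebesgue v) A"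
    using hausdorff_hyperplane_constant by blast
  \<comment> \<open>Maximizing for \<mu>/\<kappa> produces the factor \<open>M.w\<close> with its
    denominator \<kappa>; multiplying back by \<kappa> leaves gamma(K)^(\<alpha>-1).\<close>
  define \<mu>' where "\<mu>' = scale_measure (ennreal (1 / \<kappa>)) \<mu>"
  have e\<mu>': "emeasure \<mu>' A = ennreal (1 / \<kappa>) * emeasure \<mu> A" for A by (simp add: \<mu>'_def)
  have s\<mu>': "sets \<mu>' = sets \<mu>" by (simp add: \<mu>'_def)
  have "finite_measure \<mu>'"
    using finite_measure.emeasure_finite[OF assms(2)]
    by (intro finite_measureI) (simp add: e\<mu>' ennreal_mult_eq_top_iff)
  then interpret S: sphere_measure \<mu>'
    by (intro sphere_measure.intro) (simp_all add: s\<mu>' assms(1))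
  have "not_concentrated_in_hemisphere \<mu>'"
    using assms(4) \<kappa>(1) by (auto simp: not_concentrated_in_hemisphere_def e\<mu>' ennreal_zero_less_mult_iff)
  then obtain K where K: "sym_convex K" "interior K \<noteq> {}"
    "\<And>L. sym_convex L \<Longrightarrow> gauss_functional \<mu>' \<alpha> L \<le> gauss_functional \<mu>' \<alpha> K"
    using S.gauss_functional_maximizer[OF _ assms(5,6)] by blast
  have Ksym: "\<And>x. x \<in> K \<Longrightarrow> - x \<in> K" and Kc: "compact K" "convex K"
    using K(1) by (auto simp: sym_convex_def)
  have eqK: "uminus ` K = K" using Ksym by (force simp: image_iff)
  obtain r where r: "0 < r" "cball 0 r \<subseteq> K"
  proof -
    obtain x where x: "x \<in> interior K" using K(2) by blast
    then have "- x \<in> uminus ` interior K" by blast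
    also have "uminus ` interior K = interior (uminus ` K)" by (simp add: interior_negations)
    finally have mx: "- x \<in> interior K" by (simp add: eqK)
    \<comment> \<open>The origin is the midpoint of an interior point and its mirror image.\<close>
    have "(1 / 2) *\<^sub>R x + (1 / 2) *\<^sub>R (- x) \<in> interior K"
      by (rule convexD[OF convex_interior[OF Kc(2)] x mx]) auto
    then have "0 \<in> interior K" by simp
    then show ?thesis using that by (meson mem_interior_cball)
  qed
  obtain R where R: "K \<subseteq> cball 0 R"
  proof -
    obtain R where "\<forall>x\<in>K. norm x \<le> R" using compact_imp_bounded[OF Kc(1)] unfolding bounded_iff by blast
    then show ?thesis by (intro that[of R]) auto
  qed
  interpret M: maximizer \<kappa> "TYPE('n)" K r R \<mu>' \<alpha>
  proof
    show "\<alpha> < 1"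
    proof -
      have "1 / real CARD('n) \<le> 1" by simp
      then show ?thesis using assms(6) by linarith
    qed
    show "emeasure \<mu>' (uminus ` \<eta>) = emeasure \<mu>' \<eta>" if "\<eta> \<in> sets \<mu>'" for \<eta>
      using assms(3) that by (simp add: even_measure_def e\<mu>' s\<mu>')
  qed (use \<kappa> Kc r R Ksym K(3) assms(5) in auto)
  show ?thesis
  proof (intro exI conjI)
    show "convex_body K" using Kc K(2) by (simp add: convex_body_def)
    show "o_symmetric K" using eqK by (simp add: o_symmetric_def)
    show "\<mu> = scale_measure (ennreal (1 / measure gaussian_measure K powr (1 - \<alpha>))) (gaussian_surface_area K)"
    proof (rule measure_eqI)
      have "sets (gaussian_surface_area K) = sets sphere_borel"
        unfolding gaussian_surface_area_def
        using sets.sets_measure_of_eq[of "sphere_borel :: (real ^ 'n) measure"]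
        by (simp add: sphere_borel_def space_restrict_space)
      then show "sets \<mu> = sets (scale_measure (ennreal (1 / measure gaussian_measure K powr (1 - \<alpha>))) (gaussian_surface_area K))"
        using assms(1) by simp
      fix \<eta> assume \<eta>: "\<eta> \<in> sets \<mu>"
      have "emeasure \<mu> \<eta> = ennreal \<kappa> * emeasure \<mu>' \<eta>"
        unfolding e\<mu>' using \<kappa>(1) by (simp add: mult.assoc[symmetric] ennreal_mult[symmetric])
      also have "\<dots> = ennreal \<kappa> * (ennreal M.w * emeasure M.sphere_gauss \<eta>)"
        using M.\<mu>_eq_sphere_gauss[of \<eta>] \<eta> s\<mu>' by simp
      also have "\<dots> = ennreal (M.gK powr (\<alpha> - 1)) * emeasure M.sphere_gauss \<eta>"
        unfolding M.w_\<kappa>[symmetric] by (simp only: mult_ac)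
      also have "M.gK powr (\<alpha> - 1) = 1 / measure gaussian_measure K powr (1 - \<alpha>)"
        by (simp add: M.gK_def powr_minus_divide[symmetric])
      also have "emeasure M.sphere_gauss \<eta> = emeasure (gaussian_surface_area K) \<eta>"
        using M.emeasure_gaussian_surface_area[of \<eta>] \<eta> assms(1) by simp
      finally show "emeasure \<mu> \<eta> = emeasure (scale_measure (ennreal (1 / measure gaussian_measure K powr (1 - \<alpha>))) (gaussian_surface_area K)) \<eta>"
        by simp
    qed
  qed
qed

end
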